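(* Let $M$ be a 3-manifold with a strict path structure $(E^1,E^2,\theta)$, let $Y_1\to M$ be its coframe bundle, and let $Y_2\to M$ be the coframe bundle of the enriched path structure whose transverse line is spanned by the Reeb vector field of $\theta$. There exists a unique embedding $\iota_1:Y_1\to Y_2$ satisfying $\iota_1^*(\omega)=\omega$, $\iota_1^*(\omega^1)=\omega^1$ and $\iota_1^*(\omega^2)=\omega^2$. Moreover, for this embedding, $\iota_1^*(\phi)=0$ and $\iota_1^*(w)=w$. (By abuse of language the forms of $Y_1$ and $Y_2$ are written with the same letters: inside $\iota_1^*(\cdot)$ they are the forms of $Y_2$, and on the right-hand sides they are the forms of $Y_1$.)
   Context: A path structure on a 3-manifold $M$ is a pair of line subbundles $E^1,E^2\subset TM$ with $E^1\cap E^2=\{0\}$ and $D=E^1\oplus E^2$ a contact distribution. A strict path structure $(E^1,E^2,\theta)$ is a path structure with a fixed contact form $\theta$, $\ker\theta=D$. The Reeb vector field $R$ is defined by $\theta(R)=1$, $\iota_Rd\theta=0$. An enriched path structure is a path structure together with a line field $L$ transverse to $D$; here $L$ is spanned by $R$. Bundle $Y_1$: choose locally $X_1\in E^1$, $X_2\in E^2$ with $d\theta(X_1,X_2)=1$ and let $(\theta^1,\theta^2,\theta)$ be the coframe dual to $(X_1,X_2,R)$, so that $d\theta=\theta^1\wedge\theta^2$. $Y_1$ is the $\mathbb R^*$-coframe bundle whose fibre over $x$ is the set of coframes $(\omega,\omega^1,\omega^2)=(\theta(x),a^3\theta^1(x),a^{-3}\theta^2(x))$, $a\in\mathbb R^*$.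 The tautological 1-forms on $Y_1$ are denoted by the same letters $\omega,\omega^1,\omega^2$, and $w$ is the unique 1-form on $Y_1$ (the connection form) with $$d\omega=\omega^1\wedge\omega^2,\quad d\omega^1=3w\wedge\omega^1+\omega\wedge\tau^1,\quad d\omega^2=-3w\wedge\omega^2-\omega\wedge\tau^2,$$ where $\tau^1\wedge\omega^2=\tau^2\wedge\omega^1=0$. Bundle $Y_2$ of an enriched path structure $(T^1,T^2,L)$, with $D=T^1\oplus T^2$ (here $T^i=E^i$): let $(\theta^1,\theta^2,\theta)$ be the coframe dual to a frame $X_1\in T^1$, $X_2\in T^2$, $X\in L$. One considers the coframes $\omega=\lambda\theta$, $\omega^1=a^1\theta^1$, $\omega^2=a^2\theta^2$ with $a^1,a^2,\lambda>0$ (positivity being supposed for simplicity) which satisfy $d\omega|_D=(\omega^1\wedge\omega^2)|_D$ (for an extension of $\omega$ with kernel $D$). $Y_2$ is the bundle of these coframes $(\omega,\omega^1,\omega^2)$, called an $(\mathbb R^* )^2$-coframe bundle; the structure group acts by $(\omega,\omega^1,\omega^2)\mapsto(\lambda\omega,a^1\omega^1,a^2\omega^2)$ with $\lambda,a^1,a^2\in\mathbb R_+^*$ and $a^1a^2=\lambda$. The tautological 1-forms on $Y_2$ are again denoted $\omega,\omega^1,\omega^2$, and $\phi,w$ are the unique 1-forms on $Y_2$ (connection forms) with $$d\omega=2\phi\wedge\omega+\omega^1\wedge\omega^2,\quad d\omega^1=\phi\wedge\omega^1+3w\wedge\omega^1+\omega\wedge\tau^1,\quad d\omega^2=\phi\wedge\omega^2-3w\wedge\omega^2-\omega\wedge\tau^2,$$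 where $\tau^1=\tau^1_2\omega^2$ and $\tau^2=\tau^2_1\omega^1$ for some functions $\tau^1_2,\tau^2_1$ on $Y_2$.
   Formalization: Embeddings are required to cover the identity of M (otherwise lifts of automorphisms, e.g. Heisenberg translations, break uniqueness), and Y_2 has full (R^* )^2 fibres, with frames of any sign (with positive scalings of one fixed frame, coframes of Y_1 with a<0 would not lie in Y_2). *)

theory Defs
  imports "HOL-Analysis.Analysis"
begin

section \<open>Smooth maps between normed spaces\<close>

text \<open>Used for open \<open>S\<close> and finite-dimensional domains only, where being \<open>C^k\<close> is
  equivalent to the existence and continuity of all iterated directional derivatives up to order \<open>k\<close>.\<close>

primrec Ck_on :: "nat \<Rightarrow> 'e::real_normed_vector set \<Rightarrow> ('e \<Rightarrow> 'f::real_normed_vector) \<Rightarrow> bool" where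
  "Ck_on 0 S f \<longleftrightarrow> continuous_on S f"
| "Ck_on (Suc k) S f \<longleftrightarrow> (\<forall>x\<in>S. f differentiable (at x)) \<and>
     (\<forall>v. Ck_on k S (\<lambda>x. frechet_derivative f (at x) v))"

definition smooth_on :: "'e::real_normed_vector set \<Rightarrow> ('e \<Rightarrow> 'f::real_normed_vector) \<Rightarrow> bool" where
  "smooth_on S f \<longleftrightarrow> (\<forall>k. Ck_on k S f)"


section \<open>Smooth manifolds\<close>

text \<open>A manifold is given by an atlas, which need not be maximal. Its points and its topology are
  those determined by the charts.\<close>

type_synonym ('a, 'e) chart = "'a set \<times> ('a \<Rightarrow> 'e)"

definition points :: "('a, 'e) chart set \<Rightarrow> 'a set" where
  "points A = (\<Union>(U, \<phi>)\<in>A. U)"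

definition mtop :: "('a, 'e::euclidean_space) chart set \<Rightarrow> 'a topology" where
  "mtop A = topology (\<lambda>W. W \<subseteq> points A \<and> (\<forall>(U, \<phi>)\<in>A. open (\<phi> ` (U \<inter> W))))"

definition smooth_manifold :: "('a, 'e::euclidean_space) chart set \<Rightarrow> bool" where
  "smooth_manifold A \<longleftrightarrow>
     (\<forall>(U, \<phi>)\<in>A. inj_on \<phi> U \<and> open (\<phi> ` U)) \<and>
     (\<forall>(U, \<phi>)\<in>A. \<forall>(V, \<psi>)\<in>A.
        open (\<phi> ` (U \<inter> V)) \<and> smooth_on (\<phi> ` (U \<inter> V)) (\<psi> \<circ> inv_into U \<phi>)) \<and>
     Hausdorff_space (mtop A) \<and> second_countable (mtop A)"

definition smooth_map ::
  "('a, 'e::euclidean_space) chart set \<Rightarrow> ('b, 'f::euclidean_space) chart set \<Rightarrow> ('a \<Rightarrow> 'b) \<Rightarrow> bool" where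
  "smooth_map A B f \<longleftrightarrow> continuous_map (mtop A) (mtop B) f \<and>
     (\<forall>(U, \<phi>)\<in>A. \<forall>(V, \<psi>)\<in>B. smooth_on (\<phi> ` (U \<inter> f -` V)) (\<psi> \<circ> f \<circ> inv_into U \<phi>))"

definition smooth_fun_on :: "('a, 'e::euclidean_space) chart set \<Rightarrow> 'a set \<Rightarrow> ('a \<Rightarrow> real) \<Rightarrow> bool" where
  "smooth_fun_on A W f \<longleftrightarrow> (\<forall>(U, \<phi>)\<in>A. smooth_on (\<phi> ` (U \<inter> W)) (f \<circ> inv_into U \<phi>))"

definition smooth_near :: "('a, 'e::euclidean_space) chart set \<Rightarrow> 'a \<Rightarrow> ('a \<Rightarrow> real) \<Rightarrow> bool" where
  "smooth_near A p f \<longleftrightarrow> (\<exists>W. openin (mtop A) W \<and> p \<in> W \<and> smooth_fun_on A W f)"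


subsection \<open>Tangent vectors\<close>

text \<open>A tangent vector at \<open>p\<close> is a derivation \<open>f \<mapsto> \<Sum>\<^sub>i h\<^sub>i (\<partial>f/\<partial>x\<^sub>i)(p)\<close> acting on the functions that are
  smooth near \<open>p\<close>. It is extended by zero to all other functions, so that equality of
  derivations is equality of HOL functions.\<close>

type_synonym 'a tvec = "('a \<Rightarrow> real) \<Rightarrow> real"

definition chart_vec ::
  "('a, 'e::euclidean_space) chart set \<Rightarrow> ('a, 'e) chart \<Rightarrow> 'a \<Rightarrow> 'e \<Rightarrow> 'a tvec" where
  "chart_vec A c p h = (\<lambda>f. if smooth_near A p f
     then frechet_derivative (f \<circ> inv_into (fst c) (snd c)) (at (snd c p)) h else 0)"

definition tangent_space :: "('a, 'e::euclidean_space) chart set \<Rightarrow> 'a \<Rightarrow> 'a tvec set" where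
  "tangent_space A p = {chart_vec A c p h | c h. c \<in> A \<and> p \<in> fst c}"

definition vzero :: "'a tvec" where
  "vzero = (\<lambda>f. 0)"

definition vadd :: "'a tvec \<Rightarrow> 'a tvec \<Rightarrow> 'a tvec" where
  "vadd u v = (\<lambda>f. u f + v f)"

definition vscale :: "real \<Rightarrow> 'a tvec \<Rightarrow> 'a tvec" where
  "vscale c v = (\<lambda>f. c * v f)"

text \<open>The differential of \<open>F\<close> at \<open>p\<close>.\<close>

definition tangent_map :: "('b, 'f::euclidean_space) chart set \<Rightarrow> ('a \<Rightarrow> 'b) \<Rightarrow> 'a \<Rightarrow> 'a tvec \<Rightarrow> 'b tvec" where
  "tangent_map B F p v = (\<lambda>g. if smooth_near B (F p) g then v (g \<circ> F) else 0)"

definition vector_field_on :: "('a, 'e::euclidean_space) chart set \<Rightarrow> 'a set \<Rightarrow> ('a \<Rightarrow> 'a tvec) \<Rightarrow> bool" where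
  "vector_field_on A W X \<longleftrightarrow> (\<forall>(U, \<phi>)\<in>A. \<exists>\<xi>. smooth_on (\<phi> ` (U \<inter> W)) \<xi> \<and>
     (\<forall>p\<in>U \<inter> W. X p = chart_vec A (U, \<phi>) p (\<xi> (\<phi> p))))"


subsection \<open>One-forms\<close>

text \<open>Covectors at \<open>p\<close> are extended by zero outside the tangent space at \<open>p\<close>.\<close>

type_synonym 'a covec = "'a tvec \<Rightarrow> real"

definition cotangent_space :: "('a, 'e::euclidean_space) chart set \<Rightarrow> 'a \<Rightarrow> 'a covec set" where
  "cotangent_space A p = {\<alpha>.
     (\<forall>u\<in>tangent_space A p. \<forall>v\<in>tangent_space A p. \<alpha> (vadd u v) = \<alpha> u + \<alpha> v) \<and>
     (\<forall>c. \<forall>v\<in>tangent_space A p. \<alpha> (vscale c v) = c * \<alpha> v) \<and>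
     (\<forall>v. v \<notin> tangent_space A p \<longrightarrow> \<alpha> v = 0)}"

text \<open>The coefficient of \<open>\<alpha>\<close> along the constant direction \<open>h\<close> in a chart.\<close>

definition form_coeff ::
  "('a, 'e::euclidean_space) chart set \<Rightarrow> ('a, 'e) chart \<Rightarrow> ('a \<Rightarrow> 'a covec) \<Rightarrow> 'e \<Rightarrow> 'e \<Rightarrow> real" where
  "form_coeff A c \<alpha> h y =
     (let p = inv_into (fst c) (snd c) y in \<alpha> p (chart_vec A c p h))"

definition one_form_on :: "('a, 'e::euclidean_space) chart set \<Rightarrow> 'a set \<Rightarrow> ('a \<Rightarrow> 'a covec) \<Rightarrow> bool" where
  "one_form_on A W \<alpha> \<longleftrightarrow> (\<forall>p\<in>W. \<alpha> p \<in> cotangent_space A p) \<and>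
     (\<forall>(U, \<phi>)\<in>A. \<forall>h. smooth_on (\<phi> ` (U \<inter> W)) (form_coeff A (U, \<phi>) \<alpha> h))"

abbreviation one_form :: "('a, 'e::euclidean_space) chart set \<Rightarrow> ('a \<Rightarrow> 'a covec) \<Rightarrow> bool" where
  "one_form A \<equiv> one_form_on A (points A)"

text \<open>Convention: \<open>d\<alpha>(X,Y) = X(\<alpha>(Y)) - Y(\<alpha>(X)) - \<alpha>([X,Y])\<close> and
  \<open>(\<alpha> \<and> \<beta>)(u,v) = \<alpha>(u)\<beta>(v) - \<alpha>(v)\<beta>(u)\<close>. The value of \<open>d\<alpha>\<close> is computed with constant
  vector fields in a chart, whose bracket vanishes; it does not depend on the chart.\<close>

definition ext_d ::
  "('a, 'e::euclidean_space) chart set \<Rightarrow> ('a \<Rightarrow> 'a covec) \<Rightarrow> 'a \<Rightarrow> 'a tvec \<Rightarrow> 'a tvec \<Rightarrow> real" where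
  "ext_d A \<alpha> p u v = (THE r. \<exists>c\<in>A. \<exists>h k. p \<in> fst c \<and>
     u = chart_vec A c p h \<and> v = chart_vec A c p k \<and>
     r = frechet_derivative (form_coeff A c \<alpha> k) (at (snd c p)) h
       - frechet_derivative (form_coeff A c \<alpha> h) (at (snd c p)) k)"

definition wedge :: "'a covec \<Rightarrow> 'a covec \<Rightarrow> 'a tvec \<Rightarrow> 'a tvec \<Rightarrow> real" where
  "wedge \<alpha> \<beta> u v = \<alpha> u * \<beta> v - \<alpha> v * \<beta> u"

definition pullback ::
  "('b, 'f::euclidean_space) chart set \<Rightarrow> ('a \<Rightarrow> 'b) \<Rightarrow> ('b \<Rightarrow> 'b covec) \<Rightarrow> 'a \<Rightarrow> 'a covec" where
  "pullback B F \<alpha> p v = \<alpha> (F p) (tangent_map B F p v)"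

definition form_eq :: "('a, 'e::euclidean_space) chart set \<Rightarrow> ('a \<Rightarrow> 'a covec) \<Rightarrow> ('a \<Rightarrow> 'a covec) \<Rightarrow> bool" where
  "form_eq A \<alpha> \<beta> \<longleftrightarrow> (\<forall>p\<in>points A. \<forall>v\<in>tangent_space A p. \<alpha> p v = \<beta> p v)"


subsection \<open>Smooth embeddings\<close>

definition smooth_embedding ::
  "('a, 'e::euclidean_space) chart set \<Rightarrow> ('b, 'f::euclidean_space) chart set \<Rightarrow> ('a \<Rightarrow> 'b) \<Rightarrow> bool" where
  "smooth_embedding A B F \<longleftrightarrow> smooth_map A B F \<and>
     (\<forall>p\<in>points A. inj_on (tangent_map B F p) (tangent_space A p)) \<and>
     embedding_map (mtop A) (mtop B) F"


section \<open>Strict path structures\<close>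

definition line_subbundle :: "('a, 'e::euclidean_space) chart set \<Rightarrow> ('a \<Rightarrow> 'a tvec set) \<Rightarrow> bool" where
  "line_subbundle A E \<longleftrightarrow> (\<forall>p\<in>points A. \<exists>W X. openin (mtop A) W \<and> p \<in> W \<and> vector_field_on A W X \<and>
     (\<forall>q\<in>W. X q \<noteq> vzero \<and> E q = {vscale c (X q) | c. True}))"

definition plane_sum :: "('a \<Rightarrow> 'a tvec set) \<Rightarrow> ('a \<Rightarrow> 'a tvec set) \<Rightarrow> 'a \<Rightarrow> 'a tvec set" where
  "plane_sum E F p = {vadd u v | u v. u \<in> E p \<and> v \<in> F p}"

definition form_kernel :: "('a, 'e::euclidean_space) chart set \<Rightarrow> ('a \<Rightarrow> 'a covec) \<Rightarrow> 'a \<Rightarrow> 'a tvec set" where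
  "form_kernel A \<eta> p = {v \<in> tangent_space A p. \<eta> p v = 0}"

text \<open>\<open>\<eta> \<and> d\<eta>\<close> vanishes nowhere; meant for 3-manifolds.\<close>

definition contact_form_on ::
  "('a, real^3) chart set \<Rightarrow> 'a set \<Rightarrow> ('a \<Rightarrow> 'a covec) \<Rightarrow> bool" where
  "contact_form_on A W \<eta> \<longleftrightarrow> one_form_on A W \<eta> \<and>
     (\<forall>p\<in>W. \<exists>u\<in>tangent_space A p. \<exists>v\<in>tangent_space A p. \<exists>w\<in>tangent_space A p.
        \<eta> p u * ext_d A \<eta> p v w + \<eta> p v * ext_d A \<eta> p w u + \<eta> p w * ext_d A \<eta> p u v \<noteq> 0)"

definition contact_distribution :: "('a, real^3) chart set \<Rightarrow> ('a \<Rightarrow> 'a tvec set) \<Rightarrow> bool" where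
  "contact_distribution A D \<longleftrightarrow> (\<forall>p\<in>points A. \<exists>W \<eta>. openin (mtop A) W \<and> p \<in> W \<and>
     contact_form_on A W \<eta> \<and> (\<forall>q\<in>W. form_kernel A \<eta> q = D q))"

definition path_structure ::
  "('a, real^3) chart set \<Rightarrow> ('a \<Rightarrow> 'a tvec set) \<Rightarrow> ('a \<Rightarrow> 'a tvec set) \<Rightarrow> bool" where
  "path_structure A E1 E2 \<longleftrightarrow> line_subbundle A E1 \<and> line_subbundle A E2 \<and>
     (\<forall>p\<in>points A. E1 p \<inter> E2 p = {vzero}) \<and> contact_distribution A (plane_sum E1 E2)"

definition strict_path_structure ::
  "('a, real^3) chart set \<Rightarrow> ('a \<Rightarrow> 'a tvec set) \<Rightarrow> ('a \<Rightarrow> 'a tvec set) \<Rightarrow> ('a \<Rightarrow> 'a covec) \<Rightarrow> bool" where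
  "strict_path_structure A E1 E2 \<theta> \<longleftrightarrow> path_structure A E1 E2 \<and>
     contact_form_on A (points A) \<theta> \<and> (\<forall>p\<in>points A. form_kernel A \<theta> p = plane_sum E1 E2 p)"

definition reeb :: "('a, real^3) chart set \<Rightarrow> ('a \<Rightarrow> 'a covec) \<Rightarrow> 'a \<Rightarrow> 'a tvec" where
  "reeb A \<theta> p = (THE r. r \<in> tangent_space A p \<and> \<theta> p r = 1 \<and>
     (\<forall>v\<in>tangent_space A p. ext_d A \<theta> p r v = 0))"

definition reeb_line :: "('a, real^3) chart set \<Rightarrow> ('a \<Rightarrow> 'a covec) \<Rightarrow> 'a \<Rightarrow> 'a tvec set" where
  "reeb_line A \<theta> p = {vscale c (reeb A \<theta> p) | c. True}"


section \<open>The coframe bundles \<open>Y\<^sub>1\<close> and \<open>Y\<^sub>2\<close>\<close>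

text \<open>Coframes are ordered \<open>(\<omega>, \<omega>\<^sup>1, \<omega>\<^sup>2)\<close>; accordingly frames are ordered with the vector transverse
  to the contact plane first.\<close>

type_synonym 'a frame = "'a tvec \<times> 'a tvec \<times> 'a tvec"
type_synonym 'a coframe = "'a covec \<times> 'a covec \<times> 'a covec"

fun dual_coframe :: "('a, real^3) chart set \<Rightarrow> 'a \<Rightarrow> 'a frame \<Rightarrow> 'a coframe \<Rightarrow> bool" where
  "dual_coframe A x (X, X1, X2) (\<theta>, \<theta>1, \<theta>2) \<longleftrightarrow>
     \<theta> \<in> cotangent_space A x \<and> \<theta>1 \<in> cotangent_space A x \<and> \<theta>2 \<in> cotangent_space A x \<and>
     \<theta>  X = 1 \<and> \<theta>  X1 = 0 \<and> \<theta>  X2 = 0 \<and>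
     \<theta>1 X = 0 \<and> \<theta>1 X1 = 1 \<and> \<theta>1 X2 = 0 \<and>
     \<theta>2 X = 0 \<and> \<theta>2 X1 = 0 \<and> \<theta>2 X2 = 1"

definition Y1_fibre ::
  "('a, real^3) chart set \<Rightarrow> ('a \<Rightarrow> 'a tvec set) \<Rightarrow> ('a \<Rightarrow> 'a tvec set) \<Rightarrow> ('a \<Rightarrow> 'a covec) \<Rightarrow>
   'a \<Rightarrow> 'a coframe set" where
  "Y1_fibre A E1 E2 \<theta> x =
     {(\<theta> x, (\<lambda>v. a powi 3 * \<theta>1 v), (\<lambda>v. a powi (-3) * \<theta>2 v)) | a \<theta>1 \<theta>2.
        a \<noteq> (0::real) \<and>
        (\<exists>X1\<in>E1 x. \<exists>X2\<in>E2 x. ext_d A \<theta> x X1 X2 = 1 \<and>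
           dual_coframe A x (reeb A \<theta> x, X1, X2) (\<theta> x, \<theta>1, \<theta>2))}"

text \<open>The positive scalings are relative to an arbitrary frame adapted to \<open>(T\<^sup>1, T\<^sup>2, L)\<close>. As the
  vectors of that frame may be replaced by their opposites, all coframes dual to an adapted frame and
  normalised by \<open>d\<omega>|D = \<omega>\<^sup>1 \<and> \<omega>\<^sup>2|D\<close> occur: the fibre is a torsor under
  \<open>\<real>\<^sup>* \<times> \<real>\<^sup>*\<close> (parameters \<open>a\<^sup>1, a\<^sup>2\<close>, with \<open>\<lambda> = a\<^sup>1 a\<^sup>2\<close>). No orientation of
  the lines is chosen, in accordance with the \<open>\<real>\<^sup>*\<close>-fibres of \<open>Y\<^sub>1\<close>.\<close>

definition Y2_fibre ::
  "('a, real^3) chart set \<Rightarrow> ('a \<Rightarrow> 'a tvec set) \<Rightarrow> ('a \<Rightarrow> 'a tvec set) \<Rightarrow> ('a \<Rightarrow> 'a tvec set) \<Rightarrow>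
   'a \<Rightarrow> 'a coframe set" where
  "Y2_fibre A T1 T2 L x =
     {(\<omega>, \<omega>1, \<omega>2).
        (\<exists>X\<in>L x. \<exists>X1\<in>T1 x. \<exists>X2\<in>T2 x. \<exists>\<theta> \<theta>1 \<theta>2 l a1 a2.
           dual_coframe A x (X, X1, X2) (\<theta>, \<theta>1, \<theta>2) \<and> l > 0 \<and> a1 > 0 \<and> a2 > 0 \<and>
           \<omega> = (\<lambda>v. l * \<theta> v) \<and> \<omega>1 = (\<lambda>v. a1 * \<theta>1 v) \<and> \<omega>2 = (\<lambda>v. a2 * \<theta>2 v)) \<and>
        (\<exists>W \<eta>. openin (mtop A) W \<and> x \<in> W \<and> one_form_on A W \<eta> \<and> \<eta> x = \<omega> \<and>
           (\<forall>q\<in>W. form_kernel A \<eta> q = plane_sum T1 T2 q) \<and>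
           (\<forall>u\<in>plane_sum T1 T2 x. \<forall>v\<in>plane_sum T1 T2 x. ext_d A \<eta> x u v = wedge \<omega>1 \<omega>2 u v))}"

definition total_space :: "('a, real^3) chart set \<Rightarrow> ('a \<Rightarrow> 'a coframe set) \<Rightarrow> ('a \<times> 'a coframe) set" where
  "total_space A F = {(x, \<Omega>). x \<in> points A \<and> \<Omega> \<in> F x}"

definition local_section ::
  "('a, real^3) chart set \<Rightarrow> ('a \<Rightarrow> 'a tvec set) \<Rightarrow> 'a set \<Rightarrow> ('a \<Rightarrow> 'a tvec) \<Rightarrow> bool" where
  "local_section A E W X \<longleftrightarrow> vector_field_on A W X \<and> (\<forall>x\<in>W. X x \<in> E x \<and> X x \<noteq> vzero)"

text \<open>The smooth structures are the usual ones of principal bundles, given by the trivialisations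
  associated with local frames. For a coframe of \<open>Y\<^sub>1\<close> written with respect to a local frame
  \<open>(X\<^sub>1, X\<^sub>2)\<close>, the fibre coordinate is \<open>\<omega>\<^sup>1(X\<^sub>1) = a\<^sup>3\<close>; for \<open>Y\<^sub>2\<close> the fibre coordinates are
  \<open>\<omega>\<^sup>1(X\<^sub>1) = a\<^sup>1\<close> and \<open>\<omega>\<^sup>2(X\<^sub>2) = a\<^sup>2\<close>. These numbers determine the coframe. The domains
  \<open>W\<close> may be smaller than the given chart domains, over which the line bundles need not be trivial.\<close>

definition Y1 ::
  "('a, real^3) chart set \<Rightarrow> ('a \<Rightarrow> 'a tvec set) \<Rightarrow> ('a \<Rightarrow> 'a tvec set) \<Rightarrow> ('a \<Rightarrow> 'a covec) \<Rightarrow>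
   ('a \<times> 'a coframe, (real^3) \<times> real) chart set" where
  "Y1 A E1 E2 \<theta> =
     {({(x, \<Omega>) \<in> total_space A (Y1_fibre A E1 E2 \<theta>). x \<in> W}, \<lambda>(x, \<omega>, \<omega>1, \<omega>2). (\<phi> x, \<omega>1 (X1 x))) | U \<phi> W X1.
        (U, \<phi>) \<in> A \<and> W \<subseteq> U \<and> openin (mtop A) W \<and> local_section A E1 W X1}"

definition Y2 ::
  "('a, real^3) chart set \<Rightarrow> ('a \<Rightarrow> 'a tvec set) \<Rightarrow> ('a \<Rightarrow> 'a tvec set) \<Rightarrow> ('a \<Rightarrow> 'a tvec set) \<Rightarrow>
   ('a \<times> 'a coframe, (real^3) \<times> real \<times> real) chart set" where
  "Y2 A T1 T2 L =
     {({(x, \<Omega>) \<in> total_space A (Y2_fibre A T1 T2 L). x \<in> W},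
       \<lambda>(x, \<omega>, \<omega>1, \<omega>2). (\<phi> x, \<omega>1 (X1 x), \<omega>2 (X2 x))) | U \<phi> W X1 X2.
        (U, \<phi>) \<in> A \<and> W \<subseteq> U \<and> openin (mtop A) W \<and> local_section A T1 W X1 \<and> local_section A T2 W X2}"

text \<open>The tautological forms on a bundle of coframes over \<open>A\<close>: at a coframe \<open>(x, \<omega>, \<omega>\<^sup>1, \<omega>\<^sup>2)\<close> their
  values are the pullbacks of \<open>\<omega>, \<omega>\<^sup>1, \<omega>\<^sup>2\<close> under the differential of the projection to the base.\<close>

definition taut :: "('a, real^3) chart set \<Rightarrow> 'a \<times> 'a coframe \<Rightarrow> ('a \<times> 'a coframe) covec" where
  "taut A = (\<lambda>(x, \<omega>, \<omega>1, \<omega>2) v. \<omega> (tangent_map A fst (x, \<omega>, \<omega>1, \<omega>2) v))"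

definition taut1 :: "('a, real^3) chart set \<Rightarrow> 'a \<times> 'a coframe \<Rightarrow> ('a \<times> 'a coframe) covec" where
  "taut1 A = (\<lambda>(x, \<omega>, \<omega>1, \<omega>2) v. \<omega>1 (tangent_map A fst (x, \<omega>, \<omega>1, \<omega>2) v))"

definition taut2 :: "('a, real^3) chart set \<Rightarrow> 'a \<times> 'a coframe \<Rightarrow> ('a \<times> 'a coframe) covec" where
  "taut2 A = (\<lambda>(x, \<omega>, \<omega>1, \<omega>2) v. \<omega>2 (tangent_map A fst (x, \<omega>, \<omega>1, \<omega>2) v))"


subsection \<open>Connection forms\<close>

text \<open>In both cases the structure equations determine the connection forms uniquely.\<close>

definition Y1_connection_form ::
  "('a, real^3) chart set \<Rightarrow> ('a \<times> 'a coframe, (real^3) \<times> real) chart set \<Rightarrow>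
   ('a \<times> 'a coframe \<Rightarrow> ('a \<times> 'a coframe) covec) \<Rightarrow> bool" where
  "Y1_connection_form A Y w \<longleftrightarrow> one_form Y w \<and>
     (\<exists>\<tau>1 \<tau>2. one_form Y \<tau>1 \<and> one_form Y \<tau>2 \<and>
        (\<forall>q\<in>points Y. \<forall>u\<in>tangent_space Y q. \<forall>v\<in>tangent_space Y q.
           let \<omega> = taut A q; \<omega>1 = taut1 A q; \<omega>2 = taut2 A q in
             ext_d Y (taut A) q u v = wedge \<omega>1 \<omega>2 u v \<and>
             ext_d Y (taut1 A) q u v = 3 * wedge (w q) \<omega>1 u v + wedge \<omega> (\<tau>1 q) u v \<and>
             ext_d Y (taut2 A) q u v = - 3 * wedge (w q) \<omega>2 u v - wedge \<omega> (\<tau>2 q) u v \<and>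
             wedge (\<tau>1 q) \<omega>2 u v = 0 \<and> wedge (\<tau>2 q) \<omega>1 u v = 0))"

definition Y2_connection_forms ::
  "('a, real^3) chart set \<Rightarrow> ('a \<times> 'a coframe, (real^3) \<times> real \<times> real) chart set \<Rightarrow>
   ('a \<times> 'a coframe \<Rightarrow> ('a \<times> 'a coframe) covec) \<Rightarrow>
   ('a \<times> 'a coframe \<Rightarrow> ('a \<times> 'a coframe) covec) \<Rightarrow> bool" where
  "Y2_connection_forms A Y \<phi> w \<longleftrightarrow> one_form Y \<phi> \<and> one_form Y w \<and>
     (\<exists>\<tau>12 \<tau>21. smooth_fun_on Y (points Y) \<tau>12 \<and> smooth_fun_on Y (points Y) \<tau>21 \<and>
        (\<forall>q\<in>points Y. \<forall>u\<in>tangent_space Y q. \<forall>v\<in>tangent_space Y q.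
           let \<omega> = taut A q; \<omega>1 = taut1 A q; \<omega>2 = taut2 A q;
               \<tau>1 = (\<lambda>z. \<tau>12 q * \<omega>2 z); \<tau>2 = (\<lambda>z. \<tau>21 q * \<omega>1 z) in
             ext_d Y (taut A) q u v = 2 * wedge (\<phi> q) \<omega> u v + wedge \<omega>1 \<omega>2 u v \<and>
             ext_d Y (taut1 A) q u v =
               wedge (\<phi> q) \<omega>1 u v + 3 * wedge (w q) \<omega>1 u v + wedge \<omega> \<tau>1 u v \<and>
             ext_d Y (taut2 A) q u v =
               wedge (\<phi> q) \<omega>2 u v - 3 * wedge (w q) \<omega>2 u v - wedge \<omega> \<tau>2 u v))"


section \<open>Embeddings of \<open>Y\<^sub>1\<close> into \<open>Y\<^sub>2\<close>\<close>

text \<open>Embeddings of bundles over \<open>M\<close>, i.e. covering the identity of \<open>M\<close>: otherwise composition with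
  the lift of an automorphism of the strict path structure would preserve the tautological forms as
  well. Maps are taken to be extensional, so that uniqueness refers to their values on \<open>Y\<^sub>1\<close> only.\<close>

definition tautological_embedding ::
  "('a, real^3) chart set \<Rightarrow> ('a \<times> 'a coframe, (real^3) \<times> real) chart set \<Rightarrow>
   ('a \<times> 'a coframe, (real^3) \<times> real \<times> real) chart set \<Rightarrow>
   ('a \<times> 'a coframe \<Rightarrow> 'a \<times> 'a coframe) \<Rightarrow> bool" where
  "tautological_embedding A Y Z \<iota> \<longleftrightarrow>
     \<iota> \<in> extensional (points Y) \<and> smooth_embedding Y Z \<iota> \<and> (\<forall>q\<in>points Y. fst (\<iota> q) = fst q) \<and>
     form_eq Y (pullback Z \<iota> (taut A)) (taut A) \<and>
     form_eq Y (pullback Z \<iota> (taut1 A)) (taut1 A) \<and>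
     form_eq Y (pullback Z \<iota> (taut2 A)) (taut2 A)"

end

theory Submission
  imports Defs
begin

text \<open>Fix a frame \<open>X\<^sub>1 \<in> E\<^sup>1\<close>, \<open>X\<^sub>2 \<in> E\<^sup>2\<close> at a point and put \<open>\<delta> = d\<theta>(X\<^sub>1, X\<^sub>2)\<close>. A coframe in \<open>Y\<^sub>2\<close> is
  determined by the nonzero numbers \<open>a\<^sup>1 = \<omega>\<^sup>1(X\<^sub>1)\<close> and \<open>a\<^sup>2 = \<omega>\<^sup>2(X\<^sub>2)\<close>, its first member being
  \<open>\<omega> = (a\<^sup>1 a\<^sup>2 / \<delta>) \<theta>\<close>; it lies in \<open>Y\<^sub>1\<close> iff \<open>a\<^sup>1 a\<^sup>2 = \<delta>\<close>. Hence \<open>Y\<^sub>1\<close> is a subset of \<open>Y\<^sub>2\<close> and the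
  inclusion preserves the tautological forms. It is an embedding because rescaling \<open>\<omega>\<close> to \<open>\<theta>\<close> is a
  smooth retraction \<open>Y\<^sub>2 \<rightarrow> Y\<^sub>1\<close>. It is unique since the tautological forms at a coframe determine that
  coframe. As \<open>d\<close> commutes with pullback, subtracting the structure equations of \<open>Y\<^sub>1\<close> from the
  pulled back ones of \<open>Y\<^sub>2\<close> and evaluating on vectors dual to \<open>\<omega>, \<omega>\<^sup>1, \<omega>\<^sup>2\<close> identifies the connection
  forms. That \<open>d\<close> commutes with pullback, and is well defined at all, rests on the symmetry of
  second derivatives.\<close>

section \<open>Calculus of smooth maps\<close>

text \<open>Lines carry no orientation here, so \<open>a1\<close> and \<open>a2\<close> range over
  all nonzero reals: in \<open>Y2\<close> the signs are absorbed by the frame, in \<open>Y1\<close>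
  by real cube roots. The factor \<open>a1 * a2 / \<delta>\<close> has this origin: a form \<eta>
  with the kernel of \<theta> satisfies \<open>d\<eta> = \<eta>(R) d\<theta>\<close> on the plane at
  each point, so the normalisation prescribes the value of \<omega> on the Reeb vector
  \<open>R\<close>, however \<omega> is extended. The main obstacle is that \<open>ext_d\<close> is
  a definite description over all charts, of no known value until chart independence is proved. One
  computation for a smooth map \<open>F\<close> settles this and more: \<open>F = id\<close> gives
  chart independence, the inclusion gives naturality. Points of \<open>Y1\<close> are points of
  \<open>Y2\<close>, but tangent vectors there are derivations relative to different atlases, so the
  inclusion still has to be differentiated. Finally, the tangent spaces of \<open>Y1\<close> have
  dimension four and the tautological forms vanish on vertical vectors. Testing on dual vectors
  alone would miss the vertical direction; therefore one slot of each structure equation stays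
  arbitrary.\<close>

lemma Ck_on_cong:
  assumes "open S" "\<And>x. x \<in> S \<Longrightarrow> f x = g x" "Ck_on k S f"
  shows "Ck_on k S g"
  using assms
proof (induction k arbitrary: f g)
  case 0
  then show ?case by (metis Ck_on.simps(1) continuous_on_cong)
next
  case (Suc k)
  have 1: "(g has_derivative frechet_derivative f (at x)) (at x)" if "x \<in> S" for x
    using Suc.prems that
    by (metis Ck_on.simps(2) frechet_derivative_works has_derivative_transform_within_open)
  then have 2: "frechet_derivative g (at x) = frechet_derivative f (at x)" if "x \<in> S" for x
    using that frechet_derivative_at by metis
  have "Ck_on k S (\<lambda>x. frechet_derivative g (at x) v)" for v
    by (rule Suc.IH[of "\<lambda>x. frechet_derivative f (at x) v"]) (use Suc.prems 2 in auto)
  with 1 show ?case by (auto simp: differentiable_def)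
qed

text \<open>\<open>frechet_derivative\<close> is an indefinite choice. On an open set any explicit
  formula for the derivative may replace it, which is what lets the closure properties below run by
  induction on \<open>k\<close>.\<close>

lemma Ck_on_SucI:
  assumes "open S" "\<And>x. x \<in> S \<Longrightarrow> (f has_derivative f' x) (at x)" "\<And>v. Ck_on k S (\<lambda>x. f' x v)"
  shows "Ck_on (Suc k) S f"
proof -
  have "f' x = frechet_derivative f (at x)" if "x \<in> S" for x
    using assms(2) that frechet_derivative_at by metis
  then have "Ck_on k S (\<lambda>x. frechet_derivative f (at x) v)" for v
    by (intro Ck_on_cong[OF assms(1) _ assms(3)[of v]]) auto
  with assms(2) show ?thesis by (auto simp: differentiable_def)
qed

lemma Ck_on_has_derivative:
  "Ck_on (Suc k) S f \<Longrightarrow> x \<in> S \<Longrightarrow> (f has_derivative frechet_derivative f (at x)) (at x)"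
  by (simp add: frechet_derivative_works[symmetric])

lemma Ck_on_Suc: "Ck_on (Suc k) S f \<Longrightarrow> Ck_on k S f"
proof (induction k arbitrary: f)
  case 0
  then show ?case
    by (auto intro!: continuous_at_imp_continuous_on differentiable_imp_continuous_within)
next
  case (Suc k)
  then show ?case using Ck_on.simps(2) by blast
qed

lemma Ck_on_subset: "Ck_on k S f \<Longrightarrow> T \<subseteq> S \<Longrightarrow> Ck_on k T f"
  by (induction k arbitrary: f) (auto intro: continuous_on_subset)

lemma Ck_on_const: "Ck_on k S (\<lambda>x. c)"
  by (induction k arbitrary: c) auto

lemma Ck_on_bounded_linear:
  assumes "bounded_linear L" "open S" "Ck_on k S f"
  shows "Ck_on k S (\<lambda>x. L (f x))"
  using assms(3)
proof (induction k arbitrary: f)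
  case 0
  then show ?case using assms bounded_linear.continuous_on by auto
next
  case (Suc k)
  show ?case
  proof (rule Ck_on_SucI[OF assms(2)])
    show "((\<lambda>x. L (f x)) has_derivative (\<lambda>v. L (frechet_derivative f (at x) v))) (at x)" if "x \<in> S" for x
      using Ck_on_has_derivative[OF Suc.prems that] bounded_linear.has_derivative[OF assms(1)] by blast
    show "Ck_on k S (\<lambda>x. L (frechet_derivative f (at x) v))" for v
      using Suc by auto
  qed
qed

lemma Ck_on_id: "open S \<Longrightarrow> Ck_on k S (\<lambda>x. x)"
proof (cases k)
  case (Suc j)
  assume "open S"
  show ?thesis unfolding Suc
    by (rule Ck_on_SucI[OF \<open>open S\<close>, of _ "\<lambda>x v. v"]) (auto intro: Ck_on_const)
qed auto

lemma Ck_on_add: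
  assumes "open S" "Ck_on k S f" "Ck_on k S g"
  shows "Ck_on k S (\<lambda>x. f x + g x)"
  using assms(2,3)
proof (induction k arbitrary: f g)
  case 0
  then show ?case by (auto intro: continuous_intros)
next
  case (Suc k)
  show ?case
  proof (rule Ck_on_SucI[OF assms(1)])
    show "((\<lambda>x. f x + g x) has_derivative
        (\<lambda>v. frechet_derivative f (at x) v + frechet_derivative g (at x) v)) (at x)" if "x \<in> S" for x
      using Suc.prems that by (intro has_derivative_add Ck_on_has_derivative)
  qed (use Suc in auto)
qed

lemma Ck_on_sum:
  assumes "open S" "\<And>i. i \<in> I \<Longrightarrow> Ck_on k S (f i)"
  shows "Ck_on k S (\<lambda>x. \<Sum>i\<in>I. f i x)"
  using assms(2)
  by (induction I rule: infinite_finite_induct) (auto intro: Ck_on_const Ck_on_add[OF assms(1)])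

text \<open>By the Leibniz rule the derivative is a sum of two bilinear terms, each pairing an
  undifferentiated factor with a derivative; the former is lowered to order \<open>k\<close> by
  \<open>Ck_on_Suc\<close> before the induction hypothesis applies.\<close>

lemma Ck_on_bilinear:
  assumes "bounded_bilinear b" "open S" "Ck_on k S f" "Ck_on k S g"
  shows "Ck_on k S (\<lambda>x. b (f x) (g x))"
  using assms(3,4)
proof (induction k arbitrary: f g)
  case 0
  then show ?case using bounded_bilinear.continuous_on[OF assms(1)] by auto
next
  case (Suc k)
  show ?case
  proof (rule Ck_on_SucI[OF assms(2)])
    show "((\<lambda>x. b (f x) (g x)) has_derivative
        (\<lambda>v. b (f x) (frechet_derivative g (at x) v) + b (frechet_derivative f (at x) v) (g x))) (at x)"
      if "x \<in> S" for x
      using Suc.prems that by (intro bounded_bilinear.FDERIV[OF assms(1)] Ck_on_has_derivative)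
    show "Ck_on k S (\<lambda>x. b (f x) (frechet_derivative g (at x) v) + b (frechet_derivative f (at x) v) (g x))" for v
      using Suc.prems Ck_on_Suc[OF Suc.prems(1)] Ck_on_Suc[OF Suc.prems(2)]
      by (intro Ck_on_add[OF assms(2)] Suc.IH) auto
  qed
qed

text \<open>The derivative \<open>- (1/f) f' (1/f)\<close> contains \<open>1/f\<close> again, but
  only at order \<open>k\<close>, where the induction hypothesis covers it.\<close>

lemma Ck_on_inverse:
  fixes f :: "'e::real_normed_vector \<Rightarrow> real"
  assumes "open S" "Ck_on k S f" "\<And>x. x \<in> S \<Longrightarrow> f x \<noteq> 0"
  shows "Ck_on k S (\<lambda>x. inverse (f x))"
  using assms(2,3)
proof (induction k arbitrary: f)
  case 0
  then show ?case by (auto intro: continuous_intros)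
next
  case (Suc k)
  show ?case
  proof (rule Ck_on_SucI[OF assms(1)])
    show "((\<lambda>x. inverse (f x)) has_derivative
        (\<lambda>v. - (inverse (f x) * frechet_derivative f (at x) v * inverse (f x)))) (at x)"
      if "x \<in> S" for x
      using Suc.prems that by (intro Deriv.has_derivative_inverse Ck_on_has_derivative) auto
    have "Ck_on k S (\<lambda>x. inverse (f x))"
      using Suc Ck_on_Suc by blast
    then show "Ck_on k S (\<lambda>x. - (inverse (f x) * frechet_derivative f (at x) v * inverse (f x)))" for v
      using Suc.prems
      by (intro Ck_on_bounded_linear[OF bounded_linear_minus[OF bounded_linear_ident] assms(1)]
        Ck_on_bilinear[OF bounded_bilinear_mult assms(1)]) auto
  qed
qed

lemma Ck_on_Pair:
  assumes "open S" "Ck_on k S f" "Ck_on k S g"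
  shows "Ck_on k S (\<lambda>x. (f x, g x))"
  using assms(2,3)
proof (induction k arbitrary: f g)
  case 0
  then show ?case by (auto intro: continuous_intros)
next
  case (Suc k)
  show ?case
  proof (rule Ck_on_SucI[OF assms(1)])
    show "((\<lambda>x. (f x, g x)) has_derivative
        (\<lambda>v. (frechet_derivative f (at x) v, frechet_derivative g (at x) v))) (at x)" if "x \<in> S" for x
      using Suc.prems that by (intro has_derivative_Pair Ck_on_has_derivative)
  qed (use Suc in auto)
qed

lemma linear_sum_Basis:
  fixes L :: "'e::euclidean_space \<Rightarrow> 'f::real_vector"
  assumes "linear L"
  shows "L v = (\<Sum>b\<in>Basis. (v \<bullet> b) *\<^sub>R L b)"
proof -
  have "L v = L (\<Sum>b\<in>Basis. (v \<bullet> b) *\<^sub>R b)"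
    by (simp add: euclidean_representation)
  then show ?thesis
    by (simp add: linear_sum[OF assms] linear_scale[OF assms])
qed

text \<open>In the chain rule \<open>g'(f x) (f' x v)\<close> both the point and the direction of
  \<open>g'\<close> move with \<open>x\<close>, whereas \<open>Ck_on\<close> speaks of fixed
  directions. Expanding \<open>f' x v\<close> in \<open>Basis\<close> leaves products of its
  coordinates with derivatives of \<open>g\<close> in constant directions.\<close>

lemma Ck_on_compose:
  fixes f :: "'e::real_normed_vector \<Rightarrow> 'f::euclidean_space" and g :: "'f \<Rightarrow> 'g::real_normed_vector"
  assumes "open S" "open T" "f ` S \<subseteq> T" "Ck_on k S f" "Ck_on k T g"
  shows "Ck_on k S (\<lambda>x. g (f x))"
  using assms(4,5)
proof (induction k arbitrary: g)
  case 0
  then show ?case using assms(3) continuous_on_compose2 by auto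
next
  case (Suc k)
  have fk: "Ck_on k S f" using Suc.prems(1) Ck_on_Suc by blast
  let ?f' = "\<lambda>x. frechet_derivative f (at x)" and ?g' = "\<lambda>y. frechet_derivative g (at y)"
  show ?case
  proof (rule Ck_on_SucI[OF assms(1)])
    show "((\<lambda>x. g (f x)) has_derivative (\<lambda>v. \<Sum>b\<in>Basis. (?f' x v \<bullet> b) *\<^sub>R ?g' (f x) b)) (at x)"
      if "x \<in> S" for x
    proof -
      have *: "(g has_derivative ?g' (f x)) (at (f x))"
        using Ck_on_has_derivative[OF Suc.prems(2)] assms(3) that by blast
      have "((\<lambda>x. g (f x)) has_derivative (\<lambda>v. ?g' (f x) (?f' x v))) (at x)"
        using has_derivative_compose[OF Ck_on_has_derivative[OF Suc.prems(1) that] *] .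
      then show ?thesis
        by (simp add: linear_sum_Basis[OF has_derivative_linear[OF *], symmetric])
    qed
    show "Ck_on k S (\<lambda>x. \<Sum>b\<in>Basis. (?f' x v \<bullet> b) *\<^sub>R ?g' (f x) b)" for v
      using Suc.prems fk
      by (intro Ck_on_sum assms(1) Ck_on_bilinear[OF bounded_bilinear_scaleR]
          Ck_on_bounded_linear[OF bounded_linear_inner_left] Suc.IH) auto
  qed
qed

section \<open>The same closure properties at infinite order\<close>

lemma smooth_on_cong:
  assumes "open S" "\<And>x. x \<in> S \<Longrightarrow> f x = g x" "smooth_on S f"
  shows "smooth_on S g"
  using Ck_on_cong[OF assms(1,2)] assms(3) unfolding smooth_on_def by simp

lemma smooth_on_subset: "smooth_on S f \<Longrightarrow> T \<subseteq> S \<Longrightarrow> smooth_on T f"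
  using Ck_on_subset[of _ S f T] by (simp add: smooth_on_def)

lemma smooth_on_Ck_on: "smooth_on S f \<Longrightarrow> Ck_on k S f"
  by (simp add: smooth_on_def)

lemma smooth_on_continuous_on: "smooth_on S f \<Longrightarrow> continuous_on S f"
  using smooth_on_Ck_on[of S f 0] by simp

lemma smooth_on_has_derivative:
  "smooth_on S f \<Longrightarrow> x \<in> S \<Longrightarrow> (f has_derivative frechet_derivative f (at x)) (at x)"
  using smooth_on_Ck_on[of S f "Suc 0"] Ck_on_has_derivative[of 0 S f x] by simp

lemma smooth_on_differentiable: "smooth_on S f \<Longrightarrow> x \<in> S \<Longrightarrow> f differentiable (at x)"
  using smooth_on_has_derivative differentiable_def by blast

lemma smooth_on_frechet_derivative:
  assumes "smooth_on S f"
  shows "smooth_on S (\<lambda>x. frechet_derivative f (at x) v)"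
  using smooth_on_Ck_on[OF assms, of "Suc _"] by (simp add: smooth_on_def)

lemma smooth_on_const: "smooth_on S (\<lambda>x. c)"
  by (simp add: smooth_on_def Ck_on_const)

lemma smooth_on_id: "open S \<Longrightarrow> smooth_on S (\<lambda>x. x)"
  by (simp add: smooth_on_def Ck_on_id)

lemma smooth_on_bounded_linear:
  "bounded_linear L \<Longrightarrow> open S \<Longrightarrow> smooth_on S f \<Longrightarrow> smooth_on S (\<lambda>x. L (f x))"
  by (simp add: smooth_on_def Ck_on_bounded_linear)

lemma smooth_on_sum:
  "open S \<Longrightarrow> (\<And>i. i \<in> I \<Longrightarrow> smooth_on S (f i)) \<Longrightarrow> smooth_on S (\<lambda>x. \<Sum>i\<in>I. f i x)"
  by (simp add: smooth_on_def Ck_on_sum)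

lemma smooth_on_diff:
  "open S \<Longrightarrow> smooth_on S f \<Longrightarrow> smooth_on S g \<Longrightarrow> smooth_on S (\<lambda>x. f x - g x)"
  using Ck_on_add[of S _ f "\<lambda>x. - g x"]
    Ck_on_bounded_linear[OF bounded_linear_minus[OF bounded_linear_ident], of S _ g]
  by (simp add: smooth_on_def)

lemma smooth_on_mult:
  fixes f g :: "'e::real_normed_vector \<Rightarrow> real"
  shows "open S \<Longrightarrow> smooth_on S f \<Longrightarrow> smooth_on S g \<Longrightarrow> smooth_on S (\<lambda>x. f x * g x)"
  by (simp add: smooth_on_def Ck_on_bilinear[OF bounded_bilinear_mult])

lemma smooth_on_inner:
  "open S \<Longrightarrow> smooth_on S f \<Longrightarrow> smooth_on S g \<Longrightarrow> smooth_on S (\<lambda>x. f x \<bullet> g x)"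
  by (simp add: smooth_on_def Ck_on_bilinear[OF bounded_bilinear_inner])

lemma smooth_on_divide:
  fixes f g :: "'e::real_normed_vector \<Rightarrow> real"
  shows "open S \<Longrightarrow> smooth_on S f \<Longrightarrow> smooth_on S g \<Longrightarrow> (\<And>x. x \<in> S \<Longrightarrow> g x \<noteq> 0) \<Longrightarrow>
    smooth_on S (\<lambda>x. f x / g x)"
  unfolding divide_inverse
  by (rule smooth_on_mult) (simp_all add: smooth_on_def Ck_on_inverse)

lemma smooth_on_Pair:
  "open S \<Longrightarrow> smooth_on S f \<Longrightarrow> smooth_on S g \<Longrightarrow> smooth_on S (\<lambda>x. (f x, g x))"
  by (simp add: smooth_on_def Ck_on_Pair)

lemma smooth_on_compose:
  fixes f :: "'e::real_normed_vector \<Rightarrow> 'f::euclidean_space" and g :: "'f \<Rightarrow> 'g::real_normed_vector"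
  shows "open S \<Longrightarrow> open T \<Longrightarrow> f ` S \<subseteq> T \<Longrightarrow> smooth_on S f \<Longrightarrow> smooth_on T g \<Longrightarrow>
    smooth_on S (\<lambda>x. g (f x))"
  by (simp add: smooth_on_def Ck_on_compose)

subsection \<open>Symmetry of second derivatives\<close>

text \<open>Two applications of the mean value theorem express the second difference of \<open>f\<close> over the
  parallelogram spanned by \<open>s h\<close> and \<open>s k\<close> by one mixed derivative.\<close>

lemma second_difference_mean_value:
  fixes f :: "'e::real_normed_vector \<Rightarrow> real"
  assumes "s > 0"
    and in_S: "\<And>a b. 0 \<le> a \<Longrightarrow> a \<le> s \<Longrightarrow> 0 \<le> b \<Longrightarrow> b \<le> s \<Longrightarrow> x + a *\<^sub>R h + b *\<^sub>R k \<in> S"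
    and f': "\<And>y. y \<in> S \<Longrightarrow> (f has_derivative f' y) (at y)"
    and f'': "\<And>y. y \<in> S \<Longrightarrow> ((\<lambda>z. f' z h) has_derivative f'' y) (at y)"
  shows "\<exists>a b. 0 \<le> a \<and> a \<le> s \<and> 0 \<le> b \<and> b \<le> s \<and>
    f (x + s *\<^sub>R h + s *\<^sub>R k) - f (x + s *\<^sub>R h) - f (x + s *\<^sub>R k) + f x
      = s * s * f'' (x + a *\<^sub>R h + b *\<^sub>R k) k"
proof -
  define g where "g a = f (x + a *\<^sub>R h + s *\<^sub>R k) - f (x + a *\<^sub>R h)" for a
  have der: "((\<lambda>a. f (x + a *\<^sub>R h + c)) has_real_derivative f' (x + a *\<^sub>R h + c) h) (at a)"
    if "x + a *\<^sub>R h + c \<in> S" for a c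
  proof -
    have "((\<lambda>a. x + a *\<^sub>R h + c) has_derivative (\<lambda>t. t *\<^sub>R h)) (at a)"
      by (auto intro!: derivative_eq_intros)
    from has_derivative_compose[OF this f'[OF that]] show ?thesis
      unfolding has_field_derivative_def
      by (rule has_derivative_eq_rhs)
        (auto simp: linear_scale[OF has_derivative_linear[OF f'[OF that]]] mult.commute)
  qed
  have "(g has_real_derivative (f' (x + a *\<^sub>R h + s *\<^sub>R k) h - f' (x + a *\<^sub>R h) h)) (at a)"
    if "0 \<le> a" "a \<le> s" for a
    unfolding g_def using der[of a "s *\<^sub>R k"] der[of a 0] in_S[of a s] in_S[of a 0] that \<open>s > 0\<close>
    by (auto intro!: DERIV_diff)
  then obtain a where a: "0 < a" "a < s"
    "g s - g 0 = (s - 0) * (f' (x + a *\<^sub>R h + s *\<^sub>R k) h - f' (x + a *\<^sub>R h) h)"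
    using MVT2[OF \<open>s > 0\<close>, of g "\<lambda>a. f' (x + a *\<^sub>R h + s *\<^sub>R k) h - f' (x + a *\<^sub>R h) h"] by blast
  have der2: "((\<lambda>b. f' (x + a *\<^sub>R h + b *\<^sub>R k) h) has_real_derivative f'' (x + a *\<^sub>R h + b *\<^sub>R k) k) (at b)"
    if "0 \<le> b" "b \<le> s" for b
  proof -
    have S: "x + a *\<^sub>R h + b *\<^sub>R k \<in> S" using in_S a that by auto
    have "((\<lambda>b. x + a *\<^sub>R h + b *\<^sub>R k) has_derivative (\<lambda>t. t *\<^sub>R k)) (at b)"
      by (auto intro!: derivative_eq_intros)
    from has_derivative_compose[OF this f''[OF S]] show ?thesis
      unfolding has_field_derivative_def
      by (rule has_derivative_eq_rhs)
        (auto simp: linear_scale[OF has_derivative_linear[OF f''[OF S]]] mult.commute)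
  qed
  obtain b where b: "0 < b" "b < s"
    "f' (x + a *\<^sub>R h + s *\<^sub>R k) h - f' (x + a *\<^sub>R h + 0 *\<^sub>R k) h = (s - 0) * f'' (x + a *\<^sub>R h + b *\<^sub>R k) k"
    using MVT2[OF \<open>s > 0\<close> der2] by blast
  show ?thesis
    using a b by (intro exI[of _ a] exI[of _ b]) (auto simp: g_def)
qed

text \<open>The second difference is symmetric in \<open>h\<close> and \<open>k\<close>, and over a
  small parallelogram it is \<open>s * s\<close> times a value of either mixed derivative. If these
  differed at \<open>x\<close>, continuity would keep each within half of the gap of its value at
  \<open>x\<close>, so near \<open>x\<close> they could not share a value.\<close>

lemma second_derivative_symmetric_real:
  fixes f :: "'e::real_normed_vector \<Rightarrow> real"
  assumes "open S" "x \<in> S"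
    and f': "\<And>y. y \<in> S \<Longrightarrow> (f has_derivative f' y) (at y)"
    and h: "\<And>y. y \<in> S \<Longrightarrow> ((\<lambda>z. f' z h) has_derivative fh y) (at y)"
    and k: "\<And>y. y \<in> S \<Longrightarrow> ((\<lambda>z. f' z k) has_derivative fk y) (at y)"
    and cont: "continuous_on S (\<lambda>y. fh y k)" "continuous_on S (\<lambda>y. fk y h)"
  shows "fh x k = fk x h"
proof (rule ccontr)
  assume ne: "fh x k \<noteq> fk x h"
  define e where "e = \<bar>fh x k - fk x h\<bar> / 2"
  have "e > 0" using ne by (simp add: e_def)
  have "isCont (\<lambda>y. fh y k) x" "isCont (\<lambda>y. fk y h) x"
    using cont assms(1,2) continuous_on_eq_continuous_at by blast+
  then obtain d1 d2 where d: "d1 > 0" "d2 > 0"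
    "\<forall>y. dist y x < d1 \<longrightarrow> \<bar>fh y k - fh x k\<bar> < e" "\<forall>y. dist y x < d2 \<longrightarrow> \<bar>fk y h - fk x h\<bar> < e"
    using \<open>e > 0\<close> unfolding continuous_at_eps_delta dist_real_def by blast
  obtain d3 where d3: "d3 > 0" "\<forall>y. dist y x < d3 \<longrightarrow> y \<in> S"
    using assms(1,2) unfolding open_dist by blast
  define d where "d = min d3 (min d1 d2)"
  \<comment> \<open>Every point of the parallelogram lies within
    \<open>s * (norm h + norm k)\<close> of \<open>x\<close>, hence within \<open>d / 2\<close>. The
    summand 1 keeps \<open>N\<close> positive when \<open>h\<close> and \<open>k\<close> both
    vanish.\<close>
  define N where "N = norm h + norm k + 1"
  define s where "s = d / (2 * N)"
  have "d > 0" using d d3 by (auto simp: d_def)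
  have pos: "N > 0"
    using norm_ge_zero[of h] norm_ge_zero[of k] unfolding N_def by linarith
  then have "s > 0" using \<open>d > 0\<close> by (simp add: s_def)
  have near: "dist (x + a *\<^sub>R u + b *\<^sub>R v) x < d"
    if "0 \<le> a" "a \<le> s" "0 \<le> b" "b \<le> s" "norm u + norm v = norm h + norm k" for a b u v
  proof -
    have "dist (x + a *\<^sub>R u + b *\<^sub>R v) x \<le> a * norm u + b * norm v"
      using norm_triangle_ineq[of "a *\<^sub>R u" "b *\<^sub>R v"] that by (simp add: dist_norm)
    also have "\<dots> \<le> s * (norm h + norm k)"
    proof -
      have "a * norm u + b * norm v \<le> s * norm u + s * norm v"
        using that by (intro add_mono mult_right_mono) auto
      then show ?thesis using that(5) by (simp flip: distrib_left)
    qed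
    also have "\<dots> \<le> s * N" using \<open>s > 0\<close> by (simp add: N_def)
    also have "\<dots> = d / 2" using pos by (simp add: s_def)
    also have "\<dots> < d" using \<open>d > 0\<close> by simp
    finally show ?thesis .
  qed
  have in_S: "x + a *\<^sub>R u + b *\<^sub>R v \<in> S"
    if "0 \<le> a" "a \<le> s" "0 \<le> b" "b \<le> s" "norm u + norm v = norm h + norm k" for a b u v
    using near[OF that] d3(2) by (simp add: d_def)
  \<comment> \<open>Lets the same bounds serve with the two sides of the parallelogram
    exchanged.\<close>
  have eq: "norm k + norm h = norm h + norm k" by simp
  let ?\<Delta> = "f (x + s *\<^sub>R h + s *\<^sub>R k) - f (x + s *\<^sub>R h) - f (x + s *\<^sub>R k) + f x"
  obtain a b where ab: "0 \<le> a" "a \<le> s" "0 \<le> b" "b \<le> s" "?\<Delta> = s * s * fh (x + a *\<^sub>R h + b *\<^sub>R k) k"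
    using second_difference_mean_value[OF \<open>s > 0\<close> in_S[OF _ _ _ _ refl] f' h] by blast
  obtain a' b' where ab': "0 \<le> a'" "a' \<le> s" "0 \<le> b'" "b' \<le> s"
    "f (x + s *\<^sub>R k + s *\<^sub>R h) - f (x + s *\<^sub>R k) - f (x + s *\<^sub>R h) + f x
      = s * s * fk (x + a' *\<^sub>R k + b' *\<^sub>R h) h"
    using second_difference_mean_value[OF \<open>s > 0\<close> in_S[OF _ _ _ _ eq] f' k] by blast
  have "?\<Delta> = s * s * fk (x + a' *\<^sub>R k + b' *\<^sub>R h) h"
    using ab'(5) by (simp add: algebra_simps)
  then have "fh (x + a *\<^sub>R h + b *\<^sub>R k) k = fk (x + a' *\<^sub>R k + b' *\<^sub>R h) h"
    using ab(5) \<open>s > 0\<close> by simp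
  moreover have "\<bar>fh (x + a *\<^sub>R h + b *\<^sub>R k) k - fh x k\<bar> < e"
    using near[OF ab(1-4) refl] d(3) by (simp add: d_def)
  moreover have "\<bar>fk (x + a' *\<^sub>R k + b' *\<^sub>R h) h - fk x h\<bar> < e"
    using near[OF ab'(1-4) eq] d(4) by (simp add: d_def)
  ultimately have "\<bar>fh x k - fk x h\<bar> < e + e"
    by linarith
  then show False
    by (simp add: e_def)
qed

lemma second_derivative_symmetric:
  fixes f :: "'e::real_normed_vector \<Rightarrow> 'f::euclidean_space"
  assumes "open S" "x \<in> S" "smooth_on S f"
  shows "frechet_derivative (\<lambda>y. frechet_derivative f (at y) h) (at x) k
    = frechet_derivative (\<lambda>y. frechet_derivative f (at y) k) (at x) h"
proof (rule euclidean_eqI)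
  fix b :: 'f assume "b \<in> Basis"
  let ?D = "\<lambda>y. frechet_derivative f (at y)"
  have lin: "bounded_linear (\<lambda>z. z \<bullet> b)" by (rule bounded_linear_inner_left)
  have smooth: "smooth_on S (\<lambda>y. ?D y v)" for v
    using assms smooth_on_frechet_derivative by blast
  note D = bounded_linear.has_derivative[OF lin smooth_on_has_derivative]
  have cont: "continuous_on S (\<lambda>y. frechet_derivative (\<lambda>z. ?D z u) (at y) v \<bullet> b)" for u v
    using smooth_on_continuous_on[OF smooth_on_frechet_derivative[OF smooth]]
      bounded_linear.continuous_on[OF lin] by blast
  show "frechet_derivative (\<lambda>y. ?D y h) (at x) k \<bullet> b = frechet_derivative (\<lambda>y. ?D y k) (at x) h \<bullet> b"
    by (rule second_derivative_symmetric_real[OF assms(1,2) D[OF assms(3)] D[OF smooth] D[OF smooth]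
          cont cont])
qed

section \<open>Atlases, tangent vectors and exterior derivatives\<close>

lemma Ck_on_Union:
  assumes "\<And>T. T \<in> \<T> \<Longrightarrow> open T \<and> Ck_on k T f"
  shows "Ck_on k (\<Union>\<T>) f"
  using assms
proof (induction k arbitrary: f)
  case 0
  then show ?case by (auto intro!: continuous_on_open_Union)
next
  case (Suc k)
  have "Ck_on k (\<Union>\<T>) (\<lambda>x. frechet_derivative f (at x) v)" for v
    using Suc by auto
  then show ?case using Suc.prems by auto
qed

text \<open>Being \<open>C^k\<close> passes to the union of all open sets on which \<open>f\<close>
  is smooth, and that union covers \<open>S\<close>.\<close>

lemma smooth_on_local:
  assumes "\<And>x. x \<in> S \<Longrightarrow> \<exists>T. open T \<and> x \<in> T \<and> smooth_on T f"
  shows "smooth_on S f"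
  unfolding smooth_on_def
proof
  fix k
  have "Ck_on k (\<Union>{T. open T \<and> smooth_on T f}) f"
    by (rule Ck_on_Union) (auto intro: smooth_on_Ck_on)
  then show "Ck_on k S f"
    by (rule Ck_on_subset) (use assms in blast)
qed

text \<open>The compatibility of charts on its own, in the form in which it is verified for the
  coframe bundles.\<close>

definition smooth_atlas :: "('a, 'e::euclidean_space) chart set \<Rightarrow> bool" where
  "smooth_atlas A \<longleftrightarrow>
     (\<forall>(U, \<phi>)\<in>A. inj_on \<phi> U \<and> open (\<phi> ` U)) \<and>
     (\<forall>(U, \<phi>)\<in>A. \<forall>(V, \<psi>)\<in>A.
        open (\<phi> ` (U \<inter> V)) \<and> smooth_on (\<phi> ` (U \<inter> V)) (\<psi> \<circ> inv_into U \<phi>))"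

lemma smooth_manifold_imp_atlas: "smooth_manifold A \<Longrightarrow> smooth_atlas A"
  by (simp add: smooth_manifold_def smooth_atlas_def)

lemma smooth_atlas_chart:
  assumes "smooth_atlas A" "(U, \<phi>) \<in> A"
  shows "inj_on \<phi> U" "open (\<phi> ` U)"
  using assms by (auto simp: smooth_atlas_def)

lemma inv_into_chart [simp]:
  "smooth_atlas A \<Longrightarrow> (U, \<phi>) \<in> A \<Longrightarrow> p \<in> U \<Longrightarrow> inv_into U \<phi> (\<phi> p) = p"
  by (simp add: smooth_atlas_chart inv_into_f_f)

lemma smooth_atlas_transition:
  assumes "smooth_atlas A" "(U, \<phi>) \<in> A" "(V, \<psi>) \<in> A"
  shows "open (\<phi> ` (U \<inter> V))" "smooth_on (\<phi> ` (U \<inter> V)) (\<psi> \<circ> inv_into U \<phi>)"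
  using assms unfolding smooth_atlas_def by blast+

lemma points_chart: "(U, \<phi>) \<in> A \<Longrightarrow> p \<in> U \<Longrightarrow> p \<in> points A"
  by (auto simp: points_def)

lemma pointsE:
  assumes "p \<in> points A"
  obtains U \<phi> where "(U, \<phi>) \<in> A" "p \<in> U"
  using assms by (auto simp: points_def)

text \<open>\<open>topology\<close> says nothing about a predicate until that predicate is known to
  be closed under binary intersections and arbitrary unions. The intersections are where injectivity
  of the charts enters.\<close>

lemma openin_mtop:
  assumes "smooth_atlas A"
  shows "openin (mtop A) W \<longleftrightarrow> W \<subseteq> points A \<and> (\<forall>(U, \<phi>)\<in>A. open (\<phi> ` (U \<inter> W)))"
proof -
  let ?P = "\<lambda>W. W \<subseteq> points A \<and> (\<forall>(U, \<phi>)\<in>A. open (\<phi> ` (U \<inter> W)))"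
  have "istopology ?P"
    unfolding istopology_def
  proof (intro conjI allI impI)
    fix S T assume ST: "?P S" "?P T"
    then show "S \<inter> T \<subseteq> points A" by auto
    show "\<forall>(U, \<phi>)\<in>A. open (\<phi> ` (U \<inter> (S \<inter> T)))"
    proof clarify
      fix U \<phi> assume c: "(U, \<phi>) \<in> A"
      have "\<phi> ` (U \<inter> (S \<inter> T)) = \<phi> ` (U \<inter> S) \<inter> \<phi> ` (U \<inter> T)"
        using smooth_atlas_chart(1)[OF assms c] by (auto simp: inj_on_def)
      then show "open (\<phi> ` (U \<inter> (S \<inter> T)))" using ST c by auto
    qed
  next
    fix K assume K: "\<forall>k\<in>K. ?P k"
    then show "\<Union>K \<subseteq> points A" by auto
    show "\<forall>(U, \<phi>)\<in>A. open (\<phi> ` (U \<inter> \<Union>K))"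
    proof clarify
      fix U \<phi> assume c: "(U, \<phi>) \<in> A"
      have "open (\<Union>k\<in>K. \<phi> ` (U \<inter> k))" using K c by (intro open_UN) blast
      also have "(\<Union>k\<in>K. \<phi> ` (U \<inter> k)) = \<phi> ` (U \<inter> \<Union>K)" by auto
      finally show "open (\<phi> ` (U \<inter> \<Union>K))" .
    qed
  qed
  then show ?thesis
    unfolding mtop_def by (simp add: topology_inverse')
qed

lemma openin_chart_image:
  "smooth_atlas A \<Longrightarrow> openin (mtop A) W \<Longrightarrow> (U, \<phi>) \<in> A \<Longrightarrow> open (\<phi> ` (U \<inter> W))"
  by (auto simp: openin_mtop)

lemma openin_points: "smooth_atlas A \<Longrightarrow> openin (mtop A) (points A)"
proof -
  assume A: "smooth_atlas A"
  have "U \<inter> points A = U" if "(U, \<phi>) \<in> A" for U \<phi>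
    using points_chart[OF that] by blast
  then show ?thesis
    using smooth_atlas_chart(2)[OF A] by (auto simp: openin_mtop[OF A])
qed

lemma topspace_mtop [simp]:
  assumes "smooth_atlas A"
  shows "topspace (mtop A) = points A"
proof
  show "points A \<subseteq> topspace (mtop A)"
    using openin_points[OF assms] by (rule openin_subset)
  show "topspace (mtop A) \<subseteq> points A"
    using openin_topspace[of "mtop A"] unfolding openin_mtop[OF assms] by blast
qed

lemma openin_chart: "smooth_atlas A \<Longrightarrow> (U, \<phi>) \<in> A \<Longrightarrow> openin (mtop A) U"
  using smooth_atlas_transition(1)[of A _ _ U \<phi>] points_chart[of U \<phi> A]
  by (auto simp: openin_mtop)

text \<open>A transition map may be given by any explicit formula \<open>G\<close>, so the inverse
  of a bundle chart never has to be computed. Pairing a chart with itself yields the openness of its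
  image.\<close>

lemma smooth_atlasI:
  assumes inj: "\<And>U \<phi>. (U, \<phi>) \<in> A \<Longrightarrow> inj_on \<phi> U"
    and trans: "\<And>U \<phi> V \<psi>. (U, \<phi>) \<in> A \<Longrightarrow> (V, \<psi>) \<in> A \<Longrightarrow> open (\<phi> ` (U \<inter> V)) \<and>
      (\<exists>G. smooth_on (\<phi> ` (U \<inter> V)) G \<and> (\<forall>p\<in>U \<inter> V. \<psi> p = G (\<phi> p)))"
  shows "smooth_atlas A"
proof -
  have "smooth_on (\<phi> ` (U \<inter> V)) (\<psi> \<circ> inv_into U \<phi>)" if c: "(U, \<phi>) \<in> A" "(V, \<psi>) \<in> A" for U \<phi> V \<psi>
  proof -
    obtain G where G: "smooth_on (\<phi> ` (U \<inter> V)) G" "\<forall>p\<in>U \<inter> V. \<psi> p = G (\<phi> p)"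
      using trans[OF c] by blast
    show ?thesis
      by (rule smooth_on_cong[OF _ _ G(1)]) (use trans[OF c] G(2) inj[OF c(1)] in auto)
  qed
  moreover have "open (\<phi> ` U)" if "(U, \<phi>) \<in> A" for U \<phi>
    using trans[OF that that] by auto
  ultimately show ?thesis
    using inj trans unfolding smooth_atlas_def by blast
qed

text \<open>Continuity follows from the local formulas: in a chart of the source, the preimage of an
  open set is a union, over the charts of the target, of preimages under the functions
  \<open>G\<close>.\<close>

lemma smooth_mapI:
  assumes A: "smooth_atlas A" and B: "smooth_atlas B"
    and F: "\<And>p. p \<in> points A \<Longrightarrow> F p \<in> points B"
    and G: "\<And>U \<phi> V \<psi>. (U, \<phi>) \<in> A \<Longrightarrow> (V, \<psi>) \<in> B \<Longrightarrow> open (\<phi> ` (U \<inter> F -` V)) \<and>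
      (\<exists>G. smooth_on (\<phi> ` (U \<inter> F -` V)) G \<and> (\<forall>p\<in>U \<inter> F -` V. \<psi> (F p) = G (\<phi> p)))"
  shows "smooth_map A B F"
proof -
  have "openin (mtop A) {x \<in> points A. F x \<in> W}" if W: "openin (mtop B) W" for W
    unfolding openin_mtop[OF A]
  proof (intro conjI ballI, simp, clarify)
    fix U \<phi> assume c: "(U, \<phi>) \<in> A"
    have "open (\<phi> ` (U \<inter> F -` (V \<inter> W)))" if c': "(V, \<psi>) \<in> B" for V \<psi>
    proof -
      obtain G where o: "open (\<phi> ` (U \<inter> F -` V))" and G: "smooth_on (\<phi> ` (U \<inter> F -` V)) G"
        "\<forall>p\<in>U \<inter> F -` V. \<psi> (F p) = G (\<phi> p)" using G[OF c c'] by blast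
      \<comment> \<open>Injectivity of \<psi> turns membership of \<open>G y\<close> in a chart
        image back into membership of \<open>F p\<close> in \<open>W\<close>.\<close>
      have "\<phi> ` (U \<inter> F -` (V \<inter> W)) = \<phi> ` (U \<inter> F -` V) \<inter> G -` (\<psi> ` (V \<inter> W))"
      proof (intro equalityI subsetI)
        fix y assume "y \<in> \<phi> ` (U \<inter> F -` V) \<inter> G -` (\<psi> ` (V \<inter> W))"
        then obtain p z where p: "p \<in> U" "F p \<in> V" "y = \<phi> p" "z \<in> V" "z \<in> W" "G y = \<psi> z" by auto
        then have "F p = z"
          using G(2) smooth_atlas_chart(1)[OF B c'] by (auto simp: inj_on_def)
        then show "y \<in> \<phi> ` (U \<inter> F -` (V \<inter> W))" using p by auto
      next
        fix y assume "y \<in> \<phi> ` (U \<inter> F -` (V \<inter> W))"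
        then obtain p where p: "p \<in> U" "F p \<in> V" "F p \<in> W" "y = \<phi> p" by auto
        moreover have "G y = \<psi> (F p)" using G(2) p by auto
        ultimately show "y \<in> \<phi> ` (U \<inter> F -` V) \<inter> G -` (\<psi> ` (V \<inter> W))" by auto
      qed
      then show ?thesis
        using continuous_open_preimage[OF smooth_on_continuous_on[OF G(1)] o
            openin_chart_image[OF B W c']] by simp
    qed
    then have "open (\<Union>(V, \<psi>)\<in>B. \<phi> ` (U \<inter> F -` (V \<inter> W)))" by auto
    also have "(\<Union>(V, \<psi>)\<in>B. \<phi> ` (U \<inter> F -` (V \<inter> W))) = \<phi> ` (U \<inter> {x \<in> points A. F x \<in> W})"
      using F c by (fastforce simp: points_def)
    finally show "open (\<phi> ` (U \<inter> {x \<in> points A. F x \<in> W}))" .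
  qed
  then have "continuous_map (mtop A) (mtop B) F"
    using A B F by (auto simp: continuous_map)
  moreover have "smooth_on (\<phi> ` (U \<inter> F -` V)) (\<psi> \<circ> F \<circ> inv_into U \<phi>)"
    if c: "(U, \<phi>) \<in> A" "(V, \<psi>) \<in> B" for U \<phi> V \<psi>
  proof -
    obtain G' where G': "smooth_on (\<phi> ` (U \<inter> F -` V)) G'" "\<forall>p\<in>U \<inter> F -` V. \<psi> (F p) = G' (\<phi> p)"
      using G[OF c] by blast
    show ?thesis
      by (rule smooth_on_cong[OF _ _ G'(1)]) (use G[OF c] G'(2) A c in auto)
  qed
  ultimately show ?thesis
    unfolding smooth_map_def by blast
qed

lemma smooth_mapD:
  assumes A: "smooth_atlas A" and B: "smooth_atlas B" and F: "smooth_map A B F"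
  shows "p \<in> points A \<Longrightarrow> F p \<in> points B"
    and "openin (mtop B) W \<Longrightarrow> openin (mtop A) {x \<in> points A. F x \<in> W}"
    and "(U, \<phi>) \<in> A \<Longrightarrow> (V, \<psi>) \<in> B \<Longrightarrow> open (\<phi> ` (U \<inter> F -` V))"
    and "(U, \<phi>) \<in> A \<Longrightarrow> (V, \<psi>) \<in> B \<Longrightarrow> smooth_on (\<phi> ` (U \<inter> F -` V)) (\<psi> \<circ> F \<circ> inv_into U \<phi>)"
proof -
  have cont: "continuous_map (mtop A) (mtop B) F"
    using F by (simp add: smooth_map_def)
  show "p \<in> points A \<Longrightarrow> F p \<in> points B"
    using cont A B by (auto simp: continuous_map)
  show *: "openin (mtop B) W \<Longrightarrow> openin (mtop A) {x \<in> points A. F x \<in> W}" for W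
    using cont A B by (auto simp: continuous_map)
  show "open (\<phi> ` (U \<inter> F -` V))" if c: "(U, \<phi>) \<in> A" "(V, \<psi>) \<in> B"
  proof -
    have "U \<inter> {x \<in> points A. F x \<in> V} = U \<inter> F -` V"
      using c by (auto simp: points_def)
    then show ?thesis
      using openin_chart_image[OF A *[OF openin_chart[OF B c(2)]] c(1)] by simp
  qed
  show "smooth_on (\<phi> ` (U \<inter> F -` V)) (\<psi> \<circ> F \<circ> inv_into U \<phi>)" if c: "(U, \<phi>) \<in> A" "(V, \<psi>) \<in> B"
    using F that unfolding smooth_map_def by blast
qed

lemma smooth_map_id:
  assumes A: "smooth_atlas A"
  shows "smooth_map A A id"
proof (rule smooth_mapI[OF A A])
  fix U \<phi> V \<psi> assume c: "(U, \<phi>) \<in> A" "(V, \<psi>) \<in> A"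
  show "open (\<phi> ` (U \<inter> id -` V)) \<and>
      (\<exists>G. smooth_on (\<phi> ` (U \<inter> id -` V)) G \<and> (\<forall>p\<in>U \<inter> id -` V. \<psi> (id p) = G (\<phi> p)))"
    using smooth_atlas_transition[OF A c] A c by (intro conjI exI[of _ "\<psi> \<circ> inv_into U \<phi>"]) auto
qed simp

text \<open>Test functions are total HOL functions. Their values off the manifold must not matter,
  since the maps compared later agree only on the points of an atlas.\<close>

lemma smooth_near_cong:
  assumes A: "smooth_atlas A" and "\<And>x. x \<in> points A \<Longrightarrow> f x = g x" and "smooth_near A p f"
  shows "smooth_near A p g"
proof -
  obtain W where W: "openin (mtop A) W" "p \<in> W" "smooth_fun_on A W f"
    using assms(3) unfolding smooth_near_def by blast
  have "smooth_on (\<phi> ` (U \<inter> W)) (g \<circ> inv_into U \<phi>)" if c: "(U, \<phi>) \<in> A" for U \<phi>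
  proof (rule smooth_on_cong)
    show "smooth_on (\<phi> ` (U \<inter> W)) (f \<circ> inv_into U \<phi>)"
      using W(3) c by (auto simp: smooth_fun_on_def)
    show "open (\<phi> ` (U \<inter> W))" using openin_chart_image[OF A W(1) c] .
  qed (use assms(2) A c points_chart[OF c] in auto)
  then show ?thesis
    using W unfolding smooth_near_def smooth_fun_on_def by blast
qed

lemma smooth_near_differentiable:
  assumes A: "smooth_atlas A" and c: "(U, \<phi>) \<in> A" "p \<in> U" and "smooth_near A p f"
  shows "(f \<circ> inv_into U \<phi>) differentiable (at (\<phi> p))"
proof -
  obtain W where W: "openin (mtop A) W" "p \<in> W" "smooth_fun_on A W f"
    using assms(4) unfolding smooth_near_def by blast
  have "smooth_on (\<phi> ` (U \<inter> W)) (f \<circ> inv_into U \<phi>)"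
    using W(3) c by (auto simp: smooth_fun_on_def)
  from smooth_on_differentiable[OF this] show ?thesis
    using c W by blast
qed

text \<open>In charts \<open>g \<circ> F\<close> factors through a chart of the target only where
  \<open>F\<close> stays in its domain; hence the patching by
  \<open>smooth_on_local\<close>.\<close>

lemma smooth_near_compose:
  assumes A: "smooth_atlas A" and B: "smooth_atlas B" and F: "smooth_map A B F"
    and p: "p \<in> points A" and g: "smooth_near B (F p) g"
  shows "smooth_near A p (g \<circ> F)"
proof -
  obtain W where W: "openin (mtop B) W" "F p \<in> W" "smooth_fun_on B W g"
    using g unfolding smooth_near_def by blast
  let ?W = "{x \<in> points A. F x \<in> W}"
  have "smooth_on (\<phi> ` (U \<inter> ?W)) (g \<circ> F \<circ> inv_into U \<phi>)" if c: "(U, \<phi>) \<in> A" for U \<phi>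
  proof (rule smooth_on_local)
    fix y assume "y \<in> \<phi> ` (U \<inter> ?W)"
    then obtain x where x: "x \<in> U" "F x \<in> W" "y = \<phi> x" by auto
    then obtain V \<psi> where c': "(V, \<psi>) \<in> B" "F x \<in> V"
      using smooth_mapD(1)[OF A B F] points_chart[OF c] by (meson pointsE)
    let ?W' = "{x \<in> points A. F x \<in> V \<inter> W}"
    let ?T = "\<phi> ` (U \<inter> ?W')"
    have o: "open ?T"
      by (intro openin_chart_image[OF A _ c] smooth_mapD(2)[OF A B F] openin_Int openin_chart[OF B c'(1)] W(1))
    have sF: "smooth_on ?T (\<psi> \<circ> F \<circ> inv_into U \<phi>)"
      by (rule smooth_on_subset[OF smooth_mapD(4)[OF A B F c c'(1)]]) auto
    have sg: "smooth_on (\<psi> ` (V \<inter> W)) (g \<circ> inv_into V \<psi>)"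
      using W(3) c' by (auto simp: smooth_fun_on_def)
    have "smooth_on ?T (\<lambda>y. (g \<circ> inv_into V \<psi>) ((\<psi> \<circ> F \<circ> inv_into U \<phi>) y))"
      by (rule smooth_on_compose[OF o _ _ sF sg]) (use A B c c' W(1) openin_chart_image in auto)
    then have "smooth_on ?T (g \<circ> F \<circ> inv_into U \<phi>)"
      by (rule smooth_on_cong[OF o, rotated]) (use A B c c' in auto)
    moreover have "y \<in> ?T" using x c c' by (auto simp: points_def)
    ultimately show "\<exists>T. open T \<and> y \<in> T \<and> smooth_on T (g \<circ> F \<circ> inv_into U \<phi>)"
      using o by blast
  qed
  moreover have "openin (mtop A) ?W" using smooth_mapD(2)[OF A B F W(1)] .
  ultimately show ?thesis
    using p W(2) unfolding smooth_near_def smooth_fun_on_def by (intro exI[of _ ?W]) auto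
qed

section \<open>Tangent vectors in a chart and differentials of maps\<close>

lemma smooth_near_coordinate:
  assumes A: "smooth_atlas A" and c: "(U, \<phi>) \<in> A" "p \<in> U"
  shows "smooth_near A p (\<lambda>x. \<phi> x \<bullet> b)"
proof -
  have "smooth_on (\<psi> ` (V \<inter> U)) ((\<lambda>x. \<phi> x \<bullet> b) \<circ> inv_into V \<psi>)" if c': "(V, \<psi>) \<in> A" for V \<psi>
    using smooth_on_bounded_linear[OF bounded_linear_inner_left smooth_atlas_transition[OF A c' c(1)], of b]
    by (simp add: o_def)
  then show ?thesis
    using openin_chart[OF A c(1)] c(2) unfolding smooth_near_def smooth_fun_on_def by blast
qed

text \<open>Coordinate functions are the test functions that recover the components of
  \<open>h\<close>, so a derivation determines its components in a chart.\<close>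

lemma chart_vec_coordinate:
  assumes A: "smooth_atlas A" and c: "(U, \<phi>) \<in> A" "p \<in> U"
  shows "chart_vec A (U, \<phi>) p h (\<lambda>x. \<phi> x \<bullet> b) = h \<bullet> b"
proof -
  have "((\<lambda>y. y \<bullet> b) has_derivative (\<lambda>y. y \<bullet> b)) (at (\<phi> p))"
    by (intro derivative_eq_intros) auto
  then have "((\<lambda>x. \<phi> x \<bullet> b) \<circ> inv_into U \<phi> has_derivative (\<lambda>y. y \<bullet> b)) (at (\<phi> p))"
    by (rule has_derivative_transform_within_open[of _ _ _ _ "\<phi> ` U"])
      (use A c smooth_atlas_chart(2)[OF A c(1)] in auto)
  from frechet_derivative_at[OF this, symmetric] show ?thesis
    using smooth_near_coordinate[OF A c] by (simp add: chart_vec_def)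
qed

lemma chart_vec_inject:
  assumes "smooth_atlas A" "(U, \<phi>) \<in> A" "p \<in> U"
  shows "chart_vec A (U, \<phi>) p h = chart_vec A (U, \<phi>) p k \<longleftrightarrow> h = k"
proof
  assume "chart_vec A (U, \<phi>) p h = chart_vec A (U, \<phi>) p k"
  then have "h \<bullet> b = k \<bullet> b" for b
    using chart_vec_coordinate[OF assms, of h b] chart_vec_coordinate[OF assms, of k b] by simp
  then show "h = k" by (rule euclidean_eqI)
qed simp

lemma chart_vec_add:
  assumes "smooth_atlas A" "(U, \<phi>) \<in> A" "p \<in> U"
  shows "chart_vec A (U, \<phi>) p (h + k) = vadd (chart_vec A (U, \<phi>) p h) (chart_vec A (U, \<phi>) p k)"
  using linear_add[OF linear_frechet_derivative[OF smooth_near_differentiable[OF assms]]]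
  by (auto simp: chart_vec_def vadd_def)

lemma chart_vec_scale:
  assumes "smooth_atlas A" "(U, \<phi>) \<in> A" "p \<in> U"
  shows "chart_vec A (U, \<phi>) p (c *\<^sub>R h) = vscale c (chart_vec A (U, \<phi>) p h)"
  using linear_scale[OF linear_frechet_derivative[OF smooth_near_differentiable[OF assms]]]
  by (auto simp: chart_vec_def vscale_def)

lemma chart_vec_zero:
  assumes "smooth_atlas A" "(U, \<phi>) \<in> A" "p \<in> U"
  shows "chart_vec A (U, \<phi>) p 0 = vzero"
  using chart_vec_scale[OF assms, of 0 0] by (simp add: vscale_def vzero_def)

lemma chart_vec_cong:
  assumes A: "smooth_atlas A" and c: "(U, \<phi>) \<in> A" "p \<in> U"
    and fg: "\<And>x. x \<in> points A \<Longrightarrow> f x = g x"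
  shows "chart_vec A (U, \<phi>) p h f = chart_vec A (U, \<phi>) p h g"
proof (cases "smooth_near A p f")
  case True
  then have g: "smooth_near A p g" by (intro smooth_near_cong[OF A _ True] fg)
  have "(f \<circ> inv_into U \<phi> has_derivative frechet_derivative (f \<circ> inv_into U \<phi>) (at (\<phi> p))) (at (\<phi> p))"
    using smooth_near_differentiable[OF A c True] by (simp add: frechet_derivative_works)
  then have "(g \<circ> inv_into U \<phi> has_derivative frechet_derivative (f \<circ> inv_into U \<phi>) (at (\<phi> p))) (at (\<phi> p))"
    by (rule has_derivative_transform_within_open[of _ _ _ _ "\<phi> ` U"])
      (use A c smooth_atlas_chart(2)[OF A c(1)] fg points_chart[OF c(1)] in auto)
  from frechet_derivative_at[OF this] show ?thesis
    using True g by (simp add: chart_vec_def)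
next
  case False
  have "\<not> smooth_near A p g"
    using False smooth_near_cong[OF A, of g f p] fg by auto
  with False show ?thesis by (simp add: chart_vec_def)
qed

lemma chart_vec_in_tangent_space:
  "(U, \<phi>) \<in> A \<Longrightarrow> p \<in> U \<Longrightarrow> chart_vec A (U, \<phi>) p h \<in> tangent_space A p"
  unfolding tangent_space_def by force

lemma tangent_vec_cong:
  assumes "smooth_atlas A" "v \<in> tangent_space A p" "\<And>x. x \<in> points A \<Longrightarrow> f x = g x"
  shows "v f = v g"
proof -
  obtain U \<phi> h where "(U, \<phi>) \<in> A" "p \<in> U" "v = chart_vec A (U, \<phi>) p h"
    using assms(2) by (auto simp: tangent_space_def)
  then show ?thesis by (auto intro!: chart_vec_cong[OF assms(1)] assms(3))
qed

lemma tangent_vec_not_smooth: "v \<in> tangent_space A p \<Longrightarrow> \<not> smooth_near A p f \<Longrightarrow> v f = 0"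
  by (auto simp: tangent_space_def chart_vec_def)

text \<open>The chain rule for derivations. On functions that are not smooth near \<open>F p\<close>
  both sides take the default value 0.\<close>

lemma tangent_map_chart_vec:
  assumes A: "smooth_atlas A" and B: "smooth_atlas B" and F: "smooth_map A B F"
    and c: "(U, \<phi>) \<in> A" "p \<in> U" and c': "(V, \<psi>) \<in> B" "F p \<in> V"
  shows "tangent_map B F p (chart_vec A (U, \<phi>) p h) =
    chart_vec B (V, \<psi>) (F p) (frechet_derivative (\<psi> \<circ> F \<circ> inv_into U \<phi>) (at (\<phi> p)) h)"
proof
  fix g
  show "tangent_map B F p (chart_vec A (U, \<phi>) p h) g =
    chart_vec B (V, \<psi>) (F p) (frechet_derivative (\<psi> \<circ> F \<circ> inv_into U \<phi>) (at (\<phi> p)) h) g"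
  proof (cases "smooth_near B (F p) g")
    case g: True
    let ?f = "\<psi> \<circ> F \<circ> inv_into U \<phi>" and ?g = "g \<circ> inv_into V \<psi>"
    have gF: "smooth_near A p (g \<circ> F)"
      using smooth_near_compose[OF A B F points_chart[OF c] g] .
    have y: "\<phi> p \<in> \<phi> ` (U \<inter> F -` V)" using c c' by auto
    have f: "(?f has_derivative frechet_derivative ?f (at (\<phi> p))) (at (\<phi> p))"
      using smooth_on_has_derivative[OF smooth_mapD(4)[OF A B F c(1) c'(1)] y] .
    have g': "(?g has_derivative frechet_derivative ?g (at (?f (\<phi> p)))) (at (?f (\<phi> p)))"
      using smooth_near_differentiable[OF B c' g] A c by (simp add: frechet_derivative_works)
    have "((\<lambda>y. ?g (?f y)) has_derivative
        (\<lambda>v. frechet_derivative ?g (at (?f (\<phi> p))) (frechet_derivative ?f (at (\<phi> p)) v))) (at (\<phi> p))"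
      using has_derivative_compose[OF f g'] .
    then have "((g \<circ> F) \<circ> inv_into U \<phi> has_derivative
        (\<lambda>v. frechet_derivative ?g (at (?f (\<phi> p))) (frechet_derivative ?f (at (\<phi> p)) v))) (at (\<phi> p))"
      by (rule has_derivative_transform_within_open[OF _ smooth_mapD(3)[OF A B F c(1) c'(1)] y])
        (use A B c c' in auto)
    from frechet_derivative_at[OF this, symmetric] show ?thesis
      using g gF A c by (simp add: tangent_map_def chart_vec_def)
  qed (simp add: tangent_map_def chart_vec_def)
qed

lemma tangent_map_id: "v \<in> tangent_space A p \<Longrightarrow> tangent_map A id p v = v"
  by (auto simp: tangent_map_def tangent_vec_not_smooth)

text \<open>If \<open>g\<close> is smooth near \<open>G (F p)\<close>, then
  \<open>g \<circ> G\<close> is smooth near \<open>F p\<close>, so the default value 0 of the inner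
  differential does not intervene.\<close>

lemma tangent_map_compose:
  assumes "smooth_atlas B" "smooth_atlas C" "smooth_map B C G" "F p \<in> points B"
  shows "tangent_map C G (F p) (tangent_map B F p v) = tangent_map C (G \<circ> F) p v"
  using smooth_near_compose[OF assms(1-4)] by (auto simp: tangent_map_def o_assoc)

text \<open>A change of charts is the differential of the identity map, written in two
  charts.\<close>

lemma chart_vec_change:
  assumes A: "smooth_atlas A" and c: "(U, \<phi>) \<in> A" "p \<in> U" and c': "(V, \<psi>) \<in> A" "p \<in> V"
  shows "chart_vec A (U, \<phi>) p h =
    chart_vec A (V, \<psi>) p (frechet_derivative (\<psi> \<circ> inv_into U \<phi>) (at (\<phi> p)) h)"
  using tangent_map_chart_vec[OF A A smooth_map_id[OF A] c, of V \<psi>] c'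
    tangent_map_id[OF chart_vec_in_tangent_space[OF c]] by simp

lemma tangent_spaceE:
  assumes A: "smooth_atlas A" and c: "(U, \<phi>) \<in> A" "p \<in> U" and v: "v \<in> tangent_space A p"
  obtains h where "v = chart_vec A (U, \<phi>) p h"
proof -
  obtain V \<psi> k where "(V, \<psi>) \<in> A" "p \<in> V" "v = chart_vec A (V, \<psi>) p k"
    using v by (auto simp: tangent_space_def)
  then show ?thesis
    using chart_vec_change[OF A _ _ c] that by metis
qed

section \<open>Tangent and cotangent spaces as vector spaces\<close>

lemma tangent_space_points: "v \<in> tangent_space A p \<Longrightarrow> p \<in> points A"
  by (auto simp: tangent_space_def points_def)

lemma vadd_in_tangent_space:
  assumes A: "smooth_atlas A" and "u \<in> tangent_space A p" "v \<in> tangent_space A p"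
  shows "vadd u v \<in> tangent_space A p"
proof -
  obtain U \<phi> where c: "(U, \<phi>) \<in> A" "p \<in> U"
    using assms(2) tangent_space_points pointsE by metis
  obtain h k where "u = chart_vec A (U, \<phi>) p h" "v = chart_vec A (U, \<phi>) p k"
    using tangent_spaceE[OF A c] assms(2,3) by metis
  then show ?thesis
    using chart_vec_add[OF A c] chart_vec_in_tangent_space[OF c] by metis
qed

lemma vscale_in_tangent_space:
  assumes A: "smooth_atlas A" and "v \<in> tangent_space A p"
  shows "vscale c v \<in> tangent_space A p"
proof -
  obtain U \<phi> where c: "(U, \<phi>) \<in> A" "p \<in> U"
    using assms(2) tangent_space_points pointsE by metis
  obtain h where "v = chart_vec A (U, \<phi>) p h"
    using tangent_spaceE[OF A c] assms(2) by metis
  then show ?thesis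
    using chart_vec_scale[OF A c] chart_vec_in_tangent_space[OF c] by metis
qed

lemma tangent_map_in_tangent_space:
  assumes A: "smooth_atlas A" and B: "smooth_atlas B" and F: "smooth_map A B F"
    and v: "v \<in> tangent_space A p"
  shows "tangent_map B F p v \<in> tangent_space B (F p)"
proof -
  obtain U \<phi> h where c: "(U, \<phi>) \<in> A" "p \<in> U" "v = chart_vec A (U, \<phi>) p h"
    using v by (auto simp: tangent_space_def)
  obtain V \<psi> where c': "(V, \<psi>) \<in> B" "F p \<in> V"
    using smooth_mapD(1)[OF A B F] points_chart[OF c(1,2)] by (meson pointsE)
  show ?thesis
    using tangent_map_chart_vec[OF A B F c(1,2) c'] chart_vec_in_tangent_space[OF c'] c(3) by simp
qed

lemma cotangent_linear:
  assumes A: "smooth_atlas A" and c: "(U, \<phi>) \<in> A" "p \<in> U" and \<alpha>: "\<alpha> \<in> cotangent_space A p"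
  shows "linear (\<lambda>h. \<alpha> (chart_vec A (U, \<phi>) p h))"
proof (rule linearI)
  fix h k r
  note T = chart_vec_in_tangent_space[OF c]
  show "\<alpha> (chart_vec A (U, \<phi>) p (h + k)) = \<alpha> (chart_vec A (U, \<phi>) p h) + \<alpha> (chart_vec A (U, \<phi>) p k)"
    using \<alpha> T by (simp add: cotangent_space_def chart_vec_add[OF A c])
  show "\<alpha> (chart_vec A (U, \<phi>) p (r *\<^sub>R h)) = r *\<^sub>R \<alpha> (chart_vec A (U, \<phi>) p h)"
    using \<alpha> T by (simp add: cotangent_space_def chart_vec_scale[OF A c])
qed

lemma form_coeff_chart [simp]:
  "smooth_atlas A \<Longrightarrow> (U, \<phi>) \<in> A \<Longrightarrow> p \<in> U \<Longrightarrow>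
    form_coeff A (U, \<phi>) \<alpha> h (\<phi> p) = \<alpha> p (chart_vec A (U, \<phi>) p h)"
  by (simp add: form_coeff_def)

subsection \<open>The exterior derivative\<close>

text \<open>The terms with second derivatives of \<open>f\<close> cancel by symmetry.\<close>

lemma exterior_derivative_pullback:
  fixes f :: "'e::euclidean_space \<Rightarrow> 'f::euclidean_space"
    and a :: "'e \<Rightarrow> 'e \<Rightarrow> real" and b :: "'f \<Rightarrow> 'f \<Rightarrow> real"
  assumes S: "open S" "y \<in> S" and T: "open T" "f y \<in> T" and f: "smooth_on S f"
    and a: "\<And>h z. z \<in> S \<Longrightarrow> a h z = b (frechet_derivative f (at z) h) (f z)"
    and lin: "\<And>z. z \<in> T \<Longrightarrow> linear (\<lambda>h. b h z)"
    and diff: "\<And>h. b h differentiable (at (f y))"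
  defines "f' \<equiv> frechet_derivative f (at y)"
  shows "frechet_derivative (a k) (at y) h - frechet_derivative (a h) (at y) k =
    frechet_derivative (b (f' k)) (at (f y)) (f' h) - frechet_derivative (b (f' h)) (at (f y)) (f' k)"
proof -
  let ?b' = "\<lambda>h. frechet_derivative (b h) (at (f y))"
  let ?f2 = "\<lambda>h. frechet_derivative (\<lambda>z. frechet_derivative f (at z) h) (at y)"
  have b': "(b h has_derivative ?b' h) (at (f y))" for h
    using diff by (simp add: frechet_derivative_works)
  have bsum: "b h z = (\<Sum>i\<in>Basis. (h \<bullet> i) * b i z)" if "z \<in> T" for h z
    using linear_sum_Basis[OF lin[OF that], of h] by simp
  \<comment> \<open>Linearity in the direction holds throughout the open set \<open>T\<close>, so it
    survives differentiation in the point.\<close>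
  have b'sum: "?b' h v = (\<Sum>i\<in>Basis. (h \<bullet> i) * ?b' i v)" for h v
  proof -
    have "((\<lambda>z. \<Sum>i\<in>Basis. (h \<bullet> i) * b i z) has_derivative (\<lambda>v. \<Sum>i\<in>Basis. (h \<bullet> i) * ?b' i v)) (at (f y))"
      by (auto intro!: derivative_eq_intros b')
    then have "(b h has_derivative (\<lambda>v. \<Sum>i\<in>Basis. (h \<bullet> i) * ?b' i v)) (at (f y))"
      by (rule has_derivative_transform_within_open[OF _ T]) (simp add: bsum)
    from frechet_derivative_at[OF this] show ?thesis by metis
  qed
  have f': "(f has_derivative f') (at y)"
    unfolding f'_def using smooth_on_has_derivative[OF f S(2)] .
  have f2: "((\<lambda>z. frechet_derivative f (at z) h) has_derivative ?f2 h) (at y)" for h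
    using smooth_on_has_derivative[OF smooth_on_frechet_derivative[OF f] S(2)] .
  let ?S = "S \<inter> f -` T"
  have oS: "open ?S"
    using continuous_open_preimage[OF smooth_on_continuous_on[OF f] S(1) T(1)] .
  \<comment> \<open>In \<open>a h\<close> both the direction and the base point of \<open>b\<close>
    move: the sum comes from the moving direction, the last term from the moving point.\<close>
  have a': "frechet_derivative (a h) (at y) k =
      (\<Sum>i\<in>Basis. (?f2 h k \<bullet> i) * b i (f y)) + ?b' (f' h) (f' k)" for h k
  proof -
    have "((\<lambda>z. \<Sum>i\<in>Basis. (frechet_derivative f (at z) h \<bullet> i) * b i (f z)) has_derivative
        (\<lambda>k. \<Sum>i\<in>Basis. (frechet_derivative f (at y) h \<bullet> i) * ?b' i (f' k) + (?f2 h k \<bullet> i) * b i (f y))) (at y)"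
      by (intro has_derivative_sum has_derivative_mult has_derivative_inner_left f2
          has_derivative_compose[OF f' b'])
    then have "(a h has_derivative (\<lambda>k. \<Sum>i\<in>Basis. (frechet_derivative f (at y) h \<bullet> i) * ?b' i (f' k)
        + (?f2 h k \<bullet> i) * b i (f y))) (at y)"
      by (rule has_derivative_transform_within_open[OF _ oS]) (use S T a bsum in auto)
    from frechet_derivative_at[OF this, symmetric] show ?thesis
      by (simp add: f'_def[symmetric] b'sum[of "f' h"] sum.distrib)
  qed
  show ?thesis
    unfolding a' using second_derivative_symmetric[OF S f, of h k] by simp
qed

text \<open>The regularity under which the formula for \<open>ext_d\<close> at \<open>p\<close>
  makes sense. It is formulated to cover a \<open>one_form_on\<close> as well as the tautological
  forms, whose definition includes no extension by zero.\<close>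

definition C1_form_at :: "('a, 'e::euclidean_space) chart set \<Rightarrow> 'a \<Rightarrow> ('a \<Rightarrow> 'a covec) \<Rightarrow> bool" where
  "C1_form_at A p \<alpha> \<longleftrightarrow>
     (\<exists>W. openin (mtop A) W \<and> p \<in> W \<and>
        (\<forall>(U, \<phi>)\<in>A. \<forall>q\<in>U \<inter> W. linear (\<lambda>h. \<alpha> q (chart_vec A (U, \<phi>) q h)))) \<and>
     (\<forall>(U, \<phi>)\<in>A. p \<in> U \<longrightarrow> (\<forall>h. form_coeff A (U, \<phi>) \<alpha> h differentiable (at (\<phi> p))))"

lemma one_form_on_C1:
  assumes A: "smooth_atlas A" and W: "openin (mtop A) W" "p \<in> W" and \<alpha>: "one_form_on A W \<alpha>"
  shows "C1_form_at A p \<alpha>"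
  unfolding C1_form_at_def
proof
  have "linear (\<lambda>h. \<alpha> q (chart_vec A (U, \<phi>) q h))" if "(U, \<phi>) \<in> A" "q \<in> U \<inter> W" for U \<phi> q
    using \<alpha> that by (intro cotangent_linear[OF A]) (auto simp: one_form_on_def)
  with W show "\<exists>W. openin (mtop A) W \<and> p \<in> W \<and>
        (\<forall>(U, \<phi>)\<in>A. \<forall>q\<in>U \<inter> W. linear (\<lambda>h. \<alpha> q (chart_vec A (U, \<phi>) q h)))" by blast
  show "\<forall>(U, \<phi>)\<in>A. p \<in> U \<longrightarrow> (\<forall>h. form_coeff A (U, \<phi>) \<alpha> h differentiable (at (\<phi> p)))"
  proof clarify
    fix U \<phi> h assume c: "(U, \<phi>) \<in> A" "p \<in> U"
    then have "smooth_on (\<phi> ` (U \<inter> W)) (form_coeff A (U, \<phi>) \<alpha> h)"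
      using \<alpha> by (auto simp: one_form_on_def)
    then show "form_coeff A (U, \<phi>) \<alpha> h differentiable (at (\<phi> p))"
      using smooth_on_differentiable W(2) c by blast
  qed
qed

text \<open>Every chart around \<open>p\<close> yields the same number, because
  \<open>exterior_derivative_pullback\<close> expresses it in one fixed chart of \<open>B\<close>;
  this gives existence and uniqueness for the definite description in \<open>ext_d\<close> at once.
  With \<open>F = id\<close> it becomes independence of the chart, in general naturality.\<close>

lemma ext_d_pullback_chart:
  assumes A: "smooth_atlas A" and B: "smooth_atlas B" and F: "smooth_map A B F"
    and \<beta>: "C1_form_at B (F p) \<beta>"
    and W: "openin (mtop A) W" "p \<in> W"
    and \<alpha>: "\<And>q v. q \<in> W \<Longrightarrow> v \<in> tangent_space A q \<Longrightarrow> pullback B F \<beta> q v = \<alpha> q v"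
    and u: "u \<in> tangent_space A p" "tangent_map B F p u = chart_vec B (V, \<psi>) (F p) h"
    and v: "v \<in> tangent_space A p" "tangent_map B F p v = chart_vec B (V, \<psi>) (F p) k"
    and c': "(V, \<psi>) \<in> B" "F p \<in> V"
  shows "ext_d A \<alpha> p u v = frechet_derivative (form_coeff B (V, \<psi>) \<beta> k) (at (\<psi> (F p))) h
    - frechet_derivative (form_coeff B (V, \<psi>) \<beta> h) (at (\<psi> (F p))) k" (is "_ = ?r")
proof -
  obtain Z where Z: "openin (mtop B) Z" "F p \<in> Z"
    "\<And>q. q \<in> V \<inter> Z \<Longrightarrow> linear (\<lambda>h. \<beta> q (chart_vec B (V, \<psi>) q h))"
    using \<beta> c'(1) unfolding C1_form_at_def by blast
  have val: "frechet_derivative (form_coeff A (U, \<phi>) \<alpha> k') (at (\<phi> p)) h'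
       - frechet_derivative (form_coeff A (U, \<phi>) \<alpha> h') (at (\<phi> p)) k' = ?r"
    if c: "(U, \<phi>) \<in> A" "p \<in> U" and hk: "u = chart_vec A (U, \<phi>) p h'" "v = chart_vec A (U, \<phi>) p k'"
    for U \<phi> h' k'
  proof -
    let ?f = "\<psi> \<circ> F \<circ> inv_into U \<phi>"
    let ?S = "\<phi> ` (U \<inter> W) \<inter> \<phi> ` (U \<inter> F -` V)"
    have fy: "?f (\<phi> p) = \<psi> (F p)" using A c by simp
    have f': "frechet_derivative ?f (at (\<phi> p)) h' = h" "frechet_derivative ?f (at (\<phi> p)) k' = k"
      using tangent_map_chart_vec[OF A B F c c'] u(2) v(2) hk chart_vec_inject[OF B c'] by metis+
    have "frechet_derivative (form_coeff A (U, \<phi>) \<alpha> k') (at (\<phi> p)) h'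
       - frechet_derivative (form_coeff A (U, \<phi>) \<alpha> h') (at (\<phi> p)) k'
       = frechet_derivative (form_coeff B (V, \<psi>) \<beta> (frechet_derivative ?f (at (\<phi> p)) k')) (at (?f (\<phi> p)))
           (frechet_derivative ?f (at (\<phi> p)) h')
       - frechet_derivative (form_coeff B (V, \<psi>) \<beta> (frechet_derivative ?f (at (\<phi> p)) h')) (at (?f (\<phi> p)))
           (frechet_derivative ?f (at (\<phi> p)) k')"
    proof (rule exterior_derivative_pullback)
      show "open ?S" "\<phi> p \<in> ?S"
        using openin_chart_image[OF A W(1) c(1)] smooth_mapD(3)[OF A B F c(1) c'(1)] c c' W by auto
      show "open (\<psi> ` (V \<inter> Z))" "?f (\<phi> p) \<in> \<psi> ` (V \<inter> Z)"
        using openin_chart_image[OF B Z(1) c'(1)] fy c' Z by auto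
      show "smooth_on ?S ?f"
        using smooth_on_subset[OF smooth_mapD(4)[OF A B F c(1) c'(1)]] by blast
      show "form_coeff A (U, \<phi>) \<alpha> l z = form_coeff B (V, \<psi>) \<beta> (frechet_derivative ?f (at z) l) (?f z)"
        if "z \<in> ?S" for l z
      proof -
        obtain q where q: "q \<in> U" "q \<in> W" "z = \<phi> q" "F q \<in> V"
          using \<open>z \<in> ?S\<close> smooth_atlas_chart(1)[OF A c(1)] by (auto simp: inj_on_def)
        have "\<alpha> q (chart_vec A (U, \<phi>) q l) = \<beta> (F q) (tangent_map B F q (chart_vec A (U, \<phi>) q l))"
          using \<alpha>[OF q(2) chart_vec_in_tangent_space[OF c(1) q(1)]] by (simp add: pullback_def)
        then show ?thesis
          using q A B c(1) c'(1) tangent_map_chart_vec[OF A B F c(1) q(1) c'(1) q(4)] by simp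
      qed
      show "linear (\<lambda>l. form_coeff B (V, \<psi>) \<beta> l z)" if "z \<in> \<psi> ` (V \<inter> Z)" for z
        using that Z(3) B c' by auto
      show "form_coeff B (V, \<psi>) \<beta> l differentiable (at (?f (\<phi> p)))" for l
        using \<beta> c' fy unfolding C1_form_at_def by auto
    qed
    then show ?thesis using f' fy by simp
  qed
  obtain U \<phi> where c: "(U, \<phi>) \<in> A" "p \<in> U"
    using u(1) tangent_space_points pointsE by metis
  obtain h' k' where hk: "u = chart_vec A (U, \<phi>) p h'" "v = chart_vec A (U, \<phi>) p k'"
    using tangent_spaceE[OF A c] u(1) v(1) by metis
  show ?thesis
    unfolding ext_d_def
  proof (rule the_equality)
    show "\<exists>c\<in>A. \<exists>h k. p \<in> fst c \<and> u = chart_vec A c p h \<and> v = chart_vec A c p k \<and>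
       ?r = frechet_derivative (form_coeff A c \<alpha> k) (at (snd c p)) h
       - frechet_derivative (form_coeff A c \<alpha> h) (at (snd c p)) k"
      by (rule bexI[OF _ c(1)], rule exI[of _ h'], rule exI[of _ k'])
        (use c hk val[OF c hk] in simp)
  qed (use val in force)
qed

lemma pullback_id: "v \<in> tangent_space A q \<Longrightarrow> pullback A id \<alpha> q v = \<alpha> q v"
  by (simp add: pullback_def tangent_map_id)

lemma ext_d_chart:
  assumes A: "smooth_atlas A" and \<alpha>: "C1_form_at A p \<alpha>" and c: "(U, \<phi>) \<in> A" "p \<in> U"
  shows "ext_d A \<alpha> p (chart_vec A (U, \<phi>) p h) (chart_vec A (U, \<phi>) p k) =
      frechet_derivative (form_coeff A (U, \<phi>) \<alpha> k) (at (\<phi> p)) h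
    - frechet_derivative (form_coeff A (U, \<phi>) \<alpha> h) (at (\<phi> p)) k"
  using ext_d_pullback_chart[OF A A smooth_map_id[OF A], of p \<alpha> "points A" \<alpha>
      "chart_vec A (U, \<phi>) p h" U \<phi> h "chart_vec A (U, \<phi>) p k" k]
    chart_vec_in_tangent_space[OF c] openin_points[OF A] points_chart[OF c] \<alpha> c
  by (simp add: tangent_map_id pullback_id)

text \<open>Regularity is asked of \<beta> on the target, while \<alpha> is known through the
  pullback equation. This is why the tautological forms are examined in charts of \<open>Y2\<close>
  rather than of \<open>Y1\<close>.\<close>

lemma ext_d_pullback:
  assumes A: "smooth_atlas A" and B: "smooth_atlas B" and F: "smooth_map A B F"
    and \<beta>: "C1_form_at B (F p) \<beta>" and eq: "form_eq A (pullback B F \<beta>) \<alpha>"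
    and u: "u \<in> tangent_space A p" and v: "v \<in> tangent_space A p"
  shows "ext_d A \<alpha> p u v = ext_d B \<beta> (F p) (tangent_map B F p u) (tangent_map B F p v)"
proof -
  have p: "p \<in> points A" using u by (rule tangent_space_points)
  then obtain V \<psi> where c': "(V, \<psi>) \<in> B" "F p \<in> V"
    using smooth_mapD(1)[OF A B F] by (meson pointsE)
  obtain h k where hk: "tangent_map B F p u = chart_vec B (V, \<psi>) (F p) h"
    "tangent_map B F p v = chart_vec B (V, \<psi>) (F p) k"
    using tangent_spaceE[OF B c'] tangent_map_in_tangent_space[OF A B F] u v by metis
  show ?thesis
    using ext_d_pullback_chart[OF A B F \<beta> openin_points[OF A] p _ u hk(1) v hk(2) c', of \<alpha>] eq
      ext_d_chart[OF B \<beta> c'] hk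
    by (simp add: form_eq_def)
qed

lemma ext_d_antisym:
  assumes A: "smooth_atlas A" and \<alpha>: "C1_form_at A p \<alpha>"
    and u: "u \<in> tangent_space A p" and v: "v \<in> tangent_space A p"
  shows "ext_d A \<alpha> p u v = - ext_d A \<alpha> p v u"
proof -
  obtain U \<phi> where c: "(U, \<phi>) \<in> A" "p \<in> U"
    using u tangent_space_points pointsE by metis
  obtain h k where "u = chart_vec A (U, \<phi>) p h" "v = chart_vec A (U, \<phi>) p k"
    using tangent_spaceE[OF A c] u v by metis
  then show ?thesis using ext_d_chart[OF A \<alpha> c] by simp
qed

text \<open>In the chart formula one term is a derivative evaluated at \<open>h\<close>, hence
  linear; the other is linear because the coefficients depend linearly on \<open>h\<close> in a
  whole neighbourhood.\<close>

lemma ext_d_linear: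
  assumes A: "smooth_atlas A" and \<alpha>: "C1_form_at A p \<alpha>" and c: "(U, \<phi>) \<in> A" "p \<in> U"
  shows "linear (\<lambda>h. ext_d A \<alpha> p (chart_vec A (U, \<phi>) p h) (chart_vec A (U, \<phi>) p k))"
proof -
  let ?a = "form_coeff A (U, \<phi>) \<alpha>"
  obtain W where W: "openin (mtop A) W" "p \<in> W"
    "\<And>q. q \<in> U \<inter> W \<Longrightarrow> linear (\<lambda>h. \<alpha> q (chart_vec A (U, \<phi>) q h))"
    using \<alpha> c(1) unfolding C1_form_at_def by blast
  have a': "(?a h has_derivative frechet_derivative (?a h) (at (\<phi> p))) (at (\<phi> p))" for h
    using \<alpha> c unfolding C1_form_at_def by (auto simp: frechet_derivative_works)
  have lin: "linear (\<lambda>h. ?a h y)" if "y \<in> \<phi> ` (U \<inter> W)" for y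
    using that W(3) A c by auto
  note o = openin_chart_image[OF A W(1) c(1)]
  have y: "\<phi> p \<in> \<phi> ` (U \<inter> W)" using c W by auto
  have add: "frechet_derivative (?a (h + h')) (at (\<phi> p)) k
      = frechet_derivative (?a h) (at (\<phi> p)) k + frechet_derivative (?a h') (at (\<phi> p)) k" for h h'
  proof -
    have "(?a (h + h') has_derivative (\<lambda>k. frechet_derivative (?a h) (at (\<phi> p)) k
        + frechet_derivative (?a h') (at (\<phi> p)) k)) (at (\<phi> p))"
      by (rule has_derivative_transform_within_open[OF has_derivative_add[OF a' a'] o y])
        (use linear_add[OF lin] in auto)
    from frechet_derivative_at[OF this, symmetric] show ?thesis by simp
  qed
  have scale: "frechet_derivative (?a (r *\<^sub>R h)) (at (\<phi> p)) k
      = r * frechet_derivative (?a h) (at (\<phi> p)) k" for r h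
  proof -
    have "(?a (r *\<^sub>R h) has_derivative (\<lambda>k. r * frechet_derivative (?a h) (at (\<phi> p)) k)) (at (\<phi> p))"
      by (rule has_derivative_transform_within_open[OF has_derivative_mult_right[OF a'] o y])
        (use linear_scale[OF lin] in auto)
    from frechet_derivative_at[OF this, symmetric] show ?thesis by simp
  qed
  note l = has_derivative_linear[OF a']
  show ?thesis
    unfolding ext_d_chart[OF A \<alpha> c]
    by (rule linearI) (simp_all add: add scale linear_add[OF l] linear_scale[OF l] algebra_simps)
qed

lemma ext_d_vadd_vscale:
  assumes A: "smooth_atlas A" and \<alpha>: "C1_form_at A p \<alpha>"
    and T: "u \<in> tangent_space A p" "v \<in> tangent_space A p" "w \<in> tangent_space A p"
  shows "ext_d A \<alpha> p (vadd u v) w = ext_d A \<alpha> p u w + ext_d A \<alpha> p v w"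
    and "ext_d A \<alpha> p w (vadd u v) = ext_d A \<alpha> p w u + ext_d A \<alpha> p w v"
    and "ext_d A \<alpha> p (vscale c u) w = c * ext_d A \<alpha> p u w"
    and "ext_d A \<alpha> p w (vscale c u) = c * ext_d A \<alpha> p w u"
proof -
  obtain U \<phi> where ch: "(U, \<phi>) \<in> A" "p \<in> U"
    using T(1) tangent_space_points pointsE by metis
  obtain h k l where hk: "u = chart_vec A (U, \<phi>) p h" "v = chart_vec A (U, \<phi>) p k"
    "w = chart_vec A (U, \<phi>) p l"
    using tangent_spaceE[OF A ch] T by metis
  note lin = ext_d_linear[OF A \<alpha> ch]
  show 1: "ext_d A \<alpha> p (vadd u v) w = ext_d A \<alpha> p u w + ext_d A \<alpha> p v w"
    using linear_add[OF lin] hk by (simp add: chart_vec_add[OF A ch])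
  show 2: "ext_d A \<alpha> p (vscale c u) w = c * ext_d A \<alpha> p u w"
    using linear_scale[OF lin] hk by (simp add: chart_vec_scale[OF A ch])
  note asym = ext_d_antisym[OF A \<alpha> T(3)]
  show "ext_d A \<alpha> p w (vadd u v) = ext_d A \<alpha> p w u + ext_d A \<alpha> p w v"
    using 1 T asym[OF T(1)] asym[OF T(2)] asym[OF vadd_in_tangent_space[OF A T(1,2)]] by simp
  show "ext_d A \<alpha> p w (vscale c u) = c * ext_d A \<alpha> p w u"
    using 2 T asym[OF T(1)] asym[OF vscale_in_tangent_space[OF A T(1)]] by simp
qed

section \<open>Linear algebra of contact forms\<close>

text \<open>Here \<open>t\<close> and \<open>D\<close> stand for \<theta> and
  \<open>d\<theta>\<close> in a chart. Given \<open>z\<close> with \<open>t z = 1\<close>, every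
  vector is a combination of \<open>z\<close>, \<open>x1\<close>, \<open>x2\<close>; hence the
  nondegeneracy of \<open>t \<and> D\<close> forces \<open>D x1 x2 \<noteq> 0\<close>, and
  \<open>z\<close> can be corrected inside the kernel of \<open>t\<close> to the Reeb
  vector.\<close>

lemma contact_form_algebra:
  fixes t :: "'e::real_vector \<Rightarrow> real" and D :: "'e \<Rightarrow> 'e \<Rightarrow> real"
  assumes t: "linear t" and D: "\<And>k. linear (\<lambda>h. D h k)" and alt: "\<And>h k. D h k = - D k h"
    and ker: "\<And>h. t h = 0 \<longleftrightarrow> (\<exists>a b. h = a *\<^sub>R x1 + b *\<^sub>R x2)"
    and nondeg: "t u * D v w + t v * D w u + t w * D u v \<noteq> 0"
  shows "D x1 x2 \<noteq> 0"
    and "\<exists>!r. t r = 1 \<and> (\<forall>k. D r k = 0)"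
    and "t r = 1 \<Longrightarrow> \<forall>k. D r k = 0 \<Longrightarrow>
      h = t h *\<^sub>R r + (D h x2 / D x1 x2) *\<^sub>R x1 + (D x1 h / D x1 x2) *\<^sub>R x2"
proof -
  have diag: "D h h = 0" for h using alt[of h h] by simp
  have swap: "D x2 x1 = - D x1 x2" by (rule alt)
  note lin1 = linear_add[OF D] linear_scale[OF D]
  have lin2: "D h (k + l) = D h k + D h l" "D h (a *\<^sub>R k) = a * D h k" for h k l a
    using alt[of h "k + l"] alt[of h k] alt[of h l] alt[of h "a *\<^sub>R k"]
    by (simp_all add: lin1)
  have t12: "t x1 = 0" "t x2 = 0"
    using ker[of x1] ker[of x2] by (metis add_0_left add_0_right scaleR_one scaleR_zero_left)+
  have "t u \<noteq> 0 \<or> t v \<noteq> 0 \<or> t w \<noteq> 0" using nondeg by force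
  then obtain z0 where "t z0 \<noteq> 0" by blast
  then have "t ((1 / t z0) *\<^sub>R z0) = 1" by (simp add: linear_scale[OF t])
  then obtain z where z: "t z = 1" by blast
  have dec: "\<exists>a b. h = t h *\<^sub>R z + a *\<^sub>R x1 + b *\<^sub>R x2" for h
  proof -
    have "t (h - t h *\<^sub>R z) = 0" by (simp add: linear_diff[OF t] linear_scale[OF t] z)
    then obtain a b where "h - t h *\<^sub>R z = a *\<^sub>R x1 + b *\<^sub>R x2" using ker by blast
    then have "h = t h *\<^sub>R z + a *\<^sub>R x1 + b *\<^sub>R x2" by (simp add: algebra_simps)
    then show ?thesis by blast
  qed
  show ne: "D x1 x2 \<noteq> 0"
  proof
    assume 0: "D x1 x2 = 0"
    obtain a1 b1 a2 b2 a3 b3 where *: "u = t u *\<^sub>R z + a1 *\<^sub>R x1 + b1 *\<^sub>R x2"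
      "v = t v *\<^sub>R z + a2 *\<^sub>R x1 + b2 *\<^sub>R x2" "w = t w *\<^sub>R z + a3 *\<^sub>R x1 + b3 *\<^sub>R x2"
      using dec by metis
    \<comment> \<open>If \<open>D x1 x2\<close> vanishes, only pairings with \<open>z\<close>
      survive and \<open>D\<close> becomes a wedge product with factor \<open>t\<close>, so that
      \<open>t \<and> D\<close> cancels.\<close>
    have e: "D (p *\<^sub>R z + a *\<^sub>R x1 + b *\<^sub>R x2) (q *\<^sub>R z + a' *\<^sub>R x1 + b' *\<^sub>R x2)
      = (p * a' - a * q) * D z x1 + (p * b' - b * q) * D z x2" for p q a b a' b'
      using 0 swap alt[of x1 z] alt[of x2 z] by (simp add: lin1 lin2 diag algebra_simps)
    have vw: "D v w = (t v * a3 - a2 * t w) * D z x1 + (t v * b3 - b2 * t w) * D z x2"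
      and wu: "D w u = (t w * a1 - a3 * t u) * D z x1 + (t w * b1 - b3 * t u) * D z x2"
      and uv: "D u v = (t u * a2 - a1 * t v) * D z x1 + (t u * b2 - b1 * t v) * D z x2"
      using e * by metis+
    have "t u * D v w + t v * D w u + t w * D u v = 0"
      unfolding vw wu uv by (simp add: algebra_simps)
    with nondeg show False by simp
  qed
  show expand: "h = t h *\<^sub>R r + (D h x2 / D x1 x2) *\<^sub>R x1 + (D x1 h / D x1 x2) *\<^sub>R x2"
    if "t r = 1" "\<forall>k. D r k = 0" for h r
  proof -
    have "t (h - t h *\<^sub>R r) = 0" using that by (simp add: linear_diff[OF t] linear_scale[OF t])
    then obtain a b where ab: "h - t h *\<^sub>R r = a *\<^sub>R x1 + b *\<^sub>R x2" using ker by blast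
    then have h: "h = t h *\<^sub>R r + a *\<^sub>R x1 + b *\<^sub>R x2" by (simp add: algebra_simps)
    \<comment> \<open>Pairing the decomposition with \<open>x2\<close> and with \<open>x1\<close>
      isolates one coefficient each, because \<open>D r\<close> vanishes.\<close>
    have "D h x2 = a * D x1 x2" "D x1 h = b * D x1 x2"
      using arg_cong[OF h, of "\<lambda>k. D k x2"] arg_cong[OF h, of "D x1"] that(2) alt[of x1 r]
      by (simp_all add: lin1 lin2 diag)
    then show ?thesis using h ne by simp
  qed
  \<comment> \<open>The first correction removes \<open>D r x2\<close>, the second
    \<open>D r x1\<close>; both lie in the kernel of \<open>t\<close> and so preserve
    \<open>t r = 1\<close>.\<close>
  define r where "r = z - (D z x2 / D x1 x2) *\<^sub>R x1 + (D z x1 / D x1 x2) *\<^sub>R x2"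
  have r: "t r = 1"
    by (simp add: r_def z t12 linear_add[OF t] linear_diff[OF t] linear_scale[OF t])
  have r12: "D r x1 = 0" "D r x2 = 0"
    using ne swap by (simp_all add: r_def lin1 linear_diff[OF D] diag)
  have r0: "D r k = 0" for k
  proof -
    have "t (k - t k *\<^sub>R r) = 0" using r by (simp add: linear_diff[OF t] linear_scale[OF t])
    then obtain a b where "k - t k *\<^sub>R r = a *\<^sub>R x1 + b *\<^sub>R x2" using ker by blast
    then have "k = t k *\<^sub>R r + a *\<^sub>R x1 + b *\<^sub>R x2" by (simp add: algebra_simps)
    from arg_cong[OF this, of "D r"] show ?thesis using r12 by (simp add: lin2 diag)
  qed
  show "\<exists>!r. t r = 1 \<and> (\<forall>k. D r k = 0)"
  proof (rule ex1I)
    fix r' assume r': "t r' = 1 \<and> (\<forall>k. D r' k = 0)"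
    \<comment> \<open>Expanding \<open>r'\<close> along \<open>r\<close>, \<open>x1\<close>,
      \<open>x2\<close> leaves \<open>r\<close> alone, since \<open>D r'\<close> vanishes on
      \<open>x1\<close> and \<open>x2\<close>.\<close>
    then show "r' = r"
      using expand[OF r, of r'] r0 alt[of x1 r'] by simp
  qed (use r r0 in blast)
qed

section \<open>Strict path structures\<close>

locale strict_path =
  fixes A :: "('a, real^3) chart set"
    and E1 E2 :: "'a \<Rightarrow> 'a tvec set"
    and \<theta> :: "'a \<Rightarrow> 'a covec"
  assumes atlas: "smooth_atlas A"
    and strict: "strict_path_structure A E1 E2 \<theta>"
begin

abbreviation d\<theta> :: "'a \<Rightarrow> 'a tvec \<Rightarrow> 'a tvec \<Rightarrow> real" where
  "d\<theta> \<equiv> ext_d A \<theta>"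

text \<open>The value \<open>d\<theta> x X1 X2\<close> is not normalised to 1: bundle charts use
  arbitrary local sections, so it is carried along as a parameter.\<close>

definition adapted_frame :: "'a \<Rightarrow> 'a tvec \<Rightarrow> 'a tvec \<Rightarrow> bool" where
  "adapted_frame x X1 X2 \<longleftrightarrow>
     x \<in> points A \<and> X1 \<in> E1 x \<and> X1 \<noteq> vzero \<and> X2 \<in> E2 x \<and> X2 \<noteq> vzero"

section \<open>Line fields, adapted frames and the Reeb vector\<close>

lemma one_form_theta: "one_form A \<theta>"
  using strict by (simp add: strict_path_structure_def contact_form_on_def)

lemma theta_cotangent: "x \<in> points A \<Longrightarrow> \<theta> x \<in> cotangent_space A x"
  using one_form_theta by (simp add: one_form_on_def)

lemma C1_theta: "x \<in> points A \<Longrightarrow> C1_form_at A x \<theta>"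
  using one_form_on_C1[OF atlas openin_points[OF atlas] _ one_form_theta] .

lemma kernel_theta: "x \<in> points A \<Longrightarrow> form_kernel A \<theta> x = plane_sum E1 E2 x"
  using strict by (simp add: strict_path_structure_def)

lemma line_subbundles: "line_subbundle A E1" "line_subbundle A E2"
  using strict by (auto simp: strict_path_structure_def path_structure_def)

lemma line_subbundleE:
  assumes "line_subbundle A E" "x \<in> points A"
  obtains W Y where "openin (mtop A) W" "x \<in> W" "vector_field_on A W Y"
    "\<And>q. q \<in> W \<Longrightarrow> Y q \<noteq> vzero" "\<And>q. q \<in> W \<Longrightarrow> E q = {vscale c (Y q) | c. True}"
proof -
  have "\<exists>W X. openin (mtop A) W \<and> x \<in> W \<and> vector_field_on A W X \<and>
     (\<forall>q\<in>W. X q \<noteq> vzero \<and> E q = {vscale c (X q) | c. True})"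
    using assms by (simp add: line_subbundle_def)
  then show thesis
    by (elim exE conjE) (rule that, auto)
qed

lemma line_subbundle_fibre:
  assumes E: "line_subbundle A E" and x: "x \<in> points A" and X: "X \<in> E x" "X \<noteq> vzero"
  shows "X \<in> tangent_space A x" and "E x = {vscale c X | c. True}"
proof -
  obtain W Y where W: "x \<in> W" "vector_field_on A W Y" "E x = {vscale c (Y x) | c. True}"
    using line_subbundleE[OF E x] by metis
  obtain U \<phi> where c: "(U, \<phi>) \<in> A" "x \<in> U" using x by (rule pointsE)
  have "\<exists>h. Y x = chart_vec A (U, \<phi>) x h"
    using W c unfolding vector_field_on_def by blast
  then have Y: "Y x \<in> tangent_space A x" using chart_vec_in_tangent_space[OF c] by metis
  obtain r where r: "X = vscale r (Y x)" using W(3) X by blast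
  show "X \<in> tangent_space A x" using vscale_in_tangent_space[OF atlas Y] r by simp
  have "r \<noteq> 0" using r X(2) by (auto simp: vscale_def vzero_def)
  then have "vscale k (Y x) = vscale (k / r) X" for k
    using r by (auto simp: vscale_def)
  then have "\<exists>c. u = vscale c X" if "\<exists>c. u = vscale c (Y x)" for u
    using that by metis
  moreover have "\<exists>c. u = vscale c (Y x)" if "\<exists>c. u = vscale c X" for u
    using that r by (auto simp: vscale_def simp flip: mult.assoc)
  ultimately show "E x = {vscale c X | c. True}" unfolding W(3) by auto
qed

lemma adapted_frame_tangent:
  assumes "adapted_frame x X1 X2"
  shows "X1 \<in> tangent_space A x" "X2 \<in> tangent_space A x"
  using assms line_subbundle_fibre(1)[OF line_subbundles(1)] line_subbundle_fibre(1)[OF line_subbundles(2)]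
  by (simp_all add: adapted_frame_def)

lemma adapted_frame_lines:
  assumes "adapted_frame x X1 X2"
  shows "E1 x = {vscale c X1 | c. True}" "E2 x = {vscale c X2 | c. True}"
  using assms line_subbundle_fibre(2)[OF line_subbundles(1)] line_subbundle_fibre(2)[OF line_subbundles(2)]
  by (simp_all add: adapted_frame_def)

lemma adapted_frame_exists:
  assumes "x \<in> points A"
  obtains X1 X2 where "adapted_frame x X1 X2"
proof -
  have "\<exists>X. X \<in> E x \<and> X \<noteq> vzero" if "line_subbundle A E" for E
  proof -
    obtain W Y where "x \<in> W" "Y x \<noteq> vzero" "E x = {vscale c (Y x) | c. True}"
      using line_subbundleE[OF \<open>line_subbundle A E\<close> assms] by metis
    moreover have "Y x = vscale 1 (Y x)" by (simp add: vscale_def)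
    ultimately show ?thesis by blast
  qed
  then show ?thesis using that assms line_subbundles unfolding adapted_frame_def by blast
qed

text \<open>The algebra of \<open>contact_form_algebra\<close>, transported to the tangent space by
  \<open>chart_vec\<close>: the contact condition supplies the nondegeneracy,
  \<open>kernel_theta\<close> the description of the kernel.\<close>

lemma
  assumes fr: "adapted_frame x X1 X2"
  shows dtheta_frame: "d\<theta> x X1 X2 \<noteq> 0"
    and reeb_tangent: "reeb A \<theta> x \<in> tangent_space A x"
    and reeb_theta: "\<theta> x (reeb A \<theta> x) = 1"
    and reeb_dtheta: "v \<in> tangent_space A x \<Longrightarrow> d\<theta> x (reeb A \<theta> x) v = 0"
    and frame_expansion: "v \<in> tangent_space A x \<Longrightarrow>
      v = vadd (vadd (vscale (\<theta> x v) (reeb A \<theta> x)) (vscale (d\<theta> x v X2 / d\<theta> x X1 X2) X1))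
            (vscale (d\<theta> x X1 v / d\<theta> x X1 X2) X2)"
proof -
  have x: "x \<in> points A" using fr by (simp add: adapted_frame_def)
  then obtain U \<phi> where c: "(U, \<phi>) \<in> A" "x \<in> U" by (rule pointsE)
  let ?V = "chart_vec A (U, \<phi>) x"
  define t where "t h = \<theta> x (?V h)" for h
  define D where "D h k = d\<theta> x (?V h) (?V k)" for h k
  note T = chart_vec_in_tangent_space[OF c]
  note V = chart_vec_add[OF atlas c] chart_vec_scale[OF atlas c]
  obtain x1 x2 where x12: "X1 = ?V x1" "X2 = ?V x2"
    using tangent_spaceE[OF atlas c] adapted_frame_tangent[OF fr] by metis
  have t: "linear t"
    unfolding t_def by (rule cotangent_linear[OF atlas c theta_cotangent[OF x]])
  have D: "linear (\<lambda>h. D h k)" for k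
    unfolding D_def by (rule ext_d_linear[OF atlas C1_theta[OF x] c])
  have alt: "D h k = - D k h" for h k
    unfolding D_def by (rule ext_d_antisym[OF atlas C1_theta[OF x] T T])
  have ker: "t h = 0 \<longleftrightarrow> (\<exists>a b. h = a *\<^sub>R x1 + b *\<^sub>R x2)" for h
  proof -
    have "t h = 0 \<longleftrightarrow> ?V h \<in> form_kernel A \<theta> x"
      by (simp add: form_kernel_def T t_def)
    also have "\<dots> \<longleftrightarrow> (\<exists>a b. ?V h = vadd (vscale a X1) (vscale b X2))"
      unfolding kernel_theta[OF x] plane_sum_def adapted_frame_lines[OF fr] by blast
    also have "\<dots> \<longleftrightarrow> (\<exists>a b. h = a *\<^sub>R x1 + b *\<^sub>R x2)"
      by (simp add: x12 flip: V chart_vec_inject[OF atlas c])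
    finally show ?thesis .
  qed
  obtain u' v' w' where "t u' * D v' w' + t v' * D w' u' + t w' * D u' v' \<noteq> 0"
  proof -
    obtain u v w where T3: "u \<in> tangent_space A x" "v \<in> tangent_space A x" "w \<in> tangent_space A x"
      and nd: "\<theta> x u * d\<theta> x v w + \<theta> x v * d\<theta> x w u + \<theta> x w * d\<theta> x u v \<noteq> 0"
      using strict x unfolding strict_path_structure_def contact_form_on_def by blast
    obtain h k l where "u = ?V h" "v = ?V k" "w = ?V l"
      using tangent_spaceE[OF atlas c] T3 by metis
    with nd show ?thesis using that unfolding t_def D_def by blast
  qed
  note alg = contact_form_algebra[OF t D alt ker this]
  show d: "d\<theta> x X1 X2 \<noteq> 0" using alg(1) by (simp add: D_def x12)
  obtain r where r: "t r = 1" "\<forall>k. D r k = 0" and uniq: "\<And>r'. t r' = 1 \<and> (\<forall>k. D r' k = 0) \<Longrightarrow> r' = r"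
    using alg(2) by blast
  have reeb: "reeb A \<theta> x = ?V r"
    unfolding reeb_def
  proof (rule the_equality)
    have "d\<theta> x (?V r) v = 0" if "v \<in> tangent_space A x" for v
      using tangent_spaceE[OF atlas c that] r(2) unfolding D_def by metis
    then show "?V r \<in> tangent_space A x \<and> \<theta> x (?V r) = 1 \<and> (\<forall>v\<in>tangent_space A x. d\<theta> x (?V r) v = 0)"
      using r(1) T by (simp add: t_def)
  next
    fix R assume R: "R \<in> tangent_space A x \<and> \<theta> x R = 1 \<and> (\<forall>v\<in>tangent_space A x. d\<theta> x R v = 0)"
    then obtain r' where "R = ?V r'" using tangent_spaceE[OF atlas c] by metis
    with R show "R = ?V r" using uniq[of r'] T unfolding t_def D_def by auto
  qed
  show "reeb A \<theta> x \<in> tangent_space A x" "\<theta> x (reeb A \<theta> x) = 1"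
    using reeb T r(1) by (simp_all add: t_def)
  show "d\<theta> x (reeb A \<theta> x) v = 0" if "v \<in> tangent_space A x"
    using tangent_spaceE[OF atlas c that] r(2) unfolding D_def reeb by metis
  show "v = vadd (vadd (vscale (\<theta> x v) (reeb A \<theta> x)) (vscale (d\<theta> x v X2 / d\<theta> x X1 X2) X1))
            (vscale (d\<theta> x X1 v / d\<theta> x X1 X2) X2)" if v: "v \<in> tangent_space A x"
  proof -
    obtain h where h: "v = ?V h" using tangent_spaceE[OF atlas c v] .
    have "?V h = ?V (t h *\<^sub>R r + (D h x2 / D x1 x2) *\<^sub>R x1 + (D x1 h / D x1 x2) *\<^sub>R x2)"
      using alg(3)[OF r, of h] by simp
    then show ?thesis unfolding V reeb h x12 t_def D_def .
  qed
qed

text \<open>\<open>z1\<close> and \<open>z2\<close> complete \<theta> to the coframe dual to the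
  Reeb vector, \<open>X1\<close>, \<open>X2\<close>. They vanish on the Reeb vector because its
  contraction with \<open>d\<theta>\<close> does, and as quotients of values of
  \<open>d\<theta>\<close> they vary smoothly with smooth sections.\<close>

definition z1 :: "'a \<Rightarrow> 'a tvec \<Rightarrow> 'a tvec \<Rightarrow> 'a covec" where
  "z1 x X1 X2 v = (if v \<in> tangent_space A x then d\<theta> x v X2 / d\<theta> x X1 X2 else 0)"

definition z2 :: "'a \<Rightarrow> 'a tvec \<Rightarrow> 'a tvec \<Rightarrow> 'a covec" where
  "z2 x X1 X2 v = (if v \<in> tangent_space A x then d\<theta> x X1 v / d\<theta> x X1 X2 else 0)"

section \<open>Covectors in an adapted frame\<close>

lemma cotangent_scale: "\<alpha> \<in> cotangent_space A x \<Longrightarrow> (\<lambda>v. c * \<alpha> v) \<in> cotangent_space A x"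
  by (auto simp: cotangent_space_def distrib_left)

lemma cotangentD:
  assumes "\<alpha> \<in> cotangent_space A x"
  shows "u \<in> tangent_space A x \<Longrightarrow> v \<in> tangent_space A x \<Longrightarrow> \<alpha> (vadd u v) = \<alpha> u + \<alpha> v"
    and "u \<in> tangent_space A x \<Longrightarrow> \<alpha> (vscale c u) = c * \<alpha> u"
    and "u \<notin> tangent_space A x \<Longrightarrow> \<alpha> u = 0"
  using assms by (auto simp: cotangent_space_def)

lemma dual_frame_cotangent:
  assumes "adapted_frame x X1 X2"
  shows "z1 x X1 X2 \<in> cotangent_space A x" "z2 x X1 X2 \<in> cotangent_space A x"
  using ext_d_vadd_vscale[OF atlas C1_theta] adapted_frame_tangent[OF assms] assms
  by (auto simp: cotangent_space_def z1_def z2_def adapted_frame_def add_divide_distrib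
      vadd_in_tangent_space[OF atlas] vscale_in_tangent_space[OF atlas])

lemma dtheta_diag: "v \<in> tangent_space A x \<Longrightarrow> d\<theta> x v v = 0"
  using ext_d_antisym[OF atlas C1_theta[OF tangent_space_points], of v x v v] by simp

lemma dual_frame_values:
  assumes fr: "adapted_frame x X1 X2"
  shows "z1 x X1 X2 X1 = 1" "z1 x X1 X2 X2 = 0" "z1 x X1 X2 (reeb A \<theta> x) = 0"
    and "z2 x X1 X2 X1 = 0" "z2 x X1 X2 X2 = 1" "z2 x X1 X2 (reeb A \<theta> x) = 0"
    and "\<theta> x X1 = 0" "\<theta> x X2 = 0"
proof -
  have x: "x \<in> points A" using fr by (simp add: adapted_frame_def)
  note T = adapted_frame_tangent[OF fr] and d = dtheta_frame[OF fr]
  note R = reeb_tangent[OF fr] reeb_dtheta[OF fr]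
  show "z1 x X1 X2 X1 = 1" "z1 x X1 X2 X2 = 0" "z1 x X1 X2 (reeb A \<theta> x) = 0"
    "z2 x X1 X2 X1 = 0" "z2 x X1 X2 X2 = 1"
    using T d R dtheta_diag by (simp_all add: z1_def z2_def)
  show "z2 x X1 X2 (reeb A \<theta> x) = 0"
    using R T ext_d_antisym[OF atlas C1_theta[OF x] T(1) R(1)] by (simp add: z2_def)
  have "vadd X1 (vscale 0 X2) = X1" "vadd (vscale 0 X1) X2 = X2"
    by (simp_all add: vadd_def vscale_def)
  moreover have "vscale 0 X2 \<in> E2 x" "vscale 0 X1 \<in> E1 x"
    unfolding adapted_frame_lines[OF fr] by blast+
  ultimately have "X1 \<in> plane_sum E1 E2 x" "X2 \<in> plane_sum E1 E2 x"
    using fr unfolding plane_sum_def adapted_frame_def mem_Collect_eq by metis+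
  then show "\<theta> x X1 = 0" "\<theta> x X2 = 0"
    using kernel_theta[OF x] unfolding form_kernel_def by blast+
qed

text \<open>Apply \<alpha> to \<open>frame_expansion\<close>. Off the tangent space all covectors
  involved are 0, so the identity holds for every HOL argument.\<close>

lemma covector_expansion:
  assumes fr: "adapted_frame x X1 X2" and \<alpha>: "\<alpha> \<in> cotangent_space A x"
  shows "\<alpha> v = \<alpha> (reeb A \<theta> x) * \<theta> x v + \<alpha> X1 * z1 x X1 X2 v + \<alpha> X2 * z2 x X1 X2 v"
proof (cases "v \<in> tangent_space A x")
  case True
  note T = adapted_frame_tangent[OF fr] reeb_tangent[OF fr]
  show ?thesis
    by (subst frame_expansion[OF fr True])
      (simp add: cotangentD[OF \<alpha>] T True z1_def z2_def vadd_in_tangent_space[OF atlas]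
        vscale_in_tangent_space[OF atlas] mult.commute)
next
  case False
  then show ?thesis
    using cotangentD(3)[OF \<alpha>] cotangentD(3)[OF theta_cotangent] fr
    by (simp add: z1_def z2_def adapted_frame_def)
qed

text \<open>For fixed \<open>v\<close> the covector sending \<open>w\<close> to
  \<open>d\<theta> x w v\<close> kills the Reeb vector; expand it in the dual coframe.\<close>

lemma wedge_dual_frame:
  assumes fr: "adapted_frame x X1 X2" and T: "u \<in> tangent_space A x" "v \<in> tangent_space A x"
  shows "wedge (z1 x X1 X2) (z2 x X1 X2) u v = d\<theta> x u v / d\<theta> x X1 X2"
proof -
  have x: "x \<in> points A" using fr by (simp add: adapted_frame_def)
  note F = adapted_frame_tangent[OF fr] reeb_tangent[OF fr]
  have "(\<lambda>w. if w \<in> tangent_space A x then d\<theta> x w v else 0) \<in> cotangent_space A x"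
    using ext_d_vadd_vscale[OF atlas C1_theta[OF x]] T
    by (auto simp: cotangent_space_def vadd_in_tangent_space[OF atlas] vscale_in_tangent_space[OF atlas])
  from covector_expansion[OF fr this, of u]
  have "d\<theta> x u v = d\<theta> x X1 v * z1 x X1 X2 u + d\<theta> x X2 v * z2 x X1 X2 u"
    using T F reeb_dtheta[OF fr] by simp
  moreover have "d\<theta> x X1 v = z2 x X1 X2 v * d\<theta> x X1 X2" "d\<theta> x X2 v = - (z1 x X1 X2 v * d\<theta> x X1 X2)"
    using dtheta_frame[OF fr] T ext_d_antisym[OF atlas C1_theta[OF x] F(2) T(2)]
    unfolding z1_def z2_def by simp_all
  ultimately show ?thesis
    using dtheta_frame[OF fr] by (simp add: wedge_def field_simps)
qed

text \<open>A form with the same kernel is proportional to \<open>\<theta>\<close>; differentiating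
  \<open>\<eta>(h) \<theta>(r) = \<theta>(h) \<eta>(r)\<close> at a point where \<open>h\<close> is in the kernel avoids dividing by \<open>\<theta>(r)\<close>.\<close>

lemma ext_d_same_kernel:
  assumes W: "openin (mtop A) W" "x \<in> W" and \<eta>: "one_form_on A W \<eta>"
    and ker: "\<And>q. q \<in> W \<Longrightarrow> form_kernel A \<eta> q = form_kernel A \<theta> q"
    and fr: "adapted_frame x X1 X2"
    and u: "u \<in> form_kernel A \<theta> x" and v: "v \<in> form_kernel A \<theta> x"
  shows "ext_d A \<eta> x u v = \<eta> x (reeb A \<theta> x) * d\<theta> x u v"
proof -
  have x: "x \<in> points A" using fr by (simp add: adapted_frame_def)
  then obtain U \<phi> where c: "(U, \<phi>) \<in> A" "x \<in> U" by (rule pointsE)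
  let ?V = "\<lambda>q. chart_vec A (U, \<phi>) q"
  obtain r where r: "reeb A \<theta> x = ?V x r"
    using tangent_spaceE[OF atlas c reeb_tangent[OF fr]] .
  let ?t = "form_coeff A (U, \<phi>) \<theta>" and ?e = "form_coeff A (U, \<phi>) \<eta>"
  let ?S = "\<phi> ` (U \<inter> W)"
  have oS: "open ?S" and y: "\<phi> x \<in> ?S"
    using openin_chart_image[OF atlas W(1) c(1)] c W by auto
  have C1e: "C1_form_at A x \<eta>" using one_form_on_C1[OF atlas W \<eta>] .
  have te: "?e h z * ?t r z = ?t h z * ?e r z" if "z \<in> ?S" for h z
  proof -
    obtain q where q: "q \<in> U" "q \<in> W" "z = \<phi> q" using \<open>z \<in> ?S\<close> by auto
    have le: "linear (\<lambda>h. \<eta> q (?V q h))" and lt: "linear (\<lambda>h. \<theta> q (?V q h))"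
      using cotangent_linear[OF atlas c(1) q(1)] \<eta> theta_cotangent[OF points_chart[OF c(1) q(1)]] q(2)
      by (auto simp: one_form_on_def)
    have k: "\<theta> q (?V q h) = 0 \<longleftrightarrow> \<eta> q (?V q h) = 0" for h
      using ker[OF q(2)] chart_vec_in_tangent_space[OF c(1) q(1)] unfolding form_kernel_def by blast
    \<comment> \<open>The vector \<theta>(r) h - \<theta>(h) r lies in the kernel of \<theta>, hence
      in that of \<eta>.\<close>
    have "\<eta> q (?V q h) * \<theta> q (?V q r) = \<theta> q (?V q h) * \<eta> q (?V q r)"
      using k[of "\<theta> q (?V q r) *\<^sub>R h - \<theta> q (?V q h) *\<^sub>R r"]
        linear_diff[OF le] linear_diff[OF lt] linear_scale[OF le] linear_scale[OF lt]
      by (simp add: mult.commute)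
    then show ?thesis using q atlas c(1) by simp
  qed
  have der: "(?t h has_derivative frechet_derivative (?t h) (at (\<phi> x))) (at (\<phi> x))"
    "(?e h has_derivative frechet_derivative (?e h) (at (\<phi> x))) (at (\<phi> x))" for h
    using C1_theta[OF x] C1e c unfolding C1_form_at_def by (auto simp: frechet_derivative_works)
  have *: "frechet_derivative (?e h) (at (\<phi> x)) k = \<eta> x (reeb A \<theta> x) * frechet_derivative (?t h) (at (\<phi> x)) k"
    if h: "\<theta> x (?V x h) = 0" for h k
  proof -
    have "\<eta> x (?V x h) = 0"
      using h ker[OF W(2)] chart_vec_in_tangent_space[OF c] unfolding form_kernel_def by blast
    moreover have "\<theta> x (?V x r) = 1" using reeb_theta[OF fr] r by simp
    moreover have "((\<lambda>z. ?t h z * ?e r z) has_derivative (\<lambda>k. ?e h (\<phi> x) * frechet_derivative (?t r) (at (\<phi> x)) k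
        + frechet_derivative (?e h) (at (\<phi> x)) k * ?t r (\<phi> x))) (at (\<phi> x))"
      by (rule has_derivative_transform_within_open[OF has_derivative_mult[OF der(2) der(1)] oS y]) (rule te)
    \<comment> \<open>At \<open>x\<close> both forms vanish on \<open>h\<close> and \<theta>(r) = 1,
      so one term survives on each side of the differentiated identity.\<close>
    from has_derivative_unique[OF this has_derivative_mult[OF der(1) der(2)]]
    have "?e h (\<phi> x) * frechet_derivative (?t r) (at (\<phi> x)) k
        + frechet_derivative (?e h) (at (\<phi> x)) k * ?t r (\<phi> x)
      = ?t h (\<phi> x) * frechet_derivative (?e r) (at (\<phi> x)) k
        + frechet_derivative (?t h) (at (\<phi> x)) k * ?e r (\<phi> x)" by metis
    ultimately show ?thesis using h atlas c r by simp
  qed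
  obtain h k where hk: "u = ?V x h" "v = ?V x k"
    using tangent_spaceE[OF atlas c] u v unfolding form_kernel_def mem_Collect_eq by metis
  then have "\<theta> x (?V x h) = 0" "\<theta> x (?V x k) = 0"
    using u v by (auto simp: form_kernel_def)
  then show ?thesis
    unfolding hk ext_d_chart[OF atlas C1e c] ext_d_chart[OF atlas C1_theta[OF x] c]
    by (simp add: * algebra_simps)
qed

section \<open>The fibres of both bundles in fibre coordinates\<close>

text \<open>The coframe whose values on the adapted frame are \<open>\<omega>\<^sup>1(X\<^sub>1) = a\<^sup>1\<close>, \<open>\<omega>\<^sup>2(X\<^sub>2) = a\<^sup>2\<close> and whose
  \<open>\<omega>\<close> is normalised by \<open>d\<omega>(X\<^sub>1, X\<^sub>2) = a\<^sup>1 a\<^sup>2\<close>.\<close>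

definition coframe :: "'a \<Rightarrow> 'a tvec \<Rightarrow> 'a tvec \<Rightarrow> real \<Rightarrow> real \<Rightarrow> 'a coframe" where
  "coframe x X1 X2 a1 a2 =
     ((\<lambda>v. a1 * a2 / d\<theta> x X1 X2 * \<theta> x v), (\<lambda>v. a1 * z1 x X1 X2 v), (\<lambda>v. a2 * z2 x X1 X2 v))"

lemma covector_on_E1:
  assumes "adapted_frame x X1 X2" "\<alpha> \<in> cotangent_space A x"
    and "\<alpha> (reeb A \<theta> x) = 0" "\<alpha> X1 = a" "\<alpha> X2 = 0"
  shows "\<alpha> = (\<lambda>v. a * z1 x X1 X2 v)"
proof
  fix v show "\<alpha> v = a * z1 x X1 X2 v"
    using covector_expansion[OF assms(1,2), of v] unfolding assms(3-5) by simp
qed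

lemma covector_on_E2:
  assumes "adapted_frame x X1 X2" "\<alpha> \<in> cotangent_space A x"
    and "\<alpha> (reeb A \<theta> x) = 0" "\<alpha> X1 = 0" "\<alpha> X2 = a"
  shows "\<alpha> = (\<lambda>v. a * z2 x X1 X2 v)"
proof
  fix v show "\<alpha> v = a * z2 x X1 X2 v"
    using covector_expansion[OF assms(1,2), of v] unfolding assms(3-5) by simp
qed

lemma covector_on_reeb:
  assumes "adapted_frame x X1 X2" "\<alpha> \<in> cotangent_space A x"
    and "\<alpha> (reeb A \<theta> x) = a" "\<alpha> X1 = 0" "\<alpha> X2 = 0"
  shows "\<alpha> = (\<lambda>v. a * \<theta> x v)"
proof
  fix v show "\<alpha> v = a * \<theta> x v"
    using covector_expansion[OF assms(1,2), of v] unfolding assms(3-5) by simp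
qed

text \<open>The parameter is \<open>s = \<omega>1(X1)\<close>. A normalised frame
  \<open>c1 X1\<close>, \<open>c2 X2\<close> has \<open>c1 * c2 * d\<theta> x X1 X2 = 1\<close>, and
  the opposite weights \<open>a^3\<close>, \<open>a^(-3)\<close> make the product of the two
  coordinates \<open>d\<theta> x X1 X2\<close> for every \<open>a\<close>. Conversely the frame can
  be held fixed, since every nonzero real is a cube.\<close>

lemma Y1_fibre_eq:
  assumes fr: "adapted_frame x X1 X2"
  shows "Y1_fibre A E1 E2 \<theta> x = {coframe x X1 X2 s (d\<theta> x X1 X2 / s) | s. s \<noteq> 0}"
proof (intro equalityI subsetI)
  note d = dtheta_frame[OF fr] and F = adapted_frame_tangent[OF fr] reeb_tangent[OF fr]
  have x: "x \<in> points A" using fr by (simp add: adapted_frame_def)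
  note ext = ext_d_vadd_vscale[OF atlas C1_theta[OF x]]
  {
    fix \<Omega> assume "\<Omega> \<in> Y1_fibre A E1 E2 \<theta> x"
    then obtain a \<theta>1 \<theta>2 Y1 Y2 where a: "a \<noteq> 0" and Y: "Y1 \<in> E1 x" "Y2 \<in> E2 x" "d\<theta> x Y1 Y2 = 1"
      and dual: "dual_coframe A x (reeb A \<theta> x, Y1, Y2) (\<theta> x, \<theta>1, \<theta>2)"
      and \<Omega>: "\<Omega> = (\<theta> x, (\<lambda>v. a powi 3 * \<theta>1 v), (\<lambda>v. a powi (-3) * \<theta>2 v))"
      unfolding Y1_fibre_def by auto
    obtain c1 c2 where c: "Y1 = vscale c1 X1" "Y2 = vscale c2 X2"
      using Y adapted_frame_lines[OF fr] by auto
    have cd: "c1 * c2 * d\<theta> x X1 X2 = 1"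
      using Y(3) F by (simp add: c ext vscale_in_tangent_space[OF atlas] mult.assoc mult.left_commute)
    then have ne: "c1 \<noteq> 0" "c2 \<noteq> 0" by auto
    have cot: "\<theta>1 \<in> cotangent_space A x" "\<theta>2 \<in> cotangent_space A x" using dual by auto
    have "c1 * \<theta>1 X1 = 1" "c2 * \<theta>1 X2 = 0" "c1 * \<theta>2 X1 = 0" "c2 * \<theta>2 X2 = 1"
      using dual F by (simp_all add: c cotangentD[OF cot(1)] cotangentD[OF cot(2)])
    then have v: "\<theta>1 X1 = 1 / c1" "\<theta>1 X2 = 0" "\<theta>2 X1 = 0" "\<theta>2 X2 = 1 / c2"
      using ne by (simp_all add: field_simps)
    have \<theta>12: "\<theta>1 = (\<lambda>v. 1 / c1 * z1 x X1 X2 v)" "\<theta>2 = (\<lambda>v. 1 / c2 * z2 x X1 X2 v)"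
      using covector_on_E1[OF fr cot(1), OF _ v(1,2)] covector_on_E2[OF fr cot(2), OF _ v(3,4)] dual
      by (simp_all only: dual_coframe.simps)
    have p3: "a powi 3 = a ^ 3" "a powi (-3) = inverse (a ^ 3)"
      by (simp_all add: power_int_minus)
    define s where "s = a ^ 3 / c1"
    have s: "s \<noteq> 0" using a ne by (simp add: s_def)
    have "d\<theta> x X1 X2 = 1 / (c1 * c2)" using cd ne by (simp add: field_simps)
    then have ds: "d\<theta> x X1 X2 / s = inverse (a ^ 3) * (1 / c2)" using ne a by (simp add: s_def field_simps)
    have one: "s * (d\<theta> x X1 X2 / s) / d\<theta> x X1 X2 = 1" using s d by simp
    then have "\<Omega> = coframe x X1 X2 s (d\<theta> x X1 X2 / s)"
      unfolding \<Omega> coframe_def \<theta>12 p3 one unfolding ds unfolding s_def by (simp add: mult.assoc)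
    with s show "\<Omega> \<in> {coframe x X1 X2 s (d\<theta> x X1 X2 / s) | s. s \<noteq> 0}" by blast
  }
  fix \<Omega> assume "\<Omega> \<in> {coframe x X1 X2 s (d\<theta> x X1 X2 / s) | s. s \<noteq> 0}"
  then obtain s where s: "s \<noteq> 0" and \<Omega>: "\<Omega> = coframe x X1 X2 s (d\<theta> x X1 X2 / s)" by blast
  \<comment> \<open>The real cube root, which exists for negative \<open>s\<close> too.\<close>
  define a where "a = root 3 s"
  have a3: "a ^ 3 = s" unfolding a_def by (rule odd_real_root_pow) simp
  then have a: "a \<noteq> 0" using s by auto
  let ?d = "d\<theta> x X1 X2"
  have one: "s * (?d / s) / ?d = 1" using s d by simp
  \<comment> \<open>Dividing \<open>X2\<close> by \<open>d\<theta> x X1 X2\<close> normalises the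
    frame and multiplies the dual covector by the same number.\<close>
  have "dual_coframe A x (reeb A \<theta> x, X1, vscale (1 / ?d) X2)
      (\<theta> x, z1 x X1 X2, (\<lambda>v. ?d * z2 x X1 X2 v))"
    using d F dual_frame_values[OF fr] dual_frame_cotangent[OF fr] theta_cotangent[OF x] reeb_theta[OF fr]
    by (simp add: cotangent_scale cotangentD[OF theta_cotangent[OF x]]
        cotangentD[OF dual_frame_cotangent(1)[OF fr]] cotangentD[OF dual_frame_cotangent(2)[OF fr]])
  moreover have "d\<theta> x X1 (vscale (1 / ?d) X2) = 1" using d F by (simp add: ext)
  moreover have "X1 \<in> E1 x" "vscale (1 / ?d) X2 \<in> E2 x"
    using fr adapted_frame_lines[OF fr] by (auto simp: adapted_frame_def)
  moreover have "\<Omega> = (\<theta> x, (\<lambda>v. a powi 3 * z1 x X1 X2 v), (\<lambda>v. a powi (-3) * (?d * z2 x X1 X2 v)))"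
    unfolding \<Omega> coframe_def one by (simp add: power_int_minus a3 divide_inverse ac_simps)
  ultimately show "\<Omega> \<in> Y1_fibre A E1 E2 \<theta> x"
    using a unfolding Y1_fibre_def
    by (intro CollectI exI[of _ a] exI[of _ "z1 x X1 X2"] exI[of _ "\<lambda>v. ?d * z2 x X1 X2 v"] conjI
        bexI[of _ X1] bexI[of _ "vscale (1 / ?d) X2"])
qed

text \<open>The coordinates \<open>a1\<close>, \<open>a2\<close> are free and of any sign, and the
  normalisation then fixes \<omega> on the Reeb vector \<open>R\<close>: by
  \<open>ext_d_same_kernel\<close> the value of \<open>d\<eta>\<close> on the plane depends on
  \<eta> at \<open>x\<close> alone, so
  \<open>\<omega>(R) * d\<theta> x X1 X2 = a1 * a2\<close>.\<close>

lemma Y2_fibre_eq: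
  assumes fr: "adapted_frame x X1 X2"
  shows "Y2_fibre A E1 E2 (reeb_line A \<theta>) x = {coframe x X1 X2 a1 a2 | a1 a2. a1 \<noteq> 0 \<and> a2 \<noteq> 0}"
proof (intro equalityI subsetI)
  let ?R = "reeb A \<theta> x" and ?d = "d\<theta> x X1 X2"
  note d = dtheta_frame[OF fr] and F = adapted_frame_tangent[OF fr] reeb_tangent[OF fr]
  have x: "x \<in> points A" using fr by (simp add: adapted_frame_def)
  note ker\<theta> = kernel_theta[OF x]
  note vals = dual_frame_values[OF fr]
  have Xker: "X1 \<in> form_kernel A \<theta> x" "X2 \<in> form_kernel A \<theta> x"
    using F vals by (auto simp: form_kernel_def)
  {
    fix \<Omega> assume "\<Omega> \<in> Y2_fibre A E1 E2 (reeb_line A \<theta>) x"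
    then obtain \<omega> \<omega>1 \<omega>2 where \<Omega>: "\<Omega> = (\<omega>, \<omega>1, \<omega>2)"
      and "\<exists>X\<in>reeb_line A \<theta> x. \<exists>X1\<in>E1 x. \<exists>X2\<in>E2 x. \<exists>\<theta> \<theta>1 \<theta>2 l a1 a2.
           dual_coframe A x (X, X1, X2) (\<theta>, \<theta>1, \<theta>2) \<and> l > 0 \<and> a1 > 0 \<and> a2 > 0 \<and>
           \<omega> = (\<lambda>v. l * \<theta> v) \<and> \<omega>1 = (\<lambda>v. a1 * \<theta>1 v) \<and> \<omega>2 = (\<lambda>v. a2 * \<theta>2 v)"
      and "\<exists>W \<eta>. openin (mtop A) W \<and> x \<in> W \<and> one_form_on A W \<eta> \<and> \<eta> x = \<omega> \<and>
           (\<forall>q\<in>W. form_kernel A \<eta> q = plane_sum E1 E2 q) \<and>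
           (\<forall>u\<in>plane_sum E1 E2 x. \<forall>v\<in>plane_sum E1 E2 x. ext_d A \<eta> x u v = wedge \<omega>1 \<omega>2 u v)"
      unfolding Y2_fibre_def by blast
    then obtain X Y1 Y2 \<theta>' \<theta>1 \<theta>2 l b1 b2 W \<eta> where
      Y: "X \<in> reeb_line A \<theta> x" "Y1 \<in> E1 x" "Y2 \<in> E2 x"
      and dual: "dual_coframe A x (X, Y1, Y2) (\<theta>', \<theta>1, \<theta>2)" and b: "l > 0" "b1 > 0" "b2 > 0"
      and \<omega>: "\<omega> = (\<lambda>v. l * \<theta>' v)" "\<omega>1 = (\<lambda>v. b1 * \<theta>1 v)" "\<omega>2 = (\<lambda>v. b2 * \<theta>2 v)"
      and W: "openin (mtop A) W" "x \<in> W" and \<eta>: "one_form_on A W \<eta>" "\<eta> x = \<omega>"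
      and ker: "\<forall>q\<in>W. form_kernel A \<eta> q = plane_sum E1 E2 q"
      and d\<eta>: "\<forall>u\<in>plane_sum E1 E2 x. \<forall>v\<in>plane_sum E1 E2 x. ext_d A \<eta> x u v = wedge \<omega>1 \<omega>2 u v"
      by (elim bexE exE conjE) (rule that)
    obtain c c1 c2 where c: "X = vscale c ?R" "Y1 = vscale c1 X1" "Y2 = vscale c2 X2"
      using Y adapted_frame_lines[OF fr] by (auto simp: reeb_line_def)
    have cot: "\<theta>' \<in> cotangent_space A x" "\<theta>1 \<in> cotangent_space A x" "\<theta>2 \<in> cotangent_space A x"
      using dual by auto
    have eqs: "c * \<theta>' ?R = 1" "c * \<theta>1 ?R = 0" "c * \<theta>2 ?R = 0" "c1 * \<theta>1 X1 = 1" "c1 * \<theta>2 X1 = 0"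
      "c2 * \<theta>1 X2 = 0" "c2 * \<theta>2 X2 = 1" "c1 * \<theta>' X1 = 0" "c2 * \<theta>' X2 = 0"
      using dual F by (simp_all add: c cotangentD[OF cot(1)] cotangentD[OF cot(2)] cotangentD[OF cot(3)])
    then have nz: "c \<noteq> 0" "c1 \<noteq> 0" "c2 \<noteq> 0" "\<theta>1 X1 \<noteq> 0" "\<theta>2 X2 \<noteq> 0" by auto
    with eqs have z: "\<theta>1 ?R = 0" "\<theta>2 ?R = 0" "\<theta>1 X2 = 0" "\<theta>2 X1 = 0" "\<theta>' X1 = 0" "\<theta>' X2 = 0"
      by simp_all
    define a1 a2 where "a1 = b1 * \<theta>1 X1" "a2 = b2 * \<theta>2 X2"
    have a: "a1 \<noteq> 0" "a2 \<noteq> 0" using nz b by (simp_all add: a1_a2_def)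
    have \<omega>1: "\<omega>1 = (\<lambda>v. a1 * z1 x X1 X2 v)"
    proof
      fix v show "\<omega>1 v = a1 * z1 x X1 X2 v"
        using fun_cong[OF covector_on_E1[OF fr cot(2), OF z(1) refl z(3)], of v] by (simp add: \<omega> a1_a2_def)
    qed
    have \<omega>2: "\<omega>2 = (\<lambda>v. a2 * z2 x X1 X2 v)"
    proof
      fix v show "\<omega>2 v = a2 * z2 x X1 X2 v"
        using fun_cong[OF covector_on_E2[OF fr cot(3), OF z(2,4) refl], of v] by (simp add: \<omega> a1_a2_def)
    qed
    have W_points: "W \<subseteq> points A" using openin_subset[OF W(1)] atlas by simp
    have "ext_d A \<eta> x X1 X2 = \<eta> x ?R * ?d"
      by (rule ext_d_same_kernel[OF W \<eta>(1) _ fr Xker]) (use ker kernel_theta W_points in auto)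
    moreover have "ext_d A \<eta> x X1 X2 = a1 * a2"
      using d\<eta> Xker vals unfolding ker\<theta> \<omega>1 \<omega>2 by (simp add: wedge_def)
    ultimately have "\<omega> ?R = a1 * a2 / ?d" using d \<eta>(2) by (simp add: field_simps)
    then have "\<omega> = (\<lambda>v. a1 * a2 / ?d * \<theta> x v)"
      using z(5,6) unfolding \<omega> by (intro covector_on_reeb[OF fr cotangent_scale[OF cot(1)]]) simp_all
    then have "\<Omega> = coframe x X1 X2 a1 a2" using \<Omega> \<omega>1 \<omega>2 by (simp add: coframe_def)
    with a show "\<Omega> \<in> {coframe x X1 X2 a1 a2 | a1 a2. a1 \<noteq> 0 \<and> a2 \<noteq> 0}" by blast
  }
  fix \<Omega> assume "\<Omega> \<in> {coframe x X1 X2 a1 a2 | a1 a2. a1 \<noteq> 0 \<and> a2 \<noteq> 0}"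
  then obtain a1 a2 where a: "a1 \<noteq> 0" "a2 \<noteq> 0" and \<Omega>: "\<Omega> = coframe x X1 X2 a1 a2" by blast
  define c where "c = a1 * a2 / ?d"
  have c: "c \<noteq> 0" using a d by (simp add: c_def)
  define \<omega> \<omega>1 \<omega>2 where "\<omega> = (\<lambda>v. c * \<theta> x v)" "\<omega>1 = (\<lambda>v. a1 * z1 x X1 X2 v)" "\<omega>2 = (\<lambda>v. a2 * z2 x X1 X2 v)"
  note \<omega> = this
  have cot: "\<omega> \<in> cotangent_space A x" "\<omega>1 \<in> cotangent_space A x" "\<omega>2 \<in> cotangent_space A x"
    using dual_frame_cotangent[OF fr] theta_cotangent[OF x] by (simp_all add: \<omega> cotangent_scale)
  \<comment> \<open>All factors, with their signs, are put into the frame, so that the positive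
    scalings in the definition of the fibre can be taken to be 1.\<close>
  have dual: "dual_coframe A x (vscale (1 / c) ?R, vscale (1 / a1) X1, vscale (1 / a2) X2) (\<omega>, \<omega>1, \<omega>2)"
    using cot F a c vals reeb_theta[OF fr]
    by (simp add: cotangentD[OF cot(1)] cotangentD[OF cot(2)] cotangentD[OF cot(3)])
      (simp add: \<omega>)
  have lines: "vscale (1 / c) ?R \<in> reeb_line A \<theta> x" "vscale (1 / a1) X1 \<in> E1 x" "vscale (1 / a2) X2 \<in> E2 x"
    using adapted_frame_lines[OF fr] by (auto simp: reeb_line_def)
  \<comment> \<open>A constant nonzero multiple of \<theta> extends \<omega> and has the right
    kernel everywhere.\<close>
  define \<eta> where "\<eta> = (\<lambda>q v. c * \<theta> q v)"
  have \<eta>x: "\<eta> x = \<omega>" by (simp add: \<eta>_def \<omega>)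
  have one\<eta>: "one_form A \<eta>"
    unfolding one_form_on_def
  proof (intro conjI ballI)
    show "\<eta> p \<in> cotangent_space A p" if "p \<in> points A" for p
      using theta_cotangent[OF that] by (simp add: \<eta>_def cotangent_scale)
    show "case ch of (U, \<phi>) \<Rightarrow> \<forall>h. smooth_on (\<phi> ` (U \<inter> points A)) (form_coeff A (U, \<phi>) \<eta> h)"
      if ch: "ch \<in> A" for ch
    proof (clarify)
      fix U \<phi> h assume "ch = (U, \<phi>)"
      then have ch: "(U, \<phi>) \<in> A" using ch by simp
      have "smooth_on (\<phi> ` (U \<inter> points A)) (form_coeff A (U, \<phi>) \<theta> h)"
        using one_form_theta ch by (auto simp: one_form_on_def)
      then have "smooth_on (\<phi> ` (U \<inter> points A)) (\<lambda>y. c * form_coeff A (U, \<phi>) \<theta> h y)"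
        by (intro smooth_on_mult smooth_on_const openin_chart_image[OF atlas openin_points[OF atlas] ch])
      moreover have "form_coeff A (U, \<phi>) \<eta> h = (\<lambda>y. c * form_coeff A (U, \<phi>) \<theta> h y)"
        by (simp add: form_coeff_def \<eta>_def Let_def fun_eq_iff)
      ultimately show "smooth_on (\<phi> ` (U \<inter> points A)) (form_coeff A (U, \<phi>) \<eta> h)" by simp
    qed
  qed
  have ker\<eta>: "form_kernel A \<eta> q = form_kernel A \<theta> q" for q
    using c by (simp add: form_kernel_def \<eta>_def)
  have "ext_d A \<eta> x u v = wedge \<omega>1 \<omega>2 u v" if uv: "u \<in> plane_sum E1 E2 x" "v \<in> plane_sum E1 E2 x" for u v
  proof -
    have uv': "u \<in> form_kernel A \<theta> x" "v \<in> form_kernel A \<theta> x" using uv ker\<theta> by auto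
    then have "ext_d A \<eta> x u v = c * d\<theta> x u v"
      using ext_d_same_kernel[OF openin_points[OF atlas] x one\<eta> ker\<eta> fr uv'] reeb_theta[OF fr]
      by (simp add: \<eta>_def)
    moreover have "wedge \<omega>1 \<omega>2 u v = a1 * a2 * wedge (z1 x X1 X2) (z2 x X1 X2) u v"
      by (simp add: wedge_def \<omega> algebra_simps)
    ultimately show ?thesis
      using wedge_dual_frame[OF fr, of u v] uv' by (simp add: form_kernel_def c_def)
  qed
  then have ext: "\<exists>W \<eta>. openin (mtop A) W \<and> x \<in> W \<and> one_form_on A W \<eta> \<and> \<eta> x = \<omega> \<and>
           (\<forall>q\<in>W. form_kernel A \<eta> q = plane_sum E1 E2 q) \<and>
           (\<forall>u\<in>plane_sum E1 E2 x. \<forall>v\<in>plane_sum E1 E2 x. ext_d A \<eta> x u v = wedge \<omega>1 \<omega>2 u v)"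
    using openin_points[OF atlas] x one\<eta> \<eta>x ker\<eta> kernel_theta
    by (intro exI[of _ "points A"] exI[of _ \<eta>]) auto
  have frame: "\<exists>X\<in>reeb_line A \<theta> x. \<exists>X1\<in>E1 x. \<exists>X2\<in>E2 x. \<exists>\<theta> \<theta>1 \<theta>2 l a1 a2.
           dual_coframe A x (X, X1, X2) (\<theta>, \<theta>1, \<theta>2) \<and> l > 0 \<and> a1 > 0 \<and> a2 > 0 \<and>
           \<omega> = (\<lambda>v. l * \<theta> v) \<and> \<omega>1 = (\<lambda>v. a1 * \<theta>1 v) \<and> \<omega>2 = (\<lambda>v. a2 * \<theta>2 v)"
    using dual by (intro bexI[OF _ lines(1)] bexI[OF _ lines(2)] bexI[OF _ lines(3)]
        exI[of _ \<omega>] exI[of _ \<omega>1] exI[of _ \<omega>2] exI[of _ 1]) simp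
  show "\<Omega> \<in> Y2_fibre A E1 E2 (reeb_line A \<theta>) x"
    using frame ext unfolding Y2_fibre_def \<Omega> coframe_def \<omega>(1)[unfolded c_def, symmetric] \<omega>(2,3)[symmetric]
    by blast
qed

subsection \<open>Smoothness of the structure functions\<close>

lemma section_coefficients:
  assumes X: "vector_field_on A W X" and c: "(U, \<phi>) \<in> A"
  obtains \<xi> where "smooth_on (\<phi> ` (U \<inter> W)) \<xi>"
    "\<And>p. p \<in> U \<inter> W \<Longrightarrow> X p = chart_vec A (U, \<phi>) p (\<xi> (\<phi> p))"
proof -
  have "\<exists>\<xi>. smooth_on (\<phi> ` (U \<inter> W)) \<xi> \<and> (\<forall>p\<in>U \<inter> W. X p = chart_vec A (U, \<phi>) p (\<xi> (\<phi> p)))"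
    using X c unfolding vector_field_on_def by fast
  then show ?thesis using that by auto
qed

text \<open>Two nonvanishing sections of a line field are proportional, and the quotient of inner
  products of their chart components expresses the factor smoothly: its denominator has no
  zeros.\<close>

lemma section_ratio:
  assumes E: "line_subbundle A E" and X: "local_section A E W X" "local_section A E W' X'"
    and W: "openin (mtop A) W" "openin (mtop A) W'" and c: "(U, \<phi>) \<in> A"
  obtains g where "smooth_on (\<phi> ` (U \<inter> (W \<inter> W'))) g"
    "\<And>p. p \<in> U \<inter> (W \<inter> W') \<Longrightarrow> X' p = vscale (g (\<phi> p)) (X p)"
proof -
  obtain \<xi> where \<xi>: "smooth_on (\<phi> ` (U \<inter> W)) \<xi>"
    "\<And>p. p \<in> U \<inter> W \<Longrightarrow> X p = chart_vec A (U, \<phi>) p (\<xi> (\<phi> p))"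
    using section_coefficients[OF _ c] X(1) unfolding local_section_def by metis
  obtain \<xi>' where \<xi>': "smooth_on (\<phi> ` (U \<inter> W')) \<xi>'"
    "\<And>p. p \<in> U \<inter> W' \<Longrightarrow> X' p = chart_vec A (U, \<phi>) p (\<xi>' (\<phi> p))"
    using section_coefficients[OF _ c] X(2) unfolding local_section_def by metis
  let ?S = "\<phi> ` (U \<inter> (W \<inter> W'))"
  let ?g = "\<lambda>y. (\<xi>' y \<bullet> \<xi> y) / (\<xi> y \<bullet> \<xi> y)"
  have nz: "\<xi> (\<phi> p) \<noteq> 0" if "p \<in> U \<inter> (W \<inter> W')" for p
    using X(1) \<xi>(2)[of p] that chart_vec_zero[OF atlas c, of p] by (auto simp: local_section_def)
  have o: "open ?S" by (intro openin_chart_image[OF atlas _ c] openin_Int W)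
  have "smooth_on ?S \<xi>" "smooth_on ?S \<xi>'"
    by (rule smooth_on_subset[OF \<xi>(1)], blast, rule smooth_on_subset[OF \<xi>'(1)], blast)
  then have "smooth_on ?S ?g"
    using nz by (intro smooth_on_divide smooth_on_inner o) auto
  moreover have "X' p = vscale (?g (\<phi> p)) (X p)" if p: "p \<in> U \<inter> (W \<inter> W')" for p
  proof -
    have "p \<in> points A" using p points_chart[OF c] by blast
    then have "E p = {vscale k (X p) | k. True}"
      using line_subbundle_fibre(2)[OF E] X(1) p by (simp add: local_section_def)
    then obtain k where k: "X' p = vscale k (X p)"
      using X(2) p by (auto simp: local_section_def)
    then have "chart_vec A (U, \<phi>) p (\<xi>' (\<phi> p)) = chart_vec A (U, \<phi>) p (k *\<^sub>R \<xi> (\<phi> p))"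
      using \<xi>(2)[of p] \<xi>'(2)[of p] p chart_vec_scale[OF atlas c, of p] by simp
    then have "\<xi>' (\<phi> p) = k *\<^sub>R \<xi> (\<phi> p)" using chart_vec_inject[OF atlas c, of p] p by simp
    then have g: "?g (\<phi> p) = k" using nz[OF p] by simp
    then show "X' p = vscale (?g (\<phi> p)) (X p)" using k by simp
  qed
  ultimately show ?thesis using that by blast
qed

lemma form_coeff_theta_smooth: "(U, \<phi>) \<in> A \<Longrightarrow> smooth_on (\<phi> ` U) (form_coeff A (U, \<phi>) \<theta> h)"
proof -
  assume c: "(U, \<phi>) \<in> A"
  then have "smooth_on (\<phi> ` (U \<inter> points A)) (form_coeff A (U, \<phi>) \<theta> h)"
    using one_form_theta by (auto simp: one_form_on_def)
  moreover have "U \<inter> points A = U" using points_chart[OF c] by blast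
  ultimately show ?thesis by simp
qed

text \<open>On constant directions \<open>d\<theta>\<close> is a difference of derivatives of
  coefficients of \<theta>; moving directions reduce to these by expanding both arguments in
  \<open>Basis\<close>.\<close>

lemma dtheta_smooth:
  assumes c: "(U, \<phi>) \<in> A" and S: "open S" "S \<subseteq> \<phi> ` U" and \<xi>: "smooth_on S \<xi>" "smooth_on S \<zeta>"
  obtains g where "smooth_on S g"
    "\<And>p. p \<in> U \<Longrightarrow> \<phi> p \<in> S \<Longrightarrow>
      d\<theta> p (chart_vec A (U, \<phi>) p (\<xi> (\<phi> p))) (chart_vec A (U, \<phi>) p (\<zeta> (\<phi> p))) = g (\<phi> p)"
proof -
  let ?t = "form_coeff A (U, \<phi>) \<theta>"
  let ?m = "\<lambda>i j y. frechet_derivative (?t j) (at y) i - frechet_derivative (?t i) (at y) j"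
  let ?g = "\<lambda>y. \<Sum>i\<in>Basis. (\<xi> y \<bullet> i) * (\<Sum>j\<in>Basis. (\<zeta> y \<bullet> j) * ?m i j y)"
  have t: "smooth_on S (?t h)" for h
    using smooth_on_subset[OF form_coeff_theta_smooth[OF c] S(2)] .
  have "smooth_on S ?g"
    using S(1) by (intro smooth_on_sum smooth_on_mult smooth_on_diff smooth_on_frechet_derivative t
        smooth_on_inner smooth_on_const \<xi>)
  moreover have "d\<theta> p (chart_vec A (U, \<phi>) p (\<xi> (\<phi> p))) (chart_vec A (U, \<phi>) p (\<zeta> (\<phi> p))) = ?g (\<phi> p)"
    if p: "p \<in> U" for p
  proof -
    note C1 = C1_theta[OF points_chart[OF c p]]
    note lin = ext_d_linear[OF atlas C1 c p] and T = chart_vec_in_tangent_space[OF c p]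
    let ?D = "\<lambda>h k. d\<theta> p (chart_vec A (U, \<phi>) p h) (chart_vec A (U, \<phi>) p k)"
    have lin2: "linear (?D h)" for h
    proof -
      have eq: "?D h = (\<lambda>k. - ?D k h)" using ext_d_antisym[OF atlas C1 T T] by (intro ext)
      show ?thesis unfolding eq by (rule linear_compose_neg[OF lin])
    qed
    have D: "?D h k = (\<Sum>i\<in>Basis. (h \<bullet> i) * (\<Sum>j\<in>Basis. (k \<bullet> j) * ?D i j))" for h k
    proof -
      have "?D i k = (\<Sum>j\<in>Basis. (k \<bullet> j) * ?D i j)" for i
        using linear_sum_Basis[OF lin2[of i], of k] by simp
      then show ?thesis
        using linear_sum_Basis[OF lin[of k], of h] by simp
    qed
    show ?thesis
      by (rule trans[OF D]) (simp only: ext_d_chart[OF atlas C1 c p])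
  qed
  ultimately show ?thesis using that by blast
qed

end

section \<open>The coframe bundles as manifolds\<close>

lemma smooth_on_fst_compose:
  fixes f :: "'e::euclidean_space \<Rightarrow> 'f::real_normed_vector" and T :: "'g::real_normed_vector set"
  assumes "open S" "open T" "smooth_on S f"
  shows "smooth_on (S \<times> T) (\<lambda>p. f (fst p))"
  by (rule smooth_on_compose[OF _ assms(1) _ _ assms(3)])
    (use assms in \<open>auto intro!: open_Times smooth_on_bounded_linear[OF bounded_linear_fst] smooth_on_id\<close>)

lemma smooth_on_snd_compose:
  assumes "open S" "open T" "bounded_linear L"
  shows "smooth_on (S \<times> T) (\<lambda>p. L (snd p))"
  using assms
  by (intro smooth_on_bounded_linear[OF assms(3)] smooth_on_bounded_linear[OF bounded_linear_snd]
      smooth_on_id open_Times)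

context strict_path
begin

abbreviation "T1 \<equiv> total_space A (Y1_fibre A E1 E2 \<theta>)"
abbreviation "T2 \<equiv> total_space A (Y2_fibre A E1 E2 (reeb_line A \<theta>))"
abbreviation "B1 \<equiv> Y1 A E1 E2 \<theta>"
abbreviation "B2 \<equiv> Y2 A E1 E2 (reeb_line A \<theta>)"

section \<open>Membership in the total spaces and local sections\<close>

lemma T1_iff:
  assumes "adapted_frame x X1 X2"
  shows "(x, \<Omega>) \<in> T1 \<longleftrightarrow> (\<exists>s. s \<noteq> 0 \<and> \<Omega> = coframe x X1 X2 s (d\<theta> x X1 X2 / s))"
proof -
  have "x \<in> points A" using assms by (simp add: adapted_frame_def)
  then show ?thesis
    by (auto simp: total_space_def Y1_fibre_eq[OF assms])
qed

lemma T2_iff: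
  assumes "adapted_frame x X1 X2"
  shows "(x, \<Omega>) \<in> T2 \<longleftrightarrow> (\<exists>a1 a2. a1 \<noteq> 0 \<and> a2 \<noteq> 0 \<and> \<Omega> = coframe x X1 X2 a1 a2)"
proof -
  have "x \<in> points A" using assms by (simp add: adapted_frame_def)
  then show ?thesis
    by (auto simp: total_space_def Y2_fibre_eq[OF assms])
qed

lemma T1_fst: "q \<in> T1 \<Longrightarrow> fst q \<in> points A" and T2_fst: "q \<in> T2 \<Longrightarrow> fst q \<in> points A"
  by (auto simp: total_space_def)

lemma coframe_values:
  assumes fr: "adapted_frame x X1 X2" and \<Omega>: "(\<omega>, \<omega>1, \<omega>2) = coframe x X1 X2 a1 a2"
  shows "\<omega>1 X1 = a1" "\<omega>2 X2 = a2" "\<omega> (reeb A \<theta> x) = a1 * a2 / d\<theta> x X1 X2"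
    and "\<omega> \<in> cotangent_space A x" "\<omega>1 \<in> cotangent_space A x" "\<omega>2 \<in> cotangent_space A x"
proof -
  have x: "x \<in> points A" using fr by (simp add: adapted_frame_def)
  have \<omega>: "\<omega> = (\<lambda>v. a1 * a2 / d\<theta> x X1 X2 * \<theta> x v)"
    "\<omega>1 = (\<lambda>v. a1 * z1 x X1 X2 v)" "\<omega>2 = (\<lambda>v. a2 * z2 x X1 X2 v)"
    using \<Omega> by (simp_all add: coframe_def)
  show "\<omega>1 X1 = a1" "\<omega>2 X2 = a2" "\<omega> (reeb A \<theta> x) = a1 * a2 / d\<theta> x X1 X2"
    using dual_frame_values[OF fr] reeb_theta[OF fr] by (simp_all add: \<omega>)
  show "\<omega> \<in> cotangent_space A x" "\<omega>1 \<in> cotangent_space A x" "\<omega>2 \<in> cotangent_space A x"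
    unfolding \<omega> by (intro cotangent_scale theta_cotangent[OF x] dual_frame_cotangent[OF fr])+
qed

text \<open>The two fibre coordinates determine the whole coframe, its first member being fixed by
  the normalisation.\<close>

lemma T2_values:
  assumes fr: "adapted_frame x X1 X2" and q: "(x, \<omega>, \<omega>1, \<omega>2) \<in> T2"
  shows "\<omega>1 X1 \<noteq> 0" "\<omega>2 X2 \<noteq> 0" "(\<omega>, \<omega>1, \<omega>2) = coframe x X1 X2 (\<omega>1 X1) (\<omega>2 X2)"
proof -
  obtain a1 a2 where a: "a1 \<noteq> 0" "a2 \<noteq> 0" "(\<omega>, \<omega>1, \<omega>2) = coframe x X1 X2 a1 a2"
    using q unfolding T2_iff[OF fr] by blast
  then show "\<omega>1 X1 \<noteq> 0" "\<omega>2 X2 \<noteq> 0" "(\<omega>, \<omega>1, \<omega>2) = coframe x X1 X2 (\<omega>1 X1) (\<omega>2 X2)"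
    using coframe_values[OF fr a(3)] by simp_all
qed

lemma T1_subset_T2: "T1 \<subseteq> T2"
proof
  fix q assume q: "q \<in> T1"
  obtain x \<Omega> where x: "q = (x, \<Omega>)" by (cases q)
  obtain X1 X2 where fr: "adapted_frame x X1 X2"
    using adapted_frame_exists T1_fst[OF q] x by auto
  show "q \<in> T2"
  proof -
    obtain s where "s \<noteq> 0" "\<Omega> = coframe x X1 X2 s (d\<theta> x X1 X2 / s)"
      using q unfolding x T1_iff[OF fr] by blast
    moreover from this(1) have "d\<theta> x X1 X2 / s \<noteq> 0" using dtheta_frame[OF fr] by simp
    ultimately show ?thesis unfolding x T2_iff[OF fr] by blast
  qed
qed

lemma T1_values:
  assumes fr: "adapted_frame x X1 X2" and q: "(x, \<omega>, \<omega>1, \<omega>2) \<in> T1"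
  shows "\<omega> = \<theta> x" "\<omega>2 X2 = d\<theta> x X1 X2 / \<omega>1 X1"
proof -
  obtain s where s: "s \<noteq> 0" "(\<omega>, \<omega>1, \<omega>2) = coframe x X1 X2 s (d\<theta> x X1 X2 / s)"
    using q unfolding T1_iff[OF fr] by blast
  then show "\<omega>2 X2 = d\<theta> x X1 X2 / \<omega>1 X1" using coframe_values[OF fr s(2)] by simp
  show "\<omega> = \<theta> x" using s dtheta_frame[OF fr] by (simp add: coframe_def)
qed

lemma T2_cotangent:
  assumes "(x, \<omega>, \<omega>1, \<omega>2) \<in> T2"
  shows "\<omega> \<in> cotangent_space A x" "\<omega>1 \<in> cotangent_space A x" "\<omega>2 \<in> cotangent_space A x"
proof -
  obtain X1 X2 where fr: "adapted_frame x X1 X2"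
    using adapted_frame_exists T2_fst[OF assms] by auto
  show "\<omega> \<in> cotangent_space A x" "\<omega>1 \<in> cotangent_space A x" "\<omega>2 \<in> cotangent_space A x"
    using coframe_values(4-6)[OF fr T2_values(3)[OF fr assms]] .
qed

lemma section_adapted:
  assumes "openin (mtop A) W" "x \<in> W"
  shows "local_section A E1 W X1 \<Longrightarrow> local_section A E2 W' X2 \<Longrightarrow> x \<in> W' \<Longrightarrow> adapted_frame x (X1 x) (X2 x)"
    and "local_section A E1 W X1 \<Longrightarrow> \<exists>X2. adapted_frame x (X1 x) X2"
proof -
  have x: "x \<in> points A" using openin_subset[OF assms(1)] assms(2) atlas by auto
  show "local_section A E1 W X1 \<Longrightarrow> local_section A E2 W' X2 \<Longrightarrow> x \<in> W' \<Longrightarrow> adapted_frame x (X1 x) (X2 x)"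
    using x assms(2) by (simp add: local_section_def adapted_frame_def)
  obtain Y1 Y2 where "adapted_frame x Y1 Y2" using adapted_frame_exists[OF x] .
  then show "local_section A E1 W X1 \<Longrightarrow> \<exists>X2. adapted_frame x (X1 x) X2"
    using x assms(2) by (auto simp: local_section_def adapted_frame_def)
qed

lemma local_section_subset:
  assumes X: "local_section A E W X" and Z: "Z \<subseteq> W"
  shows "local_section A E Z X"
  unfolding local_section_def vector_field_on_def
proof (intro conjI)
  show "\<forall>(V, \<psi>)\<in>A. \<exists>\<xi>. smooth_on (\<psi> ` (V \<inter> Z)) \<xi> \<and> (\<forall>p\<in>V \<inter> Z. X p = chart_vec A (V, \<psi>) p (\<xi> (\<psi> p)))"
  proof clarify
    fix V \<psi> assume c: "(V, \<psi>) \<in> A"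
    obtain \<xi> where \<xi>: "smooth_on (\<psi> ` (V \<inter> W)) \<xi>"
      "\<And>p. p \<in> V \<inter> W \<Longrightarrow> X p = chart_vec A (V, \<psi>) p (\<xi> (\<psi> p))"
      using section_coefficients[OF _ c] X unfolding local_section_def by metis
    have "smooth_on (\<psi> ` (V \<inter> Z)) \<xi>"
      by (rule smooth_on_subset[OF \<xi>(1)]) (use Z in blast)
    with \<xi>(2) Z show "\<exists>\<xi>. smooth_on (\<psi> ` (V \<inter> Z)) \<xi> \<and>
      (\<forall>p\<in>V \<inter> Z. X p = chart_vec A (V, \<psi>) p (\<xi> (\<psi> p)))" by blast
  qed
qed (use X Z in \<open>auto simp: local_section_def\<close>)

lemma local_section_exists:
  assumes E: "line_subbundle A E" and c: "(U, \<phi>) \<in> A" "x \<in> U"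
  obtains W X where "openin (mtop A) W" "x \<in> W" "W \<subseteq> U" "local_section A E W X"
proof -
  obtain W X where W: "openin (mtop A) W" "x \<in> W" "vector_field_on A W X"
    "\<And>q. q \<in> W \<Longrightarrow> X q \<noteq> vzero" "\<And>q. q \<in> W \<Longrightarrow> E q = {vscale c (X q) | c. True}"
    using line_subbundleE[OF E points_chart[OF c]] by metis
  have "X q \<in> E q" if "q \<in> W" for q
  proof -
    have "X q = vscale 1 (X q)" by (simp add: vscale_def)
    then show ?thesis using W(5)[OF that] by blast
  qed
  then have "local_section A E W X"
    using W(3,4) by (simp add: local_section_def)
  then have "local_section A E (W \<inter> U) X"
    by (rule local_section_subset) blast
  then show ?thesis
    using that[of "W \<inter> U" X] W(1,2) c openin_chart[OF atlas c(1)] by blast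
qed

lemma base_transition:
  assumes c: "(U, \<phi>) \<in> A" "(V, \<psi>) \<in> A" and W: "openin (mtop A) W" "W \<subseteq> U" "openin (mtop A) W'" "W' \<subseteq> V"
  shows "open (\<phi> ` (W \<inter> W'))" "smooth_on (\<phi> ` (W \<inter> W')) (\<psi> \<circ> inv_into U \<phi>)"
proof -
  have "U \<inter> (W \<inter> W') = W \<inter> W'" using W by blast
  then show "open (\<phi> ` (W \<inter> W'))"
    using openin_chart_image[OF atlas openin_Int[OF W(1,3)] c(1)] by simp
  show "smooth_on (\<phi> ` (W \<inter> W')) (\<psi> \<circ> inv_into U \<phi>)"
    by (rule smooth_on_subset[OF smooth_atlas_transition(2)[OF atlas c]]) (use W in blast)
qed

lemma section_ratio_within:
  assumes E: "line_subbundle A E" and X: "local_section A E W X" "local_section A E W' X'"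
    and W: "openin (mtop A) W" "W \<subseteq> U" "openin (mtop A) W'" and c: "(U, \<phi>) \<in> A"
  obtains g where "smooth_on (\<phi> ` (W \<inter> W')) g"
    "\<forall>p\<in>W \<inter> W'. X' p = vscale (g (\<phi> p)) (X p)"
proof -
  have "U \<inter> (W \<inter> W') = W \<inter> W'" using W by blast
  then show ?thesis using section_ratio[OF E X W(1,3) c] that by metis
qed

lemma section_tangent:
  "line_subbundle A E \<Longrightarrow> openin (mtop A) W \<Longrightarrow> local_section A E W X \<Longrightarrow> p \<in> W \<Longrightarrow> X p \<in> tangent_space A p"
  using line_subbundle_fibre(1)[of E p "X p"] openin_subset[of "mtop A" W] topspace_mtop[OF atlas]
  by (auto simp: local_section_def)

text \<open>The two sections may have different domains, as happens when a chart of
  \<open>Y1\<close> is compared with a chart of \<open>Y2\<close>.\<close>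

lemma dtheta_sections:
  assumes c: "(U, \<phi>) \<in> A" and X: "local_section A E W X" "local_section A E' W' X'"
    and W: "openin (mtop A) W" "W \<subseteq> U" "openin (mtop A) W'"
  obtains g where "smooth_on (\<phi> ` (W \<inter> W')) g" "\<And>p. p \<in> W \<inter> W' \<Longrightarrow> d\<theta> p (X p) (X' p) = g (\<phi> p)"
proof -
  let ?S = "\<phi> ` (W \<inter> W')"
  have o: "open ?S" "?S \<subseteq> \<phi> ` U"
    using base_transition(1)[OF c c W(1,2) openin_Int[OF W(1,3)]] W by (auto simp: Int_absorb1)
  obtain \<xi> where \<xi>: "smooth_on (\<phi> ` (U \<inter> W)) \<xi>"
    "\<And>p. p \<in> U \<inter> W \<Longrightarrow> X p = chart_vec A (U, \<phi>) p (\<xi> (\<phi> p))"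
    using section_coefficients[OF _ c] X(1) unfolding local_section_def by metis
  obtain \<xi>' where \<xi>': "smooth_on (\<phi> ` (U \<inter> W')) \<xi>'"
    "\<And>p. p \<in> U \<inter> W' \<Longrightarrow> X' p = chart_vec A (U, \<phi>) p (\<xi>' (\<phi> p))"
    using section_coefficients[OF _ c] X(2) unfolding local_section_def by metis
  have s: "smooth_on ?S \<xi>" "smooth_on ?S \<xi>'"
    by (rule smooth_on_subset[OF \<xi>(1)], use W in blast, rule smooth_on_subset[OF \<xi>'(1)], use W in blast)
  obtain g where "smooth_on ?S g" "\<And>p. p \<in> U \<Longrightarrow> \<phi> p \<in> ?S \<Longrightarrow>
      d\<theta> p (chart_vec A (U, \<phi>) p (\<xi> (\<phi> p))) (chart_vec A (U, \<phi>) p (\<xi>' (\<phi> p))) = g (\<phi> p)"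
    using dtheta_smooth[OF c o s] by metis
  moreover have "p \<in> U" if "p \<in> W" for p using that W by blast
  ultimately show ?thesis using that[of g] \<xi>(2) \<xi>'(2) by simp
qed

subsection \<open>Charts\<close>

definition chart1 :: "('a \<Rightarrow> real^3) \<Rightarrow> ('a \<Rightarrow> 'a tvec) \<Rightarrow> 'a \<times> 'a coframe \<Rightarrow> (real^3) \<times> real" where
  "chart1 \<phi> X1 = (\<lambda>(x, \<omega>, \<omega>1, \<omega>2). (\<phi> x, \<omega>1 (X1 x)))"

definition chart2 ::
  "('a \<Rightarrow> real^3) \<Rightarrow> ('a \<Rightarrow> 'a tvec) \<Rightarrow> ('a \<Rightarrow> 'a tvec) \<Rightarrow> 'a \<times> 'a coframe \<Rightarrow> (real^3) \<times> real \<times> real" where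
  "chart2 \<phi> X1 X2 = (\<lambda>(x, \<omega>, \<omega>1, \<omega>2). (\<phi> x, \<omega>1 (X1 x), \<omega>2 (X2 x)))"

definition chart1_data where
  "chart1_data U \<phi> W X1 \<longleftrightarrow>
     (U, \<phi>) \<in> A \<and> W \<subseteq> U \<and> openin (mtop A) W \<and> local_section A E1 W X1"

definition chart2_data where
  "chart2_data U \<phi> W X1 X2 \<longleftrightarrow>
     (U, \<phi>) \<in> A \<and> W \<subseteq> U \<and> openin (mtop A) W \<and> local_section A E1 W X1 \<and> local_section A E2 W X2"

lemma B1_eq: "B1 = {({q \<in> T1. fst q \<in> W}, chart1 \<phi> X1) | U \<phi> W X1. chart1_data U \<phi> W X1}"
proof -
  have eq: "{(x, \<Omega>). (x, \<Omega>) \<in> T1 \<and> x \<in> W} = {q \<in> T1. fst q \<in> W}" for W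
    by auto
  show ?thesis unfolding Y1_def chart1_def chart1_data_def eq ..
qed

lemma B2_eq: "B2 = {({q \<in> T2. fst q \<in> W}, chart2 \<phi> X1 X2) | U \<phi> W X1 X2. chart2_data U \<phi> W X1 X2}"
proof -
  have eq: "{(x, \<Omega>). (x, \<Omega>) \<in> T2 \<and> x \<in> W} = {q \<in> T2. fst q \<in> W}" for W
    by auto
  show ?thesis unfolding Y2_def chart2_def chart2_data_def eq ..
qed

lemma B1E:
  assumes "(P, \<kappa>) \<in> B1"
  obtains U \<phi> W X1 where "chart1_data U \<phi> W X1" "P = {q \<in> T1. fst q \<in> W}" "\<kappa> = chart1 \<phi> X1"
  using assms unfolding B1_eq by auto

lemma B2E:
  assumes "(P, \<kappa>) \<in> B2"
  obtains U \<phi> W X1 X2 where "chart2_data U \<phi> W X1 X2" "P = {q \<in> T2. fst q \<in> W}" "\<kappa> = chart2 \<phi> X1 X2"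
  using assms unfolding B2_eq by auto

text \<open>Stated for all \<open>Z\<close> inside the domain, because overlaps of charts and
  preimages of charts under the bundle maps consist of the coframes over such a \<open>Z\<close>.
  Openness of their images thus reduces to openness in the base.\<close>

lemma chart1_image:
  assumes c: "chart1_data U \<phi> W X1" and Z: "Z \<subseteq> W"
  shows "chart1 \<phi> X1 ` {q \<in> T1. fst q \<in> Z} = \<phi> ` Z \<times> (- {0})"
proof (intro equalityI subsetI)
  fix y assume "y \<in> chart1 \<phi> X1 ` {q \<in> T1. fst q \<in> Z}"
  then obtain x \<omega> \<omega>1 \<omega>2 where q: "(x, \<omega>, \<omega>1, \<omega>2) \<in> T1" "x \<in> Z" "y = (\<phi> x, \<omega>1 (X1 x))"
    by (auto simp: chart1_def)
  obtain X2 where "adapted_frame x (X1 x) X2"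
    using section_adapted(2)[of W x X1] c q(2) Z by (auto simp: chart1_data_def)
  then show "y \<in> \<phi> ` Z \<times> (- {0})"
    using T2_values(1)[of x "X1 x" X2 \<omega> \<omega>1 \<omega>2] T1_subset_T2 q by auto
next
  fix y assume "y \<in> \<phi> ` Z \<times> (- {0 :: real})"
  then obtain x s where y: "x \<in> Z" "s \<noteq> 0" "y = (\<phi> x, s)" by auto
  obtain X2 where fr: "adapted_frame x (X1 x) X2"
    using section_adapted(2)[of W x X1] c y(1) Z by (auto simp: chart1_data_def)
  obtain \<omega> \<omega>1 \<omega>2 where \<Omega>: "(\<omega>, \<omega>1, \<omega>2) = coframe x (X1 x) X2 s (d\<theta> x (X1 x) X2 / s)"
    by (metis prod_cases3)
  have "(x, \<omega>, \<omega>1, \<omega>2) \<in> T1" unfolding T1_iff[OF fr] using \<Omega> y(2) by blast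
  moreover have "y = chart1 \<phi> X1 (x, \<omega>, \<omega>1, \<omega>2)"
    using coframe_values(1)[OF fr \<Omega>] y(3) by (simp add: chart1_def)
  ultimately show "y \<in> chart1 \<phi> X1 ` {q \<in> T1. fst q \<in> Z}" using y(1) by force
qed

lemma chart2_image:
  assumes c: "chart2_data U \<phi> W X1 X2" and Z: "Z \<subseteq> W"
  shows "chart2 \<phi> X1 X2 ` {q \<in> T2. fst q \<in> Z} = \<phi> ` Z \<times> ((- {0}) \<times> (- {0}))"
proof (intro equalityI subsetI)
  fix y assume "y \<in> chart2 \<phi> X1 X2 ` {q \<in> T2. fst q \<in> Z}"
  then obtain x \<omega> \<omega>1 \<omega>2 where q: "(x, \<omega>, \<omega>1, \<omega>2) \<in> T2" "x \<in> Z" "y = (\<phi> x, \<omega>1 (X1 x), \<omega>2 (X2 x))"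
    by (auto simp: chart2_def)
  have "adapted_frame x (X1 x) (X2 x)"
    using section_adapted(1)[of W x X1 W X2] c q(2) Z by (auto simp: chart2_data_def)
  then show "y \<in> \<phi> ` Z \<times> ((- {0}) \<times> (- {0}))"
    using T2_values(1,2)[of x "X1 x" "X2 x" \<omega> \<omega>1 \<omega>2] q by auto
next
  fix y assume "y \<in> \<phi> ` Z \<times> ((- {0 :: real}) \<times> (- {0 :: real}))"
  then obtain x a1 a2 where y: "x \<in> Z" "a1 \<noteq> 0" "a2 \<noteq> 0" "y = (\<phi> x, a1, a2)" by auto
  have fr: "adapted_frame x (X1 x) (X2 x)"
    using section_adapted(1)[of W x X1 W X2] c y(1) Z by (auto simp: chart2_data_def)
  obtain \<omega> \<omega>1 \<omega>2 where \<Omega>: "(\<omega>, \<omega>1, \<omega>2) = coframe x (X1 x) (X2 x) a1 a2"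
    by (metis prod_cases3)
  have "(x, \<omega>, \<omega>1, \<omega>2) \<in> T2" unfolding T2_iff[OF fr] using \<Omega> y(2,3) by blast
  moreover have "y = chart2 \<phi> X1 X2 (x, \<omega>, \<omega>1, \<omega>2)"
    using coframe_values(1,2)[OF fr \<Omega>] y(4) by (simp add: chart2_def)
  ultimately show "y \<in> chart2 \<phi> X1 X2 ` {q \<in> T2. fst q \<in> Z}" using y(1) by force
qed

lemma chart2_inj:
  assumes c: "chart2_data U \<phi> W X1 X2"
  shows "inj_on (chart2 \<phi> X1 X2) {q \<in> T2. fst q \<in> W}"
proof (rule inj_onI)
  fix p q assume pq: "p \<in> {q \<in> T2. fst q \<in> W}" "q \<in> {q \<in> T2. fst q \<in> W}"
    "chart2 \<phi> X1 X2 p = chart2 \<phi> X1 X2 q"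
  obtain x \<omega> \<omega>1 \<omega>2 y \<eta> \<eta>1 \<eta>2 where p: "p = (x, \<omega>, \<omega>1, \<omega>2)" and q: "q = (y, \<eta>, \<eta>1, \<eta>2)"
    by (metis prod_cases4)
  have "x \<in> U" "y \<in> U" "(U, \<phi>) \<in> A" using pq c p q by (auto simp: chart2_data_def)
  then have xy: "x = y"
    using pq(3) smooth_atlas_chart(1)[OF atlas] unfolding p q chart2_def by (auto dest: inj_onD)
  have fr: "adapted_frame x (X1 x) (X2 x)"
    using section_adapted(1)[of W x X1 W X2] c pq(1) p by (auto simp: chart2_data_def)
  have "(\<omega>, \<omega>1, \<omega>2) = (\<eta>, \<eta>1, \<eta>2)"
    using T2_values(3)[OF fr, of \<omega> \<omega>1 \<omega>2] T2_values(3)[OF fr, of \<eta> \<eta>1 \<eta>2] pq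
    unfolding p q xy[symmetric] by (simp add: chart2_def)
  then show "p = q" using xy p q by simp
qed

text \<open>The chart records only the first fibre coordinate; on \<open>Y1\<close> the second is
  \<open>d\<theta> x X1 X2\<close> divided by it, for any completion \<open>X2\<close> of the
  frame.\<close>

lemma chart1_inj:
  assumes c: "chart1_data U \<phi> W X1"
  shows "inj_on (chart1 \<phi> X1) {q \<in> T1. fst q \<in> W}"
proof (rule inj_onI)
  fix p q assume pq: "p \<in> {q \<in> T1. fst q \<in> W}" "q \<in> {q \<in> T1. fst q \<in> W}"
    "chart1 \<phi> X1 p = chart1 \<phi> X1 q"
  obtain x \<omega> \<omega>1 \<omega>2 y \<eta> \<eta>1 \<eta>2 where p: "p = (x, \<omega>, \<omega>1, \<omega>2)" and q: "q = (y, \<eta>, \<eta>1, \<eta>2)"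
    by (metis prod_cases4)
  have "x \<in> U" "y \<in> U" "(U, \<phi>) \<in> A" using pq c p q by (auto simp: chart1_data_def)
  then have xy: "x = y"
    using pq(3) smooth_atlas_chart(1)[OF atlas] unfolding p q chart1_def by (auto dest: inj_onD)
  obtain X2 where fr: "adapted_frame x (X1 x) X2"
    using section_adapted(2)[of W x X1] c pq(1) p by (auto simp: chart1_data_def)
  have T: "(x, \<omega>, \<omega>1, \<omega>2) \<in> T1" "(x, \<eta>, \<eta>1, \<eta>2) \<in> T1" using pq p q xy by auto
  have eq: "\<omega>1 (X1 x) = \<eta>1 (X1 x)" using pq(3) unfolding p q xy by (simp add: chart1_def)
  then have "\<omega>2 X2 = \<eta>2 X2" using T1_values(2)[OF fr T(1)] T1_values(2)[OF fr T(2)] by simp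
  with eq have "(\<omega>, \<omega>1, \<omega>2) = (\<eta>, \<eta>1, \<eta>2)"
    using T2_values(3)[OF fr subsetD[OF T1_subset_T2 T(1)]] T2_values(3)[OF fr subsetD[OF T1_subset_T2 T(2)]]
    by simp
  then show "p = q" using xy p q by simp
qed

section \<open>Transition maps and the two atlases\<close>

lemma open_punctured: "open (- {0 :: real})" "open ((- {0 :: real}) \<times> (- {0 :: real}))"
  by (auto intro!: open_Times)

lemma T2_scale:
  assumes q: "(x, \<omega>, \<omega>1, \<omega>2) \<in> T2" and v: "v \<in> tangent_space A x"
  shows "\<omega>1 (vscale g v) = g * \<omega>1 v" "\<omega>2 (vscale g v) = g * \<omega>2 v"
  using cotangentD(2)[OF T2_cotangent(2)[OF q] v] cotangentD(2)[OF T2_cotangent(3)[OF q] v] by simp_all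

text \<open>Formulated for coframes of \<open>Y2\<close>, because the first fibre coordinate
  transforms in the same way in both bundles. The formula serves both atlases, the inclusion and the
  retraction.\<close>

lemma smooth_transition1:
  assumes c: "chart1_data U \<phi> W X1" and c': "(V, \<psi>) \<in> A" "W' \<subseteq> V" "openin (mtop A) W'" "local_section A E1 W' X1'"
  obtains g where "smooth_on (\<phi> ` (W \<inter> W') \<times> (- {0})) (\<lambda>p. ((\<psi> \<circ> inv_into U \<phi>) (fst p), g (fst p) * snd p))"
    "smooth_on (\<phi> ` (W \<inter> W')) g"
    "\<forall>x \<omega> \<omega>1 \<omega>2. (x, \<omega>, \<omega>1, \<omega>2) \<in> T2 \<longrightarrow> x \<in> W \<inter> W' \<longrightarrow>
      \<psi> x = (\<psi> \<circ> inv_into U \<phi>) (\<phi> x) \<and> \<omega>1 (X1' x) = g (\<phi> x) * \<omega>1 (X1 x)"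
proof -
  have d: "(U, \<phi>) \<in> A" "W \<subseteq> U" "openin (mtop A) W" "local_section A E1 W X1"
    using c by (auto simp: chart1_data_def)
  note bt = base_transition[OF d(1) c'(1) d(3,2) c'(3,2)]
  obtain g where g: "smooth_on (\<phi> ` (W \<inter> W')) g"
    "\<forall>p\<in>W \<inter> W'. X1' p = vscale (g (\<phi> p)) (X1 p)"
    by (rule section_ratio_within[OF line_subbundles(1) d(4) c'(4) d(3,2) c'(3) d(1)]) blast
  have "smooth_on (\<phi> ` (W \<inter> W') \<times> (- {0})) (\<lambda>p. ((\<psi> \<circ> inv_into U \<phi>) (fst p), g (fst p) * snd p))"
    by (intro smooth_on_Pair smooth_on_mult smooth_on_fst_compose open_Times
        smooth_on_snd_compose[OF _ _ bounded_linear_ident] bt g(1) open_punctured)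
  moreover have "\<psi> x = (\<psi> \<circ> inv_into U \<phi>) (\<phi> x) \<and> \<omega>1 (X1' x) = g (\<phi> x) * \<omega>1 (X1 x)"
    if q: "(x, \<omega>, \<omega>1, \<omega>2) \<in> T2" "x \<in> W \<inter> W'" for x \<omega> \<omega>1 \<omega>2
  proof
    show "\<psi> x = (\<psi> \<circ> inv_into U \<phi>) (\<phi> x)" using q(2) d(1,2) atlas by auto
    show "\<omega>1 (X1' x) = g (\<phi> x) * \<omega>1 (X1 x)"
      unfolding bspec[OF g(2) q(2)]
      using q(2) by (intro T2_scale(1)[OF q(1)] section_tangent[OF line_subbundles(1) d(3,4)]) auto
  qed
  ultimately show ?thesis using that g by blast
qed

lemma smooth_atlas_B1: "smooth_atlas B1"
proof (rule smooth_atlasI)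
  fix P \<kappa> assume "(P, \<kappa>) \<in> B1"
  then show "inj_on \<kappa> P" by (auto elim!: B1E intro: chart1_inj)
next
  fix P \<kappa> P' \<kappa>' assume P: "(P, \<kappa>) \<in> B1" "(P', \<kappa>') \<in> B1"
  obtain U \<phi> W X1 where c: "chart1_data U \<phi> W X1" "P = {q \<in> T1. fst q \<in> W}" "\<kappa> = chart1 \<phi> X1"
    using B1E[OF P(1)] .
  obtain V \<psi> W' X1' where c': "chart1_data V \<psi> W' X1'" "P' = {q \<in> T1. fst q \<in> W'}" "\<kappa>' = chart1 \<psi> X1'"
    using B1E[OF P(2)] .
  have d: "(U, \<phi>) \<in> A" "W \<subseteq> U" "openin (mtop A) W"
    and d': "(V, \<psi>) \<in> A" "W' \<subseteq> V" "openin (mtop A) W'" "local_section A E1 W' X1'"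
    using c c' by (auto simp: chart1_data_def)
  have im: "\<kappa> ` (P \<inter> P') = \<phi> ` (W \<inter> W') \<times> (- {0})"
  proof -
    have "P \<inter> P' = {q \<in> T1. fst q \<in> W \<inter> W'}" unfolding c c' by blast
    then show ?thesis using chart1_image[OF c(1), of "W \<inter> W'"] c(3) by simp
  qed
  obtain g where g: "smooth_on (\<phi> ` (W \<inter> W') \<times> (- {0})) (\<lambda>p. ((\<psi> \<circ> inv_into U \<phi>) (fst p), g (fst p) * snd p))"
    "\<forall>x \<omega> \<omega>1 \<omega>2. (x, \<omega>, \<omega>1, \<omega>2) \<in> T2 \<longrightarrow> x \<in> W \<inter> W' \<longrightarrow>
      \<psi> x = (\<psi> \<circ> inv_into U \<phi>) (\<phi> x) \<and> \<omega>1 (X1' x) = g (\<phi> x) * \<omega>1 (X1 x)"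
    by (rule smooth_transition1[OF c(1) d']) blast
  have "\<kappa>' q = (\<lambda>p. ((\<psi> \<circ> inv_into U \<phi>) (fst p), g (fst p) * snd p)) (\<kappa> q)" if "q \<in> P \<inter> P'" for q
    using that g(2) T1_subset_T2 unfolding c c' by (cases q) (fastforce simp: chart1_def)
  then show "open (\<kappa> ` (P \<inter> P')) \<and> (\<exists>G. smooth_on (\<kappa> ` (P \<inter> P')) G \<and> (\<forall>p\<in>P \<inter> P'. \<kappa>' p = G (\<kappa> p)))"
    unfolding im using g(1) base_transition(1)[OF d(1) d'(1) d(3,2) d'(3,2)]
    by (blast intro: open_Times open_punctured)
qed

lemma smooth_transition2:
  assumes c: "chart2_data U \<phi> W X1 X2" and c': "chart2_data V \<psi> W' X1' X2'"
  obtains g h where "smooth_on (\<phi> ` (W \<inter> W') \<times> ((- {0}) \<times> (- {0})))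
      (\<lambda>p. ((\<psi> \<circ> inv_into U \<phi>) (fst p), g (fst p) * fst (snd p), h (fst p) * snd (snd p)))"
    "\<forall>x \<omega> \<omega>1 \<omega>2. (x, \<omega>, \<omega>1, \<omega>2) \<in> T2 \<longrightarrow> x \<in> W \<inter> W' \<longrightarrow>
      \<psi> x = (\<psi> \<circ> inv_into U \<phi>) (\<phi> x) \<and> \<omega>1 (X1' x) = g (\<phi> x) * \<omega>1 (X1 x) \<and> \<omega>2 (X2' x) = h (\<phi> x) * \<omega>2 (X2 x)"
proof -
  have d: "(U, \<phi>) \<in> A" "W \<subseteq> U" "openin (mtop A) W" "local_section A E1 W X1" "local_section A E2 W X2"
    and d': "(V, \<psi>) \<in> A" "W' \<subseteq> V" "openin (mtop A) W'" "local_section A E1 W' X1'" "local_section A E2 W' X2'"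
    using c c' by (auto simp: chart2_data_def)
  note bt = base_transition[OF d(1) d'(1) d(3,2) d'(3,2)]
  have c1: "chart1_data U \<phi> W X1" using d by (simp add: chart1_data_def)
  obtain g where g: "smooth_on (\<phi> ` (W \<inter> W')) g"
    "\<forall>x \<omega> \<omega>1 \<omega>2. (x, \<omega>, \<omega>1, \<omega>2) \<in> T2 \<longrightarrow> x \<in> W \<inter> W' \<longrightarrow>
      \<psi> x = (\<psi> \<circ> inv_into U \<phi>) (\<phi> x) \<and> \<omega>1 (X1' x) = g (\<phi> x) * \<omega>1 (X1 x)"
    by (rule smooth_transition1[OF c1 d'(1-4)]) blast
  obtain h where h: "smooth_on (\<phi> ` (W \<inter> W')) h"
    "\<forall>p\<in>W \<inter> W'. X2' p = vscale (h (\<phi> p)) (X2 p)"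
    by (rule section_ratio_within[OF line_subbundles(2) d(5) d'(5) d(3,2) d'(3) d(1)]) blast
  have "smooth_on (\<phi> ` (W \<inter> W') \<times> ((- {0}) \<times> (- {0})))
      (\<lambda>p. ((\<psi> \<circ> inv_into U \<phi>) (fst p), g (fst p) * fst (snd p), h (fst p) * snd (snd p)))"
    by (intro smooth_on_Pair smooth_on_mult smooth_on_fst_compose open_Times
        smooth_on_snd_compose[OF _ _ bounded_linear_fst] smooth_on_snd_compose[OF _ _ bounded_linear_snd]
        bt g(1) h(1) open_punctured)
  moreover have "\<omega>2 (X2' x) = h (\<phi> x) * \<omega>2 (X2 x)"
    if q: "(x, \<omega>, \<omega>1, \<omega>2) \<in> T2" "x \<in> W \<inter> W'" for x \<omega> \<omega>1 \<omega>2
    unfolding bspec[OF h(2) q(2)]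
    using q(2) by (intro T2_scale(2)[OF q(1)] section_tangent[OF line_subbundles(2) d(3,5)]) auto
  ultimately show ?thesis using that g(2) by blast
qed

lemma smooth_atlas_B2: "smooth_atlas B2"
proof (rule smooth_atlasI)
  fix P \<kappa> assume "(P, \<kappa>) \<in> B2"
  then show "inj_on \<kappa> P" by (auto elim!: B2E intro: chart2_inj)
next
  fix P \<kappa> P' \<kappa>' assume P: "(P, \<kappa>) \<in> B2" "(P', \<kappa>') \<in> B2"
  obtain U \<phi> W X1 X2 where c: "chart2_data U \<phi> W X1 X2" "P = {q \<in> T2. fst q \<in> W}" "\<kappa> = chart2 \<phi> X1 X2"
    using B2E[OF P(1)] .
  obtain V \<psi> W' X1' X2' where c': "chart2_data V \<psi> W' X1' X2'" "P' = {q \<in> T2. fst q \<in> W'}" "\<kappa>' = chart2 \<psi> X1' X2'"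
    using B2E[OF P(2)] .
  have d: "(U, \<phi>) \<in> A" "W \<subseteq> U" "openin (mtop A) W"
    and d': "(V, \<psi>) \<in> A" "W' \<subseteq> V" "openin (mtop A) W'"
    using c c' by (auto simp: chart2_data_def)
  have im: "\<kappa> ` (P \<inter> P') = \<phi> ` (W \<inter> W') \<times> ((- {0}) \<times> (- {0}))"
  proof -
    have "P \<inter> P' = {q \<in> T2. fst q \<in> W \<inter> W'}" unfolding c c' by blast
    then show ?thesis using chart2_image[OF c(1), of "W \<inter> W'"] c(3) by simp
  qed
  obtain g h where g: "smooth_on (\<phi> ` (W \<inter> W') \<times> ((- {0}) \<times> (- {0})))
      (\<lambda>p. ((\<psi> \<circ> inv_into U \<phi>) (fst p), g (fst p) * fst (snd p), h (fst p) * snd (snd p)))"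
    "\<forall>x \<omega> \<omega>1 \<omega>2. (x, \<omega>, \<omega>1, \<omega>2) \<in> T2 \<longrightarrow> x \<in> W \<inter> W' \<longrightarrow>
      \<psi> x = (\<psi> \<circ> inv_into U \<phi>) (\<phi> x) \<and> \<omega>1 (X1' x) = g (\<phi> x) * \<omega>1 (X1 x) \<and> \<omega>2 (X2' x) = h (\<phi> x) * \<omega>2 (X2 x)"
    by (rule smooth_transition2[OF c(1) c'(1)]) blast
  have "\<kappa>' q = (\<lambda>p. ((\<psi> \<circ> inv_into U \<phi>) (fst p), g (fst p) * fst (snd p), h (fst p) * snd (snd p))) (\<kappa> q)"
    if "q \<in> P \<inter> P'" for q
    using that g(2) unfolding c c' by (cases q) (fastforce simp: chart2_def)
  then show "open (\<kappa> ` (P \<inter> P')) \<and> (\<exists>G. smooth_on (\<kappa> ` (P \<inter> P')) G \<and> (\<forall>p\<in>P \<inter> P'. \<kappa>' p = G (\<kappa> p)))"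
    unfolding im using g(1) base_transition(1)[OF d(1) d'(1) d(3,2) d'(3,2)]
    by (blast intro: open_Times open_punctured)
qed

lemma points_B1: "points B1 = T1"
proof (intro equalityI subsetI)
  fix q assume q: "q \<in> T1"
  obtain U \<phi> where c: "(U, \<phi>) \<in> A" "fst q \<in> U" using T1_fst[OF q] by (rule pointsE)
  obtain W X where "openin (mtop A) W" "fst q \<in> W" "W \<subseteq> U" "local_section A E1 W X"
    using local_section_exists[OF line_subbundles(1) c] by metis
  then have "({q \<in> T1. fst q \<in> W}, chart1 \<phi> X) \<in> B1" "q \<in> {q \<in> T1. fst q \<in> W}"
    using c q unfolding B1_eq chart1_data_def by blast+
  then show "q \<in> points B1" by (rule points_chart)
qed (auto elim!: pointsE B1E)

lemma chart2_around:
  assumes c: "(U, \<phi>) \<in> A" "x \<in> U"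
  obtains W X1 X2 where "chart2_data U \<phi> W X1 X2" "x \<in> W"
proof -
  obtain W X where W: "openin (mtop A) W" "x \<in> W" "W \<subseteq> U" "local_section A E1 W X"
    using local_section_exists[OF line_subbundles(1) c] by metis
  obtain W' X' where W': "openin (mtop A) W'" "x \<in> W'" "W' \<subseteq> U" "local_section A E2 W' X'"
    using local_section_exists[OF line_subbundles(2) c] by metis
  have "local_section A E1 (W \<inter> W') X" "local_section A E2 (W \<inter> W') X'"
    using local_section_subset[OF W(4)] local_section_subset[OF W'(4)] by blast+
  then have "chart2_data U \<phi> (W \<inter> W') X X'"
    using W W' c unfolding chart2_data_def by blast
  then show ?thesis using that W(2) W'(2) by blast
qed

lemma points_B2: "points B2 = T2"
proof (intro equalityI subsetI)
  fix q assume q: "q \<in> T2"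
  obtain U \<phi> where c: "(U, \<phi>) \<in> A" "fst q \<in> U" using T2_fst[OF q] by (rule pointsE)
  obtain W X1 X2 where "chart2_data U \<phi> W X1 X2" "fst q \<in> W" using chart2_around[OF c] .
  then have "({q \<in> T2. fst q \<in> W}, chart2 \<phi> X1 X2) \<in> B2" "q \<in> {q \<in> T2. fst q \<in> W}"
    using q unfolding B2_eq by blast+
  then show "q \<in> points B2" by (rule points_chart)
qed (auto elim!: pointsE B2E)

end

subsection \<open>Maps between the bundles\<close>

text \<open>Retraction after inclusion is the identity only on the bundle itself; tangent vectors do
  not see the difference.\<close>

lemma tangent_map_cong:
  assumes "smooth_atlas A" "v \<in> tangent_space A p" "\<And>x. x \<in> points A \<Longrightarrow> F x = G x"
  shows "tangent_map B F p v = tangent_map B G p v"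
proof -
  have "F p = G p" using assms(2,3) tangent_space_points by metis
  moreover have "v (g \<circ> F) = v (g \<circ> G)" for g
    by (rule tangent_vec_cong[OF assms(1,2)]) (simp add: assms(3))
  ultimately show ?thesis by (auto simp: tangent_map_def)
qed

text \<open>A bundle chart lies over a base chart, and in this pair of charts the projection is the
  linear map \<open>fst\<close>.\<close>

lemma tangent_map_fst_chart:
  fixes A :: "('a, 'e::euclidean_space) chart set" and B :: "('a \<times> 'b, 'e \<times> 'g::euclidean_space) chart set"
  assumes A: "smooth_atlas A" and B: "smooth_atlas B" and fst: "smooth_map B A fst"
    and P: "(P, \<kappa>) \<in> B" "q \<in> P" and c: "(U, \<phi>) \<in> A"
    and P\<kappa>: "\<And>p. p \<in> P \<Longrightarrow> fst p \<in> U \<and> fst (\<kappa> p) = \<phi> (fst p)"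
  shows "tangent_map A fst q (chart_vec B (P, \<kappa>) q h) = chart_vec A (U, \<phi>) (fst q) (fst h)"
proof -
  have "(fst has_derivative fst) (at (\<kappa> q))" by (intro derivative_eq_intros) auto
  then have "(\<phi> \<circ> fst \<circ> inv_into P \<kappa> has_derivative fst) (at (\<kappa> q))"
    by (rule has_derivative_transform_within_open[OF _ smooth_atlas_chart(2)[OF B P(1)]])
      (use P B P\<kappa> in auto)
  from frechet_derivative_at[OF this, symmetric] show ?thesis
    using tangent_map_chart_vec[OF B A fst P c] P\<kappa>[OF P(2)] by simp
qed

context strict_path
begin

section \<open>Projections, inclusion and retraction\<close>

lemma fst_chart [simp]: "fst (chart1 \<phi> X1 p) = \<phi> (fst p)" "fst (chart2 \<phi> X1 X2 p) = \<phi> (fst p)"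
  by (simp_all add: chart1_def chart2_def case_prod_beta)

lemma smooth_map_fst1: "smooth_map B1 A fst"
proof (rule smooth_mapI[OF smooth_atlas_B1 atlas])
  fix P \<kappa> V \<psi> assume P: "(P, \<kappa>) \<in> B1" and c': "(V, \<psi>) \<in> A"
  obtain U \<phi> W X1 where c: "chart1_data U \<phi> W X1" "P = {q \<in> T1. fst q \<in> W}" "\<kappa> = chart1 \<phi> X1"
    using B1E[OF P] .
  have d: "(U, \<phi>) \<in> A" "W \<subseteq> U" "openin (mtop A) W" using c by (auto simp: chart1_data_def)
  note bt = base_transition[OF d(1) c' d(3,2) openin_chart[OF atlas c'] subset_refl]
  have im: "\<kappa> ` (P \<inter> fst -` V) = \<phi> ` (W \<inter> V) \<times> (- {0})"
  proof -
    have "P \<inter> fst -` V = {q \<in> T1. fst q \<in> W \<inter> V}" unfolding c by blast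
    then show ?thesis using chart1_image[OF c(1), of "W \<inter> V"] c(3) by simp
  qed
  have "smooth_on (\<phi> ` (W \<inter> V) \<times> (- {0 :: real})) (\<lambda>p. (\<psi> \<circ> inv_into U \<phi>) (fst p))"
    by (intro smooth_on_fst_compose bt open_punctured)
  moreover have "\<forall>p\<in>P \<inter> fst -` V. \<psi> (fst p) = (\<psi> \<circ> inv_into U \<phi>) (fst (\<kappa> p))"
    using d atlas unfolding c by (auto simp: chart1_def)
  ultimately show "open (\<kappa> ` (P \<inter> fst -` V)) \<and> (\<exists>G. smooth_on (\<kappa> ` (P \<inter> fst -` V)) G \<and>
      (\<forall>p\<in>P \<inter> fst -` V. \<psi> (fst p) = G (\<kappa> p)))"
    unfolding im using bt(1) by (blast intro: open_Times open_punctured)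
qed (simp add: points_B1 T1_fst)

lemma smooth_map_fst2: "smooth_map B2 A fst"
proof (rule smooth_mapI[OF smooth_atlas_B2 atlas])
  fix P \<kappa> V \<psi> assume P: "(P, \<kappa>) \<in> B2" and c': "(V, \<psi>) \<in> A"
  obtain U \<phi> W X1 X2 where c: "chart2_data U \<phi> W X1 X2" "P = {q \<in> T2. fst q \<in> W}" "\<kappa> = chart2 \<phi> X1 X2"
    using B2E[OF P] .
  have d: "(U, \<phi>) \<in> A" "W \<subseteq> U" "openin (mtop A) W" using c by (auto simp: chart2_data_def)
  note bt = base_transition[OF d(1) c' d(3,2) openin_chart[OF atlas c'] subset_refl]
  have im: "\<kappa> ` (P \<inter> fst -` V) = \<phi> ` (W \<inter> V) \<times> ((- {0}) \<times> (- {0}))"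
  proof -
    have "P \<inter> fst -` V = {q \<in> T2. fst q \<in> W \<inter> V}" unfolding c by blast
    then show ?thesis using chart2_image[OF c(1), of "W \<inter> V"] c(3) by simp
  qed
  have "smooth_on (\<phi> ` (W \<inter> V) \<times> ((- {0 :: real}) \<times> (- {0 :: real}))) (\<lambda>p. (\<psi> \<circ> inv_into U \<phi>) (fst p))"
    by (intro smooth_on_fst_compose bt open_punctured)
  moreover have "\<forall>p\<in>P \<inter> fst -` V. \<psi> (fst p) = (\<psi> \<circ> inv_into U \<phi>) (fst (\<kappa> p))"
    using d atlas unfolding c by (auto simp: chart2_def)
  ultimately show "open (\<kappa> ` (P \<inter> fst -` V)) \<and> (\<exists>G. smooth_on (\<kappa> ` (P \<inter> fst -` V)) G \<and>
      (\<forall>p\<in>P \<inter> fst -` V. \<psi> (fst p) = G (\<kappa> p)))"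
    unfolding im using bt(1) by (blast intro: open_Times open_punctured)
qed (simp add: points_B2 T2_fst)

text \<open>Restricted so as to be \<open>undefined\<close> off \<open>Y1\<close>, as
  \<open>extensional\<close> demands.\<close>

definition \<iota> :: "'a \<times> 'a coframe \<Rightarrow> 'a \<times> 'a coframe" where
  "\<iota> = restrict id T1"

lemma \<iota>_T1 [simp]: "q \<in> T1 \<Longrightarrow> \<iota> q = q"
  by (simp add: \<iota>_def)

lemma smooth_map_\<iota>: "smooth_map B1 B2 \<iota>"
proof (rule smooth_mapI[OF smooth_atlas_B1 smooth_atlas_B2])
  fix P \<kappa> P' \<kappa>' assume P: "(P, \<kappa>) \<in> B1" and P': "(P', \<kappa>') \<in> B2"
  obtain U \<phi> W X1 where c: "chart1_data U \<phi> W X1" "P = {q \<in> T1. fst q \<in> W}" "\<kappa> = chart1 \<phi> X1"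
    using B1E[OF P] .
  obtain V \<psi> W' X1' X2' where c': "chart2_data V \<psi> W' X1' X2'" "P' = {q \<in> T2. fst q \<in> W'}" "\<kappa>' = chart2 \<psi> X1' X2'"
    using B2E[OF P'] .
  have d: "(U, \<phi>) \<in> A" "W \<subseteq> U" "openin (mtop A) W" "local_section A E1 W X1"
    and d': "(V, \<psi>) \<in> A" "W' \<subseteq> V" "openin (mtop A) W'" "local_section A E1 W' X1'" "local_section A E2 W' X2'"
    using c c' by (auto simp: chart1_data_def chart2_data_def)
  note bt = base_transition[OF d(1) d'(1) d(3,2) d'(3,2)]
  have dom: "P \<inter> \<iota> -` P' = {q \<in> T1. fst q \<in> W \<inter> W'}"
    using T1_subset_T2 unfolding c c' by auto
  have im: "\<kappa> ` (P \<inter> \<iota> -` P') = \<phi> ` (W \<inter> W') \<times> (- {0})"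
    using chart1_image[OF c(1), of "W \<inter> W'"] c(3) dom by simp
  obtain g where g: "smooth_on (\<phi> ` (W \<inter> W')) g"
    "\<forall>x \<omega> \<omega>1 \<omega>2. (x, \<omega>, \<omega>1, \<omega>2) \<in> T2 \<longrightarrow> x \<in> W \<inter> W' \<longrightarrow>
      \<psi> x = (\<psi> \<circ> inv_into U \<phi>) (\<phi> x) \<and> \<omega>1 (X1' x) = g (\<phi> x) * \<omega>1 (X1 x)"
    by (rule smooth_transition1[OF c(1) d'(1-4)]) blast
  \<comment> \<open>\<open>X1\<close> comes from the chart of \<open>Y1\<close>, \<open>X2'\<close>
    from the chart of \<open>Y2\<close>; in this mixed frame the second fibre coordinate is
    \<open>k\<close> divided by the first.\<close>
  obtain k where k: "smooth_on (\<phi> ` (W \<inter> W')) k" "\<And>p. p \<in> W \<inter> W' \<Longrightarrow> d\<theta> p (X1 p) (X2' p) = k (\<phi> p)"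
    by (rule dtheta_sections[OF d(1,4) d'(5) d(3,2) d'(3)]) blast
  let ?G = "\<lambda>p. ((\<psi> \<circ> inv_into U \<phi>) (fst p), g (fst p) * snd p, k (fst p) / snd p)"
  have "smooth_on (\<phi> ` (W \<inter> W') \<times> (- {0})) ?G"
    by (intro smooth_on_Pair smooth_on_mult smooth_on_divide smooth_on_fst_compose open_Times
        smooth_on_snd_compose[OF _ _ bounded_linear_ident] bt g(1) k(1) open_punctured) auto
  moreover have "\<kappa>' (\<iota> q) = ?G (\<kappa> q)" if "q \<in> P \<inter> \<iota> -` P'" for q
  proof -
    obtain x \<omega> \<omega>1 \<omega>2 where q: "q = (x, \<omega>, \<omega>1, \<omega>2)" by (metis prod_cases4)
    have x: "(x, \<omega>, \<omega>1, \<omega>2) \<in> T1" "x \<in> W" "x \<in> W'" using that unfolding dom q by auto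
    have fr: "adapted_frame x (X1 x) (X2' x)"
      using section_adapted(1)[OF d(3) x(2) d(4) d'(5) x(3)] .
    show ?thesis
      using T1_values(2)[OF fr x(1)] k(2)[of x] g(2)[rule_format, OF subsetD[OF T1_subset_T2 x(1)]] x
      unfolding q c c' by (simp add: chart1_def chart2_def)
  qed
  ultimately show "open (\<kappa> ` (P \<inter> \<iota> -` P')) \<and> (\<exists>G. smooth_on (\<kappa> ` (P \<inter> \<iota> -` P')) G \<and>
      (\<forall>p\<in>P \<inter> \<iota> -` P'. \<kappa>' (\<iota> p) = G (\<kappa> p)))"
    unfolding im using bt(1) by (blast intro: open_Times open_punctured)
qed (use T1_subset_T2 in \<open>auto simp: points_B1 points_B2\<close>)

text \<open>Writing \<open>\<delta>\<close> for \<open>d\<theta>(X1, X2)\<close>, the number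
  \<open>\<omega>(R) = a1 * a2 / \<delta>\<close> has to become 1. Here \<open>\<omega>1\<close> is
  kept and \<open>\<omega>2\<close> is divided by it, so \<open>a2\<close> turns into
  \<open>\<delta> / a1\<close>; over one base frame the map merely forgets
  \<open>a2\<close>.\<close>

definition retr :: "'a \<times> 'a coframe \<Rightarrow> 'a \<times> 'a coframe" where
  "retr = (\<lambda>(x, \<omega>, \<omega>1, \<omega>2). (x, \<theta> x, \<omega>1, (\<lambda>v. \<omega>2 v / \<omega> (reeb A \<theta> x))))"

lemma fst_retr [simp]: "fst (retr q) = fst q"
  by (simp add: retr_def case_prod_beta)

lemma retr_T1:
  assumes q: "q \<in> T2"
  shows "retr q \<in> T1"
proof -
  obtain x \<omega> \<omega>1 \<omega>2 where x: "q = (x, \<omega>, \<omega>1, \<omega>2)" by (metis prod_cases4)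
  obtain X1 X2 where fr: "adapted_frame x X1 X2"
    using adapted_frame_exists T2_fst[OF q] x by auto
  let ?a1 = "\<omega>1 X1" and ?a2 = "\<omega>2 X2" and ?d = "d\<theta> x X1 X2"
  note \<Omega> = T2_values[OF fr q[unfolded x]]
  have \<omega>: "\<omega>1 = (\<lambda>v. ?a1 * z1 x X1 X2 v)" "\<omega>2 = (\<lambda>v. ?a2 * z2 x X1 X2 v)"
    using \<Omega>(3) unfolding coframe_def by (simp_all only: prod.inject)
  have R: "\<omega> (reeb A \<theta> x) = ?a1 * ?a2 / ?d" using coframe_values(3)[OF fr \<Omega>(3)] .
  have "\<omega>2 v / \<omega> (reeb A \<theta> x) = ?d / ?a1 * z2 x X1 X2 v" for v
    using \<Omega>(1,2) fun_cong[OF \<omega>(2), of v] dtheta_frame[OF fr] unfolding R by (simp add: field_simps)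
  then have "retr q = (x, coframe x X1 X2 ?a1 (?d / ?a1))"
    using \<omega>(1) \<Omega>(1) dtheta_frame[OF fr] unfolding x retr_def coframe_def by simp
  then show ?thesis using \<Omega>(1) T1_iff[OF fr] by auto
qed

lemma retr_id:
  assumes q: "q \<in> T1"
  shows "retr q = q"
proof -
  obtain x \<omega> \<omega>1 \<omega>2 where x: "q = (x, \<omega>, \<omega>1, \<omega>2)" by (metis prod_cases4)
  obtain X1 X2 where fr: "adapted_frame x X1 X2"
    using adapted_frame_exists T1_fst[OF q] x by auto
  show ?thesis
    using T1_values(1)[OF fr q[unfolded x]] reeb_theta[OF fr] unfolding x retr_def by simp
qed

lemma smooth_map_retr: "smooth_map B2 B1 retr"
proof (rule smooth_mapI[OF smooth_atlas_B2 smooth_atlas_B1])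
  fix P \<kappa> P' \<kappa>' assume P: "(P, \<kappa>) \<in> B2" and P': "(P', \<kappa>') \<in> B1"
  obtain U \<phi> W X1 X2 where c: "chart2_data U \<phi> W X1 X2" "P = {q \<in> T2. fst q \<in> W}" "\<kappa> = chart2 \<phi> X1 X2"
    using B2E[OF P] .
  obtain V \<psi> W' X1' where c': "chart1_data V \<psi> W' X1'" "P' = {q \<in> T1. fst q \<in> W'}" "\<kappa>' = chart1 \<psi> X1'"
    using B1E[OF P'] .
  have d: "(U, \<phi>) \<in> A" "W \<subseteq> U" "openin (mtop A) W"
    and d': "(V, \<psi>) \<in> A" "W' \<subseteq> V" "openin (mtop A) W'" "local_section A E1 W' X1'"
    and c1: "chart1_data U \<phi> W X1"
    using c c' by (auto simp: chart1_data_def chart2_data_def)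
  note bt = base_transition[OF d(1) d'(1) d(3,2) d'(3,2)]
  have dom: "P \<inter> retr -` P' = {q \<in> T2. fst q \<in> W \<inter> W'}"
    using retr_T1 unfolding c c' by auto
  have im: "\<kappa> ` (P \<inter> retr -` P') = \<phi> ` (W \<inter> W') \<times> ((- {0}) \<times> (- {0}))"
    using chart2_image[OF c(1), of "W \<inter> W'"] c(3) dom by simp
  obtain g where g: "smooth_on (\<phi> ` (W \<inter> W')) g"
    "\<forall>x \<omega> \<omega>1 \<omega>2. (x, \<omega>, \<omega>1, \<omega>2) \<in> T2 \<longrightarrow> x \<in> W \<inter> W' \<longrightarrow>
      \<psi> x = (\<psi> \<circ> inv_into U \<phi>) (\<phi> x) \<and> \<omega>1 (X1' x) = g (\<phi> x) * \<omega>1 (X1 x)"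
    by (rule smooth_transition1[OF c1 d'(1-4)]) blast
  let ?G = "\<lambda>p. ((\<psi> \<circ> inv_into U \<phi>) (fst p), g (fst p) * fst (snd p))"
  have "smooth_on (\<phi> ` (W \<inter> W') \<times> ((- {0 :: real}) \<times> (- {0 :: real}))) ?G"
    by (intro smooth_on_Pair smooth_on_mult smooth_on_fst_compose open_Times
        smooth_on_snd_compose[OF _ _ bounded_linear_fst] bt g(1) open_punctured)
  moreover have "\<kappa>' (retr q) = ?G (\<kappa> q)" if "q \<in> P \<inter> retr -` P'" for q
  proof -
    obtain x \<omega> \<omega>1 \<omega>2 where q: "q = (x, \<omega>, \<omega>1, \<omega>2)" by (metis prod_cases4)
    have x: "(x, \<omega>, \<omega>1, \<omega>2) \<in> T2" "x \<in> W \<inter> W'" using that unfolding dom q by auto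
    show ?thesis
      using g(2) x unfolding q c c' by (auto simp: chart1_def chart2_def retr_def)
  qed
  ultimately show "open (\<kappa> ` (P \<inter> retr -` P')) \<and> (\<exists>G. smooth_on (\<kappa> ` (P \<inter> retr -` P')) G \<and>
      (\<forall>p\<in>P \<inter> retr -` P'. \<kappa>' (retr p) = G (\<kappa> p)))"
    unfolding im using bt(1) by (blast intro: open_Times open_punctured)
qed (simp add: points_B1 points_B2 retr_T1)

lemma smooth_embedding_\<iota>: "smooth_embedding B1 B2 \<iota>"
  unfolding smooth_embedding_def
proof (intro conjI ballI)
  show "smooth_map B1 B2 \<iota>" by (rule smooth_map_\<iota>)
  have left_inv: "(retr \<circ> \<iota>) q = id q" if "q \<in> points B1" for q
    using that by (simp add: points_B1 retr_id)
  show "inj_on (tangent_map B2 \<iota> p) (tangent_space B1 p)" if p: "p \<in> points B1" for p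
  \<comment> \<open>The differential of \<open>retr\<close> is a left inverse.\<close>
  proof (rule inj_on_inverseI)
    fix v assume v: "v \<in> tangent_space B1 p"
    have "tangent_map B1 retr (\<iota> p) (tangent_map B2 \<iota> p v) = tangent_map B1 (retr \<circ> \<iota>) p v"
      by (rule tangent_map_compose[OF smooth_atlas_B2 smooth_atlas_B1 smooth_map_retr])
        (use p smooth_mapD(1)[OF smooth_atlas_B1 smooth_atlas_B2 smooth_map_\<iota>] in blast)
    also have "\<dots> = tangent_map B1 id p v"
      by (rule tangent_map_cong[OF smooth_atlas_B1 v left_inv])
    finally show "tangent_map B1 retr (\<iota> p) (tangent_map B2 \<iota> p v) = v"
      using tangent_map_id[OF v] by simp
  qed
  \<comment> \<open>A continuous map with a continuous left inverse is a homeomorphism onto its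
    image.\<close>
  have "retraction_maps (mtop B2) (mtop B1) retr \<iota>"
    using smooth_map_\<iota> smooth_map_retr left_inv smooth_atlas_B1
    by (simp add: retraction_maps_def smooth_map_def)
  then show "embedding_map (mtop B1) (mtop B2) \<iota>"
    by (intro section_imp_embedding_map) (auto simp: section_map_def)
qed

section \<open>Pullbacks of the tautological forms\<close>

lemma tangent_map_fst_embedding:
  assumes F: "smooth_map B1 B2 F" and fst: "\<And>q. q \<in> points B1 \<Longrightarrow> fst (F q) = fst q"
    and v: "v \<in> tangent_space B1 q"
  shows "tangent_map A fst (F q) (tangent_map B2 F q v) = tangent_map A fst q v"
proof -
  have q: "q \<in> points B1" using v by (rule tangent_space_points)
  have "tangent_map A fst (F q) (tangent_map B2 F q v) = tangent_map A (fst \<circ> F) q v"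
    by (rule tangent_map_compose[OF smooth_atlas_B2 atlas smooth_map_fst2])
      (rule smooth_mapD(1)[OF smooth_atlas_B1 smooth_atlas_B2 F q])
  also have "\<dots> = tangent_map A fst q v"
    by (rule tangent_map_cong[OF smooth_atlas_B1 v]) (simp add: fst)
  finally show ?thesis .
qed

text \<open>A map over the identity preserves the projection of a tangent vector; what changes is
  the coframe evaluated on it.\<close>

lemma pullback_taut:
  assumes "smooth_map B1 B2 F" "\<And>q. q \<in> points B1 \<Longrightarrow> fst (F q) = fst q" "v \<in> tangent_space B1 q"
    and Fq: "F q = (x, \<omega>, \<omega>1, \<omega>2)"
  shows "pullback B2 F (taut A) q v = \<omega> (tangent_map A fst q v)"
    and "pullback B2 F (taut1 A) q v = \<omega>1 (tangent_map A fst q v)"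
    and "pullback B2 F (taut2 A) q v = \<omega>2 (tangent_map A fst q v)"
  using tangent_map_fst_embedding[OF assms(1-3)] Fq
  by (simp_all add: pullback_def taut_def taut1_def taut2_def)

lemma form_eq_taut_\<iota>:
  "form_eq B1 (pullback B2 \<iota> (taut A)) (taut A)"
  "form_eq B1 (pullback B2 \<iota> (taut1 A)) (taut1 A)"
  "form_eq B1 (pullback B2 \<iota> (taut2 A)) (taut2 A)"
proof -
  have *: "pullback B2 \<iota> (taut A) q v = taut A q v \<and> pullback B2 \<iota> (taut1 A) q v = taut1 A q v \<and>
    pullback B2 \<iota> (taut2 A) q v = taut2 A q v" if v: "v \<in> tangent_space B1 q" for q v
  proof -
    obtain x \<omega> \<omega>1 \<omega>2 where q: "q = (x, \<omega>, \<omega>1, \<omega>2)" by (metis prod_cases4)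
    have "q \<in> T1" using tangent_space_points[OF v] points_B1 by simp
    then have "\<iota> q = (x, \<omega>, \<omega>1, \<omega>2)" using q by simp
    from pullback_taut[OF smooth_map_\<iota> _ v this] show ?thesis
      by (simp add: points_B1 q taut_def taut1_def taut2_def)
  qed
  show "form_eq B1 (pullback B2 \<iota> (taut A)) (taut A)"
    "form_eq B1 (pullback B2 \<iota> (taut1 A)) (taut1 A)"
    "form_eq B1 (pullback B2 \<iota> (taut2 A)) (taut2 A)"
    using * by (simp_all add: form_eq_def)
qed

lemma tautological_embedding_\<iota>: "tautological_embedding A B1 B2 \<iota>"
  using smooth_embedding_\<iota> form_eq_taut_\<iota>
  by (simp add: tautological_embedding_def points_B1 \<iota>_def)

section \<open>Uniqueness of the embedding\<close>

lemma B1_chart_around: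
  assumes "q \<in> T1"
  obtains P U \<phi> W X1 where "(P, chart1 \<phi> X1) \<in> B1" "q \<in> P" "chart1_data U \<phi> W X1" "P = {q \<in> T1. fst q \<in> W}"
proof -
  obtain P \<kappa> where P: "(P, \<kappa>) \<in> B1" "q \<in> P" using assms points_B1 by (metis pointsE)
  obtain U \<phi> W X1 where c: "chart1_data U \<phi> W X1" "P = {q \<in> T1. fst q \<in> W}" "\<kappa> = chart1 \<phi> X1"
    using B1E[OF P(1)] .
  show ?thesis by (rule that[OF P(1)[unfolded c(3)] P(2) c(1,2)])
qed

text \<open>Tautological forms see a vector only through its projection, so recovering a coframe
  from them requires that every vector of the base lifts. In a chart the lift has fibre component
  0.\<close>

lemma tangent_map_fst_surj:
  assumes q: "q \<in> T1" and u: "u \<in> tangent_space A (fst q)"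
  obtains v where "v \<in> tangent_space B1 q" "tangent_map A fst q v = u"
proof -
  obtain P U \<phi> W X1 where P: "(P, chart1 \<phi> X1) \<in> B1" "q \<in> P" and c: "chart1_data U \<phi> W X1"
    and P_eq: "P = {q \<in> T1. fst q \<in> W}"
    using B1_chart_around[OF q] .
  have d: "(U, \<phi>) \<in> A" "W \<subseteq> U" using c by (auto simp: chart1_data_def)
  have P\<kappa>: "fst p \<in> U \<and> fst (chart1 \<phi> X1 p) = \<phi> (fst p)" if "p \<in> P" for p
    using that d P_eq by auto
  obtain h where "u = chart_vec A (U, \<phi>) (fst q) h"
    using tangent_spaceE[OF atlas d(1) _ u] P\<kappa>[OF P(2)] by metis
  then have "tangent_map A fst q (chart_vec B1 (P, chart1 \<phi> X1) q (h, 0)) = u"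
    using tangent_map_fst_chart[OF atlas smooth_atlas_B1 smooth_map_fst1 P d(1) P\<kappa>] by simp
  then show ?thesis using that chart_vec_in_tangent_space[OF P] by blast
qed

lemma tautological_embedding_unique:
  assumes F: "tautological_embedding A B1 B2 F"
  shows "F = \<iota>"
proof
  fix q
  have sm: "smooth_map B1 B2 F" and fst: "\<And>q. q \<in> points B1 \<Longrightarrow> fst (F q) = fst q"
    and eq: "form_eq B1 (pullback B2 F (taut A)) (taut A)"
      "form_eq B1 (pullback B2 F (taut1 A)) (taut1 A)"
      "form_eq B1 (pullback B2 F (taut2 A)) (taut2 A)"
    using F unfolding tautological_embedding_def smooth_embedding_def by blast+
  show "F q = \<iota> q"
  proof (cases "q \<in> T1")
    case True
    obtain x \<omega> \<omega>1 \<omega>2 where q: "q = (x, \<omega>, \<omega>1, \<omega>2)" by (metis prod_cases4)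
    have "fst (F q) = x" using fst[of q] True points_B1 q by simp
    then obtain \<eta> \<eta>1 \<eta>2 where Fq: "F q = (x, \<eta>, \<eta>1, \<eta>2)" by (metis prod_cases4 fst_conv)
    have "F q \<in> T2"
      using smooth_mapD(1)[OF smooth_atlas_B1 smooth_atlas_B2 sm, of q] True by (simp add: points_B1 points_B2)
    then have cot': "\<eta> \<in> cotangent_space A x" "\<eta>1 \<in> cotangent_space A x" "\<eta>2 \<in> cotangent_space A x"
      using T2_cotangent[of x \<eta> \<eta>1 \<eta>2] Fq by simp_all
    have cot: "\<omega> \<in> cotangent_space A x" "\<omega>1 \<in> cotangent_space A x" "\<omega>2 \<in> cotangent_space A x"
      using T2_cotangent[of x \<omega> \<omega>1 \<omega>2] True T1_subset_T2 q by auto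
    have "\<eta> u = \<omega> u \<and> \<eta>1 u = \<omega>1 u \<and> \<eta>2 u = \<omega>2 u" for u
    proof (cases "u \<in> tangent_space A x")
      case u: True
      obtain v where v: "v \<in> tangent_space B1 q" "tangent_map A fst q v = u"
        using tangent_map_fst_surj[OF True] u q by auto
      then show ?thesis
        using pullback_taut[OF sm fst v(1) Fq] eq tangent_space_points[OF v(1)]
        by (simp add: form_eq_def taut_def taut1_def taut2_def q)
    next
      \<comment> \<open>The members of both coframes vanish off the tangent space, so agreement on
        it is equality of HOL functions.\<close>
      case False
      then show ?thesis using cotangentD(3) cot cot' by metis
    qed
    then have "\<eta> = \<omega>" "\<eta>1 = \<omega>1" "\<eta>2 = \<omega>2" by auto
    then show ?thesis using True Fq q by simp
  next
    case False
    have "F \<in> extensional T1"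
      using F by (simp add: tautological_embedding_def points_B1)
    from extensional_arb[OF this False] show ?thesis
      using False by (simp add: \<iota>_def)
  qed
qed

subsection \<open>Connection forms\<close>

text \<open>In a chart of \<open>Y2\<close> with frame \<open>X1\<close>, \<open>X2\<close>, fibre
  coordinates \<open>a1\<close>, \<open>a2\<close> and \<open>\<delta> = d\<theta>(X1, X2)\<close>,
  the coefficients along a direction with base part \<open>h\<close> are
  \<open>a1 * a2 / \<delta> * \<theta>(h)\<close>, \<open>a1 * d\<theta>(h, X2) / \<delta>\<close>
  and \<open>a2 * d\<theta>(X1, h) / \<delta>\<close>. All ingredients are smooth, and
  \<open>\<delta>\<close> has no zeros.\<close>

lemma C1_taut:
  assumes q: "q \<in> T2"
  shows "C1_form_at B2 q (taut A)" "C1_form_at B2 q (taut1 A)" "C1_form_at B2 q (taut2 A)"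
proof -
  have *: "(\<forall>p\<in>P. linear (\<lambda>h. taut A p (chart_vec B2 (P, \<kappa>) p h)) \<and>
      linear (\<lambda>h. taut1 A p (chart_vec B2 (P, \<kappa>) p h)) \<and>
      linear (\<lambda>h. taut2 A p (chart_vec B2 (P, \<kappa>) p h))) \<and>
    (\<forall>h. smooth_on (\<kappa> ` P) (form_coeff B2 (P, \<kappa>) (taut A) h) \<and>
      smooth_on (\<kappa> ` P) (form_coeff B2 (P, \<kappa>) (taut1 A) h) \<and>
      smooth_on (\<kappa> ` P) (form_coeff B2 (P, \<kappa>) (taut2 A) h))"
    if P: "(P, \<kappa>) \<in> B2" for P \<kappa>
  proof -
    obtain U \<phi> W X1 X2 where c: "chart2_data U \<phi> W X1 X2" "P = {q \<in> T2. fst q \<in> W}" "\<kappa> = chart2 \<phi> X1 X2"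
      using B2E[OF P] .
    have d: "(U, \<phi>) \<in> A" "W \<subseteq> U" "openin (mtop A) W" "local_section A E1 W X1" "local_section A E2 W X2"
      using c by (auto simp: chart2_data_def)
    have P\<kappa>: "fst p \<in> U \<and> fst (\<kappa> p) = \<phi> (fst p)" if "p \<in> P" for p
      using that d unfolding c by auto
    let ?S = "\<phi> ` W"
    have im: "\<kappa> ` P = ?S \<times> ((- {0}) \<times> (- {0}))"
      using chart2_image[OF c(1) subset_refl] unfolding c .
    have oP: "open (\<kappa> ` P)" by (rule smooth_atlas_chart(2)[OF smooth_atlas_B2 P])
    have oS: "open ?S" "?S \<subseteq> \<phi> ` U"
      using base_transition(1)[OF d(1,1) d(3,2) d(3,2)] d(2) by auto
    have val: "taut A p (chart_vec B2 (P, \<kappa>) p h) = \<omega> (chart_vec A (U, \<phi>) x (fst h))"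
      "taut1 A p (chart_vec B2 (P, \<kappa>) p h) = \<omega>1 (chart_vec A (U, \<phi>) x (fst h))"
      "taut2 A p (chart_vec B2 (P, \<kappa>) p h) = \<omega>2 (chart_vec A (U, \<phi>) x (fst h))"
      if "p \<in> P" "p = (x, \<omega>, \<omega>1, \<omega>2)" for p x \<omega> \<omega>1 \<omega>2 h
      using tangent_map_fst_chart[OF atlas smooth_atlas_B2 smooth_map_fst2 P that(1) d(1) P\<kappa>, of h] that(2)
      by (simp_all add: taut_def taut1_def taut2_def)
    have "linear (\<lambda>h. taut A p (chart_vec B2 (P, \<kappa>) p h)) \<and>
      linear (\<lambda>h. taut1 A p (chart_vec B2 (P, \<kappa>) p h)) \<and>
      linear (\<lambda>h. taut2 A p (chart_vec B2 (P, \<kappa>) p h))" if p: "p \<in> P" for p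
    proof -
      obtain x \<omega> \<omega>1 \<omega>2 where x: "p = (x, \<omega>, \<omega>1, \<omega>2)" by (metis prod_cases4)
      have "(x, \<omega>, \<omega>1, \<omega>2) \<in> T2" "x \<in> U" using p P\<kappa>[OF p] unfolding x c by auto
      then have lin: "linear (\<lambda>h. \<alpha> (chart_vec A (U, \<phi>) x (fst h)))" if "\<alpha> \<in> {\<omega>, \<omega>1, \<omega>2}" for \<alpha>
        using linear_compose[OF linear_fst cotangent_linear[OF atlas d(1), of x \<alpha>]]
          T2_cotangent[of x \<omega> \<omega>1 \<omega>2] that by (auto simp: o_def)
      show ?thesis unfolding val[OF p x] by (intro conjI lin) simp_all
    qed
    moreover have "smooth_on (\<kappa> ` P) (form_coeff B2 (P, \<kappa>) (taut A) h) \<and>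
      smooth_on (\<kappa> ` P) (form_coeff B2 (P, \<kappa>) (taut1 A) h) \<and>
      smooth_on (\<kappa> ` P) (form_coeff B2 (P, \<kappa>) (taut2 A) h)" for h
    proof -
      obtain \<xi>1 where \<xi>1: "smooth_on (\<phi> ` (U \<inter> W)) \<xi>1"
        "\<And>p. p \<in> U \<inter> W \<Longrightarrow> X1 p = chart_vec A (U, \<phi>) p (\<xi>1 (\<phi> p))"
        using section_coefficients[OF _ d(1)] d(4) unfolding local_section_def by metis
      obtain \<xi>2 where \<xi>2: "smooth_on (\<phi> ` (U \<inter> W)) \<xi>2"
        "\<And>p. p \<in> U \<inter> W \<Longrightarrow> X2 p = chart_vec A (U, \<phi>) p (\<xi>2 (\<phi> p))"
        using section_coefficients[OF _ d(1)] d(5) unfolding local_section_def by metis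
      have UW: "U \<inter> W = W" using d(2) by blast
      note \<xi> = \<xi>1(1)[unfolded UW] \<xi>2(1)[unfolded UW]
      obtain k where k: "smooth_on ?S k" "\<And>p. p \<in> W \<Longrightarrow> d\<theta> p (X1 p) (X2 p) = k (\<phi> p)"
      proof (rule dtheta_smooth[OF d(1) oS \<xi>])
        fix g assume g: "smooth_on ?S g" "\<And>p. p \<in> U \<Longrightarrow> \<phi> p \<in> ?S \<Longrightarrow>
          d\<theta> p (chart_vec A (U, \<phi>) p (\<xi>1 (\<phi> p))) (chart_vec A (U, \<phi>) p (\<xi>2 (\<phi> p))) = g (\<phi> p)"
        have "d\<theta> p (X1 p) (X2 p) = g (\<phi> p)" if "p \<in> W" for p
          using g(2)[of p] that \<xi>1(2)[of p] \<xi>2(2)[of p] d(2) by auto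
        with g(1) show thesis by (rule that)
      qed
      obtain k1 where k1: "smooth_on ?S k1"
        "\<And>p. p \<in> W \<Longrightarrow> d\<theta> p (chart_vec A (U, \<phi>) p (fst h)) (X2 p) = k1 (\<phi> p)"
      proof (rule dtheta_smooth[OF d(1) oS smooth_on_const \<xi>(2)])
        fix g assume g: "smooth_on ?S g" "\<And>p. p \<in> U \<Longrightarrow> \<phi> p \<in> ?S \<Longrightarrow>
          d\<theta> p (chart_vec A (U, \<phi>) p (fst h)) (chart_vec A (U, \<phi>) p (\<xi>2 (\<phi> p))) = g (\<phi> p)"
        have "d\<theta> p (chart_vec A (U, \<phi>) p (fst h)) (X2 p) = g (\<phi> p)" if "p \<in> W" for p
          using g(2)[of p] that \<xi>1(2)[of p] \<xi>2(2)[of p] d(2) by auto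
        with g(1) show thesis by (rule that)
      qed
      obtain k2 where k2: "smooth_on ?S k2"
        "\<And>p. p \<in> W \<Longrightarrow> d\<theta> p (X1 p) (chart_vec A (U, \<phi>) p (fst h)) = k2 (\<phi> p)"
      proof (rule dtheta_smooth[OF d(1) oS \<xi>(1) smooth_on_const])
        fix g assume g: "smooth_on ?S g" "\<And>p. p \<in> U \<Longrightarrow> \<phi> p \<in> ?S \<Longrightarrow>
          d\<theta> p (chart_vec A (U, \<phi>) p (\<xi>1 (\<phi> p))) (chart_vec A (U, \<phi>) p (fst h)) = g (\<phi> p)"
        have "d\<theta> p (X1 p) (chart_vec A (U, \<phi>) p (fst h)) = g (\<phi> p)" if "p \<in> W" for p
          using g(2)[of p] that \<xi>1(2)[of p] \<xi>2(2)[of p] d(2) by auto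
        with g(1) show thesis by (rule that)
      qed
      let ?t = "form_coeff A (U, \<phi>) \<theta> (fst h)"
      have t: "smooth_on ?S ?t"
        using smooth_on_subset[OF form_coeff_theta_smooth[OF d(1)] oS(2)] .
      have knz: "k y \<noteq> 0" if "y \<in> ?S" for y
      proof -
        obtain p where p: "p \<in> W" "y = \<phi> p" using \<open>y \<in> ?S\<close> by blast
        show ?thesis
          using dtheta_frame[OF section_adapted(1)[OF d(3) p(1) d(4,5) p(1)]] k(2)[OF p(1)] p(2) by simp
      qed
      note sm = smooth_on_mult smooth_on_divide smooth_on_fst_compose oS(1) open_Times open_punctured
        smooth_on_snd_compose[OF _ _ bounded_linear_fst] smooth_on_snd_compose[OF _ _ bounded_linear_snd]
        k(1) k1(1) k2(1) t
      have eqs: "fst (snd y) * snd (snd y) / k (fst y) * ?t (fst y) = form_coeff B2 (P, \<kappa>) (taut A) h y"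
        "fst (snd y) * (k1 (fst y) / k (fst y)) = form_coeff B2 (P, \<kappa>) (taut1 A) h y"
        "snd (snd y) * (k2 (fst y) / k (fst y)) = form_coeff B2 (P, \<kappa>) (taut2 A) h y"
        if y: "y \<in> \<kappa> ` P" for y
      proof -
        obtain p where p: "p \<in> P" "y = \<kappa> p" using y by blast
        obtain x \<omega> \<omega>1 \<omega>2 where x: "p = (x, \<omega>, \<omega>1, \<omega>2)" by (metis prod_cases4)
        have xT: "(x, \<omega>, \<omega>1, \<omega>2) \<in> T2" "x \<in> W" "x \<in> U" using p d(2) unfolding x c by auto
        have fr: "adapted_frame x (X1 x) (X2 x)"
          using section_adapted(1)[OF d(3) xT(2) d(4,5) xT(2)] .
        note \<Omega> = T2_values(3)[OF fr xT(1), unfolded coframe_def prod.inject]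
        have \<omega>: "\<omega> v = \<omega>1 (X1 x) * \<omega>2 (X2 x) / d\<theta> x (X1 x) (X2 x) * \<theta> x v"
          "\<omega>1 v = \<omega>1 (X1 x) * z1 x (X1 x) (X2 x) v" "\<omega>2 v = \<omega>2 (X2 x) * z2 x (X1 x) (X2 x) v" for v
          using fun_cong[OF conjunct1[OF \<Omega>], of v] fun_cong[OF conjunct1[OF conjunct2[OF \<Omega>]], of v]
            fun_cong[OF conjunct2[OF conjunct2[OF \<Omega>]], of v] .
        have y': "fst y = \<phi> x" "fst (snd y) = \<omega>1 (X1 x)" "snd (snd y) = \<omega>2 (X2 x)"
          using p x c(3) by (simp_all add: chart2_def)
        let ?v = "chart_vec A (U, \<phi>) x (fst h)"
        note T = chart_vec_in_tangent_space[OF d(1) xT(3)]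
        note fc = form_coeff_chart[OF smooth_atlas_B2 P p(1)]
        show "fst (snd y) * snd (snd y) / k (fst y) * ?t (fst y) = form_coeff B2 (P, \<kappa>) (taut A) h y"
          unfolding p(2) fc val(1)[OF p(1) x] \<omega>(1)[of ?v]
          using y' p(2) k(2)[OF xT(2)] atlas d(1) xT(3) by simp
        show "fst (snd y) * (k1 (fst y) / k (fst y)) = form_coeff B2 (P, \<kappa>) (taut1 A) h y"
          unfolding p(2) fc val(2)[OF p(1) x] \<omega>(2)[of ?v]
          using y' p(2) k(2)[OF xT(2)] k1(2)[OF xT(2)] T by (simp add: z1_def)
        show "snd (snd y) * (k2 (fst y) / k (fst y)) = form_coeff B2 (P, \<kappa>) (taut2 A) h y"
          unfolding p(2) fc val(3)[OF p(1) x] \<omega>(3)[of ?v]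
          using y' p(2) k(2)[OF xT(2)] k2(2)[OF xT(2)] T by (simp add: z2_def)
      qed
      have s: "smooth_on (\<kappa> ` P) (\<lambda>y. fst (snd y) * snd (snd y) / k (fst y) * ?t (fst y))"
        "smooth_on (\<kappa> ` P) (\<lambda>y. fst (snd y) * (k1 (fst y) / k (fst y)))"
        "smooth_on (\<kappa> ` P) (\<lambda>y. snd (snd y) * (k2 (fst y) / k (fst y)))"
        unfolding im using knz by (intro sm; auto)+
      show ?thesis
      proof (intro conjI)
        show "smooth_on (\<kappa> ` P) (form_coeff B2 (P, \<kappa>) (taut A) h)"
          by (rule smooth_on_cong[OF oP _ s(1)]) (rule eqs)
        show "smooth_on (\<kappa> ` P) (form_coeff B2 (P, \<kappa>) (taut1 A) h)"
          by (rule smooth_on_cong[OF oP _ s(2)]) (rule eqs)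
        show "smooth_on (\<kappa> ` P) (form_coeff B2 (P, \<kappa>) (taut2 A) h)"
          by (rule smooth_on_cong[OF oP _ s(3)]) (rule eqs)
      qed
    qed
    ultimately show ?thesis by blast
  qed
  have C1: "C1_form_at B2 q \<alpha>"
    if "\<And>P \<kappa> p. (P, \<kappa>) \<in> B2 \<Longrightarrow> p \<in> P \<Longrightarrow> linear (\<lambda>h. \<alpha> p (chart_vec B2 (P, \<kappa>) p h))"
      "\<And>P \<kappa> h. (P, \<kappa>) \<in> B2 \<Longrightarrow> smooth_on (\<kappa> ` P) (form_coeff B2 (P, \<kappa>) \<alpha> h)" for \<alpha>
    unfolding C1_form_at_def
  proof
    show "\<exists>W. openin (mtop B2) W \<and> q \<in> W \<and>
        (\<forall>(U, \<phi>)\<in>B2. \<forall>q\<in>U \<inter> W. linear (\<lambda>h. \<alpha> q (chart_vec B2 (U, \<phi>) q h)))"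
      using openin_points[OF smooth_atlas_B2] q that(1) points_B2 by (intro exI[of _ T2]) auto
    show "\<forall>(U, \<phi>)\<in>B2. q \<in> U \<longrightarrow> (\<forall>h. form_coeff B2 (U, \<phi>) \<alpha> h differentiable (at (\<phi> q)))"
      using smooth_on_differentiable[OF that(2)] by blast
  qed
  show "C1_form_at B2 q (taut A)" "C1_form_at B2 q (taut1 A)" "C1_form_at B2 q (taut2 A)"
    by (rule C1; use * in blast)+
qed

end

text \<open>Here \<open>p0, p1, p2\<close> are the tautological forms, \<open>a\<close> is the connection form of \<open>Y\<^sub>1\<close>, and \<open>f, b\<close> are the
  pullbacks of \<open>\<phi>, w\<close>; the equations are instantiated at \<open>(u, e0)\<close>, \<open>(u, e1)\<close> and \<open>(u, e2)\<close>.\<close>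

lemma structure_equations_unique:
  fixes p0 p1 p2 f a b t1 t2 :: "'v \<Rightarrow> real"
  assumes e: "e0 \<in> T" "e1 \<in> T" "e2 \<in> T"
    and dual: "p0 e0 = 1" "p0 e1 = 0" "p0 e2 = 0" "p1 e0 = 0" "p1 e1 = 1" "p1 e2 = 0"
      "p2 e0 = 0" "p2 e1 = 0" "p2 e2 = 1"
    and I: "\<And>u v. u \<in> T \<Longrightarrow> v \<in> T \<Longrightarrow> f u * p0 v - f v * p0 u = 0"
    and II: "\<And>u v. u \<in> T \<Longrightarrow> v \<in> T \<Longrightarrow>
      3 * (a u * p1 v - a v * p1 u) + (p0 u * t1 v - p0 v * t1 u) =
      (f u * p1 v - f v * p1 u) + 3 * (b u * p1 v - b v * p1 u) + (p0 u * (r1 * p2 v) - p0 v * (r1 * p2 u))"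
    and III: "\<And>u v. u \<in> T \<Longrightarrow> v \<in> T \<Longrightarrow>
      - 3 * (a u * p2 v - a v * p2 u) - (p0 u * t2 v - p0 v * t2 u) =
      (f u * p2 v - f v * p2 u) - 3 * (b u * p2 v - b v * p2 u) - (p0 u * (r2 * p1 v) - p0 v * (r2 * p1 u))"
    and IV: "\<And>u v. u \<in> T \<Longrightarrow> v \<in> T \<Longrightarrow> t1 u * p2 v - t1 v * p2 u = 0"
    and V: "\<And>u v. u \<in> T \<Longrightarrow> v \<in> T \<Longrightarrow> t2 u * p1 v - t2 v * p1 u = 0"
    and u: "u \<in> T"
  shows "f u = 0" "b u = a u"
proof -
  \<comment> \<open>Together with duality these values make the torsion terms vanish on the pairs
    \<open>(v, e1)\<close> of \<open>II\<close> and \<open>(v, e2)\<close> of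
    \<open>III\<close>.\<close>
  have t: "t1 e1 = 0" "t2 e2 = 0"
    using IV[OF e(2,3)] V[OF e(3,2)] dual by simp_all
  have f: "f e1 = 0" "f e2 = 0" and f0: "f v = f e0 * p0 v" if "v \<in> T" for v
    using I[OF e(2,1)] I[OF e(3,1)] I[OF that e(1)] dual by simp_all
  have 1: "f v + 3 * (b v - a v) = 3 * (b e1 - a e1) * p1 v" if "v \<in> T" for v
    using II[OF that e(2)] dual t f[OF that] by (simp add: algebra_simps)
  have 2: "f v - 3 * (b v - a v) = - (3 * (b e2 - a e2) * p2 v)" if "v \<in> T" for v
    using III[OF that e(3)] dual t f[OF that] by (simp add: algebra_simps)
  \<comment> \<open>At \<open>e0\<close> both right-hand sides vanish, and the two equations add up
    to \<open>2 * f e0 = 0\<close>.\<close>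
  have "f e0 = 0" using 1[OF e(1)] 2[OF e(1)] dual by simp
  then show fu: "f u = 0" using f0[OF u] by simp
  \<comment> \<open>The equation with \<open>p2\<close>, taken at \<open>e1\<close>, kills the
    factor on the right of the equation with \<open>p1\<close>; that equation then holds with
    right-hand side 0 at every \<open>u\<close>, vertical or not.\<close>
  have "b e1 = a e1" using 2[OF e(2)] dual f[OF u] by simp
  then show "b u = a u" using 1[OF u] fu by simp
qed

context strict_path
begin

text \<open>Lifts of the Reeb vector and of \<open>X1\<close>, \<open>X2\<close> divided by their
  fibre coordinates. Any lift will do, since the tautological forms vanish on vertical
  vectors.\<close>

lemma dual_vectors:
  assumes q: "q \<in> T1"
  obtains e0 e1 e2 where "e0 \<in> tangent_space B1 q" "e1 \<in> tangent_space B1 q" "e2 \<in> tangent_space B1 q"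
    "taut A q e0 = 1" "taut A q e1 = 0" "taut A q e2 = 0"
    "taut1 A q e0 = 0" "taut1 A q e1 = 1" "taut1 A q e2 = 0"
    "taut2 A q e0 = 0" "taut2 A q e1 = 0" "taut2 A q e2 = 1"
proof -
  obtain x \<omega> \<omega>1 \<omega>2 where x: "q = (x, \<omega>, \<omega>1, \<omega>2)" by (metis prod_cases4)
  obtain X1 X2 where fr: "adapted_frame x X1 X2"
    using adapted_frame_exists T1_fst[OF q] x by auto
  note F = adapted_frame_tangent[OF fr] reeb_tangent[OF fr]
  have q2: "(x, \<omega>, \<omega>1, \<omega>2) \<in> T2" using q x T1_subset_T2 by auto
  note nz = T2_values(1,2)[OF fr q2] and \<Omega> = T2_values(3)[OF fr q2] and cot = T2_cotangent[OF q2]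
  have \<omega>: "\<omega> = \<theta> x" using T1_values(1)[OF fr] q x by simp
  have z: "\<omega>1 X2 = 0" "\<omega>1 (reeb A \<theta> x) = 0" "\<omega>2 X1 = 0" "\<omega>2 (reeb A \<theta> x) = 0"
    using coframe_def[of x X1 X2 "\<omega>1 X1" "\<omega>2 X2"] \<Omega> dual_frame_values[OF fr]
    by (metis mult_zero_right prod.inject)+
  obtain e0 where e0: "e0 \<in> tangent_space B1 q" "tangent_map A fst q e0 = reeb A \<theta> x"
    using tangent_map_fst_surj[OF q] F(3) x by (metis fst_conv)
  obtain e1 where e1: "e1 \<in> tangent_space B1 q" "tangent_map A fst q e1 = vscale (1 / \<omega>1 X1) X1"
    using tangent_map_fst_surj[OF q] vscale_in_tangent_space[OF atlas F(1)] x by (metis fst_conv)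
  obtain e2 where e2: "e2 \<in> tangent_space B1 q" "tangent_map A fst q e2 = vscale (1 / \<omega>2 X2) X2"
    using tangent_map_fst_surj[OF q] vscale_in_tangent_space[OF atlas F(2)] x by (metis fst_conv)
  show ?thesis
    using e0 e1 e2 nz z F reeb_theta[OF fr] dual_frame_values(7,8)[OF fr]
    by (intro that[of e0 e1 e2])
      (simp_all add: taut_def taut1_def taut2_def x cotangentD(2)[OF cot(1)] cotangentD(2)[OF cot(2)]
        cotangentD(2)[OF cot(3)], simp_all add: \<omega>)
qed

lemma pullback_connection_forms:
  assumes w1: "Y1_connection_form A B1 w1" and w2: "Y2_connection_forms A B2 \<phi> w2"
    and u: "u \<in> tangent_space B1 q"
  shows "pullback B2 \<iota> \<phi> q u = 0" "pullback B2 \<iota> w2 q u = w1 q u"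
proof -
  have q: "q \<in> T1" using tangent_space_points[OF u] points_B1 by simp
  then have q2: "q \<in> T2" using T1_subset_T2 by blast
  obtain \<tau>1 \<tau>2 where S1: "\<forall>q\<in>points B1. \<forall>u\<in>tangent_space B1 q. \<forall>v\<in>tangent_space B1 q.
           let \<omega> = taut A q; \<omega>1 = taut1 A q; \<omega>2 = taut2 A q in
             ext_d B1 (taut A) q u v = wedge \<omega>1 \<omega>2 u v \<and>
             ext_d B1 (taut1 A) q u v = 3 * wedge (w1 q) \<omega>1 u v + wedge \<omega> (\<tau>1 q) u v \<and>
             ext_d B1 (taut2 A) q u v = - 3 * wedge (w1 q) \<omega>2 u v - wedge \<omega> (\<tau>2 q) u v \<and>
             wedge (\<tau>1 q) \<omega>2 u v = 0 \<and> wedge (\<tau>2 q) \<omega>1 u v = 0"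
    using w1 unfolding Y1_connection_form_def by blast
  obtain \<tau>12 \<tau>21 where S2: "\<forall>q\<in>points B2. \<forall>u\<in>tangent_space B2 q. \<forall>v\<in>tangent_space B2 q.
           let \<omega> = taut A q; \<omega>1 = taut1 A q; \<omega>2 = taut2 A q;
               \<tau>1 = (\<lambda>z. \<tau>12 q * \<omega>2 z); \<tau>2 = (\<lambda>z. \<tau>21 q * \<omega>1 z) in
             ext_d B2 (taut A) q u v = 2 * wedge (\<phi> q) \<omega> u v + wedge \<omega>1 \<omega>2 u v \<and>
             ext_d B2 (taut1 A) q u v =
               wedge (\<phi> q) \<omega>1 u v + 3 * wedge (w2 q) \<omega>1 u v + wedge \<omega> \<tau>1 u v \<and>
             ext_d B2 (taut2 A) q u v =
               wedge (\<phi> q) \<omega>2 u v - 3 * wedge (w2 q) \<omega>2 u v - wedge \<omega> \<tau>2 u v"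
    using w2 unfolding Y2_connection_forms_def by blast
  let ?T = "tangent_space B1 q" and ?D = "tangent_map B2 \<iota> q"
  let ?p0 = "taut A q" and ?p1 = "taut1 A q" and ?p2 = "taut2 A q"
  \<comment> \<open>The point is the same in both bundles, but tangent vectors are derivations
    relative to the respective atlas, so \<open>?D\<close> stays in all that follows.\<close>
  have \<iota>q: "\<iota> q = q" using q by simp
  have D: "?D v \<in> tangent_space B2 q" if "v \<in> ?T" for v
    using tangent_map_in_tangent_space[OF smooth_atlas_B1 smooth_atlas_B2 smooth_map_\<iota> that] \<iota>q by simp
  have p: "?p0 (?D v) = ?p0 v" "?p1 (?D v) = ?p1 v" "?p2 (?D v) = ?p2 v" if "v \<in> ?T" for v
    using form_eq_taut_\<iota> q that \<iota>q points_B1 by (auto simp: form_eq_def pullback_def)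
  have ext: "ext_d B1 (taut A) q u v = ext_d B2 (taut A) q (?D u) (?D v)"
    "ext_d B1 (taut1 A) q u v = ext_d B2 (taut1 A) q (?D u) (?D v)"
    "ext_d B1 (taut2 A) q u v = ext_d B2 (taut2 A) q (?D u) (?D v)"
    if "u \<in> ?T" "v \<in> ?T" for u v
    using ext_d_pullback[OF smooth_atlas_B1 smooth_atlas_B2 smooth_map_\<iota> _ form_eq_taut_\<iota>(1) that]
      ext_d_pullback[OF smooth_atlas_B1 smooth_atlas_B2 smooth_map_\<iota> _ form_eq_taut_\<iota>(2) that]
      ext_d_pullback[OF smooth_atlas_B1 smooth_atlas_B2 smooth_map_\<iota> _ form_eq_taut_\<iota>(3) that]
      C1_taut[OF q2] \<iota>q by simp_all
  have S1': "ext_d B1 (taut A) q u v = wedge ?p1 ?p2 u v"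
    "ext_d B1 (taut1 A) q u v = 3 * wedge (w1 q) ?p1 u v + wedge ?p0 (\<tau>1 q) u v"
    "ext_d B1 (taut2 A) q u v = - 3 * wedge (w1 q) ?p2 u v - wedge ?p0 (\<tau>2 q) u v"
    "wedge (\<tau>1 q) ?p2 u v = 0" "wedge (\<tau>2 q) ?p1 u v = 0" if "u \<in> ?T" "v \<in> ?T" for u v
    using S1 that q points_B1 unfolding Let_def by blast+
  have S2': "ext_d B2 (taut A) q u v = 2 * wedge (\<phi> q) ?p0 u v + wedge ?p1 ?p2 u v"
    "ext_d B2 (taut1 A) q u v =
       wedge (\<phi> q) ?p1 u v + 3 * wedge (w2 q) ?p1 u v + wedge ?p0 (\<lambda>z. \<tau>12 q * ?p2 z) u v"
    "ext_d B2 (taut2 A) q u v =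
       wedge (\<phi> q) ?p2 u v - 3 * wedge (w2 q) ?p2 u v - wedge ?p0 (\<lambda>z. \<tau>21 q * ?p1 z) u v"
    if "u \<in> tangent_space B2 q" "v \<in> tangent_space B2 q" for u v
    using S2 that q2 points_B2 unfolding Let_def by blast+
  obtain e0 e1 e2 where e: "e0 \<in> ?T" "e1 \<in> ?T" "e2 \<in> ?T"
    and dual: "?p0 e0 = 1" "?p0 e1 = 0" "?p0 e2 = 0" "?p1 e0 = 0" "?p1 e1 = 1" "?p1 e2 = 0"
      "?p2 e0 = 0" "?p2 e1 = 0" "?p2 e2 = 1"
    using dual_vectors[OF q] .
  have "\<phi> q (?D u) = 0 \<and> w2 q (?D u) = w1 q u"
  proof (rule conjI)
    \<comment> \<open>On \<open>Y1\<close> the equation for \<open>d\<omega>\<close> has no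
      connection term, so the pullback of \<open>2 * \<phi> \<and> \<omega>\<close> must
      vanish.\<close>
    have I: "\<phi> q (?D u) * ?p0 v - \<phi> q (?D v) * ?p0 u = 0" if "u \<in> ?T" "v \<in> ?T" for u v
      using S1'(1)[OF that] S2'(1)[OF D[OF that(1)] D[OF that(2)]] ext(1)[OF that] p[OF that(1)] p[OF that(2)]
      by (simp add: wedge_def)
    have II: "3 * (w1 q u * ?p1 v - w1 q v * ?p1 u) + (?p0 u * \<tau>1 q v - ?p0 v * \<tau>1 q u) =
      (\<phi> q (?D u) * ?p1 v - \<phi> q (?D v) * ?p1 u) + 3 * (w2 q (?D u) * ?p1 v - w2 q (?D v) * ?p1 u)
      + (?p0 u * (\<tau>12 q * ?p2 v) - ?p0 v * (\<tau>12 q * ?p2 u))" if "u \<in> ?T" "v \<in> ?T" for u v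
      using S1'(2)[OF that] S2'(2)[OF D[OF that(1)] D[OF that(2)]] ext(2)[OF that] p[OF that(1)] p[OF that(2)]
      by (simp add: wedge_def)
    have III: "- 3 * (w1 q u * ?p2 v - w1 q v * ?p2 u) - (?p0 u * \<tau>2 q v - ?p0 v * \<tau>2 q u) =
      (\<phi> q (?D u) * ?p2 v - \<phi> q (?D v) * ?p2 u) - 3 * (w2 q (?D u) * ?p2 v - w2 q (?D v) * ?p2 u)
      - (?p0 u * (\<tau>21 q * ?p1 v) - ?p0 v * (\<tau>21 q * ?p1 u))" if "u \<in> ?T" "v \<in> ?T" for u v
      using S1'(3)[OF that] S2'(3)[OF D[OF that(1)] D[OF that(2)]] ext(3)[OF that] p[OF that(1)] p[OF that(2)]
      by (simp add: wedge_def)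
    have IV: "\<tau>1 q u * ?p2 v - \<tau>1 q v * ?p2 u = 0" "\<tau>2 q u * ?p1 v - \<tau>2 q v * ?p1 u = 0"
      if "u \<in> ?T" "v \<in> ?T" for u v
      using S1'(4,5)[OF that] by (simp_all add: wedge_def)
    note * = structure_equations_unique[of e0 ?T e1 e2 ?p0 ?p1 ?p2 "\<lambda>v. \<phi> q (?D v)" "w1 q" "\<tau>1 q"
        "\<lambda>v. w2 q (?D v)" "\<tau>12 q" "\<tau>2 q" "\<tau>21 q", OF e dual I II III IV u]
    show "\<phi> q (?D u) = 0" "w2 q (?D u) = w1 q u" using * by blast+
  qed
  then show "pullback B2 \<iota> \<phi> q u = 0" "pullback B2 \<iota> w2 q u = w1 q u"
    using \<iota>q by (simp_all add: pullback_def)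
qed

end

theorem proposition2p7:
  fixes A :: "('a, real^3) chart set"
    and E1 E2 :: "'a \<Rightarrow> 'a tvec set"
    and \<theta> :: "'a \<Rightarrow> 'a covec"
  assumes "smooth_manifold A"
    and "strict_path_structure A E1 E2 \<theta>"
  shows "(\<exists>!\<iota>. tautological_embedding A (Y1 A E1 E2 \<theta>) (Y2 A E1 E2 (reeb_line A \<theta>)) \<iota>) \<and>
    (\<forall>\<iota> w1 \<phi> w2.
       tautological_embedding A (Y1 A E1 E2 \<theta>) (Y2 A E1 E2 (reeb_line A \<theta>)) \<iota> \<longrightarrow>
       Y1_connection_form A (Y1 A E1 E2 \<theta>) w1 \<longrightarrow>
       Y2_connection_forms A (Y2 A E1 E2 (reeb_line A \<theta>)) \<phi> w2 \<longrightarrow>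
       form_eq (Y1 A E1 E2 \<theta>) (pullback (Y2 A E1 E2 (reeb_line A \<theta>)) \<iota> \<phi>) (\<lambda>q v. 0) \<and>
       form_eq (Y1 A E1 E2 \<theta>) (pullback (Y2 A E1 E2 (reeb_line A \<theta>)) \<iota> w2) w1)"
proof -
  interpret strict_path A E1 E2 \<theta>
    using assms by unfold_locales (simp_all add: smooth_manifold_imp_atlas)
  show ?thesis
  proof (intro conjI allI impI)
    show "\<exists>!\<iota>. tautological_embedding A B1 B2 \<iota>"
      using tautological_embedding_\<iota> tautological_embedding_unique by blast
  next
    fix F w1 \<phi> w2
    assume "tautological_embedding A B1 B2 F" and w: "Y1_connection_form A B1 w1" "Y2_connection_forms A B2 \<phi> w2"
    then have "F = \<iota>" by (intro tautological_embedding_unique)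
    then show "form_eq B1 (pullback B2 F \<phi>) (\<lambda>q v. 0)" "form_eq B1 (pullback B2 F w2) w1"
      using pullback_connection_forms[OF w] by (simp_all add: form_eq_def)
  qed
qed

end
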